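(* Let $N$ be a positive integer. Let $A$ and $B$ be finite sets of nonzero complex numbers such that $A$, $B$, $1/A$, $1/B$ are pairwise disjoint, and let $\lambda=(\lambda_1,\dots,\lambda_N)$ be a dominant weight of length $N$. Then $$\mathcal{M}_N(A,B;\lambda)=\sum_{\substack{U\subseteq A,\ V\subseteq B\\ |U|=|V|}}(UV)^N\, Z_\lambda\big(A\setminus U\cup \tfrac1V,\ B\setminus V\cup\tfrac1U\big),$$ where $Z_\lambda(C,D):=s_{\mu'}(-C)\,s_{\nu'}(-D)\,Z(C,D)$, with $\mu=(\max\{\lambda_1,0\},\dots,\max\{\lambda_N,0\})$, $\nu=(\max\{-\lambda_N,0\},\max\{-\lambda_{N-1},0\},\dots,\max\{-\lambda_1,0\})$, and $\mu',\nu'$ their conjugate partitions. More generally, this identity holds for any finite multisets $A$ and $B$ of complex numbers, without any restrictions, provided the right-hand side is interpreted as its analytic continuation.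
   Context: A dominant weight of length $n$ is an $n$-tuple of integers $\lambda_1\ge\cdots\ge\lambda_n$; $s_\lambda(x_1,\dots,x_n)=\det(x_j^{n-k+\lambda_k})/\det(x_j^{n-k})$ ($1\le j,k\le n$), which is the usual Schur polynomial when $\lambda$ is a partition. The twisted moment is $\mathcal{M}_N(A,B;\lambda)=\int_{U(N)}\prod_{\alpha\in A}\det(I-\alpha g^* )\prod_{\beta\in B}\det(I-\beta g)\,s_\lambda(t_1,\dots,t_N)\,dg$ with $dg$ the Haar probability measure on $U(N)$ and $t_1,\dots,t_N$ the eigenvalues of $g$ (with multiplicity); products count multiplicity. Notation: $Z(C,D)=\prod_{c\in C}\prod_{d\in D}(1-cd)^{-1}$; for finite multisets $U,V$ and integer $m$, $(UV)^m=\prod_{u\in U}u^m\prod_{v\in V}v^m$; $1/U=\{u^{-1}:u\in U\}$; $-E=\{-e:e\in E\}$. For a multiset $E=\{e_1,\dots,e_k\}$ and a partition $\rho$, $s_\rho(E)=s_\rho(e_1,\dots,e_k)$, which is $0$ if the length (number of positive parts) of $\rho$ exceeds $k$; for the empty set, $s_0(\emptyset)=1$ and $s_\rho(\emptyset)=0$ for $\rho\neq0$. *)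

theory Defs
  imports "HOL-Analysis.Analysis" "Jordan_Normal_Form.Determinant"
begin

text \<open>
  \<^const>\<open>Determinants.det\<close> is the determinant for type-indexed square matrices; it is used on
  \<open>U(N)\<close>, where \<open>N = CARD('n)\<close>.  \<^const>\<open>Determinant.det\<close> is used for the determinants in the
  Schur functions, whose size depends on the number of variables.
\<close>

section \<open>Schur functions\<close>

definition alternant :: "nat \<Rightarrow> (nat \<Rightarrow> int) \<Rightarrow> (nat \<Rightarrow> complex) \<Rightarrow> complex" where
  "alternant n l x = Determinant.det
     (Matrix.mat n n (\<lambda>(j, k). x j powi (int n - 1 - int k + l k)))"

text \<open>
  Variables and parts are indexed from \<open>0\<close>, so \<open>n - k\<close> becomes \<open>n - 1 - k\<close>.  The quotient of
  determinants is a (Laurent) polynomial; where the Vandermonde determinant in the denominator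
  vanishes, its value is the limit of the quotient.  Only the entries of \<open>l\<close> and \<open>x\<close> below \<open>n\<close>
  matter.
\<close>

definition schur :: "nat \<Rightarrow> (nat \<Rightarrow> int) \<Rightarrow> (nat \<Rightarrow> complex) \<Rightarrow> complex" where
  "schur n l x =
     (let vdm = alternant n (\<lambda>_. 0); quot = (\<lambda>y. alternant n l y / vdm y)
      in if vdm x \<noteq> 0 then quot x else Lim (at x within {y. vdm y \<noteq> 0}) quot)"

text \<open>Schur functions are symmetric, so the chosen enumeration of the multiset is immaterial.\<close>

definition enum_mset :: "'a multiset \<Rightarrow> nat \<Rightarrow> 'a" where
  "enum_mset E = nth (SOME xs. mset xs = E)"

definition dominant_weight :: "int list \<Rightarrow> bool" where
  "dominant_weight lam \<longleftrightarrow> sorted_wrt (\<ge>) lam"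

text \<open>Here \<open>E\<close> is meant to have \<open>length lam\<close> elements.\<close>

definition schur_weight :: "int list \<Rightarrow> complex multiset \<Rightarrow> complex" where
  "schur_weight lam E = schur (length lam) (nth lam) (enum_mset E)"

text \<open>Partitions are weakly decreasing lists, possibly with trailing zeros.\<close>

definition part_length :: "nat list \<Rightarrow> nat" where
  "part_length \<rho> = length (filter (\<lambda>r. 0 < r) \<rho>)"

definition schur_partition :: "nat list \<Rightarrow> complex multiset \<Rightarrow> complex" where
  "schur_partition \<rho> E =
     (if part_length \<rho> > size E then 0
      else schur (size E) (\<lambda>k. if k < length \<rho> then int (\<rho> ! k) else 0) (enum_mset E))"

definition conj_partition :: "nat list \<Rightarrow> nat list" where
  "conj_partition \<rho> = map (\<lambda>j. card {i. i < length \<rho> \<and> j < \<rho> ! i}) [0..<fold max \<rho> 0]"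

definition pos_part :: "int list \<Rightarrow> nat list" where
  "pos_part lam = map (\<lambda>l. nat (max l 0)) lam"

definition neg_part :: "int list \<Rightarrow> nat list" where
  "neg_part lam = map (\<lambda>l. nat (max (- l) 0)) (rev lam)"


section \<open>The unitary group and twisted moments\<close>

definition conj_transpose :: "complex^'n^'n \<Rightarrow> complex^'n^'n" where
  "conj_transpose g = (\<chi> i j. cnj (g $ j $ i))"

definition unitary_group :: "(complex^'n^'n) set" where
  "unitary_group = {g. g ** conj_transpose g = Finite_Cartesian_Product.mat 1 \<and>
                       conj_transpose g ** g = Finite_Cartesian_Product.mat 1}"

definition haar_prob :: "(complex^'n^'n) measure \<Rightarrow> bool" where
  "haar_prob M \<longleftrightarrow>
     emeasure M (space M) = 1 \<and>
     sets M = sets (restrict_space borel unitary_group) \<and>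
     (\<forall>h\<in>unitary_group. distr M M (\<lambda>g. h ** g) = M)"

definition charpoly :: "complex^'n^'n \<Rightarrow> complex poly" where
  "charpoly g = Determinants.det (\<chi> i j. (if i = j then [:0, 1:] else 0) - [:g $ i $ j:])"

definition eigenvalues_mset :: "complex^'n^'n \<Rightarrow> complex multiset" where
  "eigenvalues_mset g = proots (charpoly g)"

definition twisted_moment ::
    "(complex^'n^'n) measure \<Rightarrow> complex multiset \<Rightarrow> complex multiset \<Rightarrow> int list \<Rightarrow> complex" where
  "twisted_moment M A B lam =
     (LINT g|M.
        (\<Prod>\<alpha>\<in>#A. Determinants.det (Finite_Cartesian_Product.mat 1 -
                     Finite_Cartesian_Product.mat \<alpha> ** conj_transpose g)) *
        (\<Prod>\<beta>\<in>#B. Determinants.det (Finite_Cartesian_Product.mat 1 -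
                     Finite_Cartesian_Product.mat \<beta> ** g)) *
        schur_weight lam (eigenvalues_mset g))"


section \<open>The swap sum\<close>

definition Z :: "complex multiset \<Rightarrow> complex multiset \<Rightarrow> complex" where
  "Z C D = (\<Prod>c\<in>#C. \<Prod>d\<in>#D. inverse (1 - c * d))"

definition Z_weight :: "int list \<Rightarrow> complex multiset \<Rightarrow> complex multiset \<Rightarrow> complex" where
  "Z_weight lam C D =
     schur_partition (conj_partition (pos_part lam)) (image_mset uminus C) *
     schur_partition (conj_partition (neg_part lam)) (image_mset uminus D) *
     Z C D"

definition swap_sum :: "int list \<Rightarrow> complex set \<Rightarrow> complex set \<Rightarrow> complex" where
  "swap_sum lam A B =
     (\<Sum>(U, V) \<in> {(U, V). U \<subseteq> A \<and> V \<subseteq> B \<and> card U = card V}.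
        ((\<Prod>u\<in>U. u ^ length lam) * (\<Prod>v\<in>V. v ^ length lam)) *
        Z_weight lam (mset_set (A - U) + image_mset inverse (mset_set V))
                     (mset_set (B - V) + image_mset inverse (mset_set U)))"

definition generic :: "complex set \<Rightarrow> complex set \<Rightarrow> bool" where
  "generic A B \<longleftrightarrow>
     finite A \<and> finite B \<and> 0 \<notin> A \<and> 0 \<notin> B \<and>
     A \<inter> B = {} \<and> A \<inter> inverse ` A = {} \<and> A \<inter> inverse ` B = {} \<and>
     B \<inter> inverse ` A = {} \<and> B \<inter> inverse ` B = {} \<and> inverse ` A \<inter> inverse ` B = {}"


section \<open>Analytic continuation\<close>

text \<open>
  Points of \<open>\<complex>\<^sup>m\<close>, and likewise exponents of monomials in \<open>m\<close> variables, are lists of length \<open>m\<close>.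
  A function on \<open>\<complex>\<^sup>m\<close> is analytic if it is given near every point by a convergent power series.
\<close>

definition analytic_everywhere :: "nat \<Rightarrow> (complex list \<Rightarrow> complex) \<Rightarrow> bool" where
  "analytic_everywhere m F \<longleftrightarrow>
     (\<forall>z. length z = m \<longrightarrow>
       (\<exists>r>0. \<exists>c. \<forall>w. length w = m \<and> (\<forall>i<m. norm (w ! i - z ! i) < r) \<longrightarrow>
          ((\<lambda>a. c a * (\<Prod>i<m. (w ! i - z ! i) ^ (a ! i))) has_sum F w)
            {a :: nat list. length a = m}))"

text \<open>
  The first \<open>p\<close> coordinates list the elements of \<open>A\<close> and the last \<open>q\<close> those of \<open>B\<close>.  The swap sum
  is a function on the open, dense and connected set of points for which \<open>A\<close> and \<open>B\<close> are sets (of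
  cardinalities \<open>p\<close> and \<open>q\<close>) in general position; it is continued from there to all of
  \<open>\<complex>\<^sup>p\<^sup>+\<^sup>q\<close>.
\<close>

definition swap_sum_continuation ::
    "int list \<Rightarrow> nat \<Rightarrow> nat \<Rightarrow> (complex list \<Rightarrow> complex) \<Rightarrow> bool" where
  "swap_sum_continuation lam p q F \<longleftrightarrow>
     analytic_everywhere (p + q) F \<and>
     (\<forall>as bs. length as = p \<and> length bs = q \<and> distinct as \<and> distinct bs \<and>
              generic (set as) (set bs) \<longrightarrow>
        F (as @ bs) = swap_sum lam (set as) (set bs))"

end

theory Submission
  imports Defs "HOL-Computational_Algebra.Fundamental_Theorem_Algebra"
    "HOL-Combinatorics.Multiset_Permutations"
begin

text \<open>
  Both sides are evaluated as one Toeplitz-type determinant.  The product of the characteristic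
  polynomials is \<open>\<Prod>\<^sub>j h(t\<^sub>j)\<close> for the Laurent polynomial
  \<open>h(x) = \<Prod>\<^sub>\<alpha> (1 - \<alpha>/x) \<Prod>\<^sub>\<beta> (1 - \<beta> x) = \<Sum>\<^sub>i c\<^sub>i x\<^sup>i\<close>, so the integrand is a
  combination of quotients of alternants, and the integral of the quotient with exponents \<open>e\<close> is
  the sign of \<open>e\<close> as an arrangement of \<open>0, \<dots>, N - 1\<close>, or zero if it is none.  This gives
  \<open>det (c\<^sub>i)\<close> with \<open>i = k - j - \<lambda>\<^sub>k\<close>.

  The integrals are computed without the Weyl integration formula.  A quotient of alternants is, up to
  sign and a power of \<open>det g\<close>, a determinant of coefficients of \<open>X\<^sup>k \<chi>\<close>, where \<open>\<chi>\<close> is the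
  characteristic polynomial, at the complementary exponents; these determinants are generated by
  \<open>\<Prod>\<^sub>a \<chi>(x\<^sub>a)\<close>.  Translation by a reflection \<open>1 + (z - 1) w w\<^sup>*\<close> yields identities for the means of
  this product times traces of resolvents, hence, as traces of resolvents are logarithmic derivatives
  of \<open>\<chi>\<close>, two differential equations for its mean.  They say that a nonvanishing integral
  determines the sum and the sum of squares of the exponents, which leaves only consecutive ones.

  In general position the determinant is, by the same complementary minors, the quotient of alternants
  in the variables \<open>A \<union> 1/B\<close>.  Splitting these into \<open>card A\<close> variables carrying the first exponents
  and \<open>card B\<close> variables carrying the others is the sum over the swaps \<open>(U, V)\<close>.  The determinant is a
  polynomial in the elements of \<open>A\<close> and \<open>B\<close>, which settles the continuation.
\<close>

section \<open>Alternants with complementary exponents\<close>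

text \<open>At a matrix with repeated eigenvalues the quotient of alternants is only a limit, and
  the chosen enumeration of the eigenvalues has no continuity in \<open>g\<close>. Complementary
  exponents remove both difficulties: determinants of coefficients of the characteristic polynomial
  are polynomials in the entries of \<open>g\<close>, hence integrable, and they are the
  coefficients of a function of auxiliary variables that can be differentiated. The differential
  equations are of first and second order because they come from the coefficients of
  \<open>z - 1\<close> and \<open>(z - 1)^2\<close>. They play the part of the determinant character
  and of the Casimir operator: among \<open>n\<close> distinct integers e, the sum of e (e - (n -
  1)) attains its minimum at 0, ..., n - 1 only. No normalizing constant has to be computed, since
  for consecutive exponents the quotient is a constant sign and the measure has total mass one. For
  all other exponents it is enough to see that the integral vanishes.\<close>

definition power_alternant :: "nat \<Rightarrow> (nat \<Rightarrow> nat) \<Rightarrow> (nat \<Rightarrow> complex) \<Rightarrow> complex" where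
  "power_alternant n l t = Determinant.det (Matrix.mat n n (\<lambda>(j, k). t j ^ l k))"

definition root_poly :: "nat \<Rightarrow> (nat \<Rightarrow> complex) \<Rightarrow> complex poly" where
  "root_poly n t = (\<Prod>j<n. [:- t j, 1:])"

definition coeff_det :: "nat \<Rightarrow> complex poly \<Rightarrow> (nat \<Rightarrow> nat) \<Rightarrow> complex" where
  "coeff_det m q s = Determinant.det (Matrix.mat m m (\<lambda>(a, k). coeff (monom 1 k * q) (s a)))"

lemma det_permute_cols:
  fixes A :: "'a :: comm_ring_1 Matrix.mat"
  assumes A: "A \<in> carrier_mat n n" and p: "p permutes {0..<n}"
  shows "Determinant.det (Matrix.mat n n (\<lambda>(i, j). A $$ (i, p j))) = signof p * Determinant.det A"
proof -
  have "Determinant.det (Matrix.mat n n (\<lambda>(i, j). A $$ (i, p j)))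
      = Determinant.det (transpose_mat (Matrix.mat n n (\<lambda>(i, j). A $$ (i, p j))))"
    by (rule Determinant.det_transpose[symmetric]) auto
  also have "transpose_mat (Matrix.mat n n (\<lambda>(i, j). A $$ (i, p j)))
      = Matrix.mat n n (\<lambda>(i, j). transpose_mat A $$ (p i, j))"
    using A permutes_in_image[OF p] by (intro eq_matI) auto
  also have "Determinant.det \<dots> = signof p * Determinant.det (transpose_mat A)"
    using A by (intro Determinant.det_permute_rows p) auto
  finally show ?thesis using Determinant.det_transpose[OF A] by simp
qed

lemma degree_root_poly: "degree (root_poly n t) = n"
  unfolding root_poly_def by (subst degree_prod_sum_eq) auto

lemma lead_coeff_root_poly: "coeff (root_poly n t) n = 1"
proof -
  have "lead_coeff (root_poly n t) = 1"
    unfolding root_poly_def by (subst lead_coeff_prod) auto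
  then show ?thesis by (simp add: degree_root_poly)
qed

lemma poly_root_poly: "poly (root_poly n t) x = (\<Prod>j<n. x - t j)"
  by (simp add: root_poly_def poly_prod algebra_simps)

text \<open>
  Expanding the polynomials of degree below \<open>n + m\<close> in the basis
  \<open>1, X, \<dots>, X\<^sup>n\<^sup>-\<^sup>1, q, X q, \<dots>, X\<^sup>m\<^sup>-\<^sup>1 q\<close>, where \<open>q\<close> vanishes at the points \<open>t j\<close>, makes the matrix of
  evaluations at the \<open>t j\<close> and of the coefficients at the complementary exponents block triangular.
\<close>

lemma power_alternant_complement:
  assumes p: "p permutes {0..<n + m}"
  shows "power_alternant n p t =
    signof p * coeff_det m (root_poly n t) (\<lambda>a. p (n + a)) * power_alternant n (\<lambda>k. k) t"
proof -
  define q where "q = root_poly n t"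
  define b where "b c = (if c < n then monom 1 c else monom 1 (c - n) * q)" for c
  define A where "A = Matrix.mat (n + m) (n + m) (\<lambda>(i, k). if i < n then t i ^ k else if k = p i then 1 else 0)"
  define U where "U = Matrix.mat (n + m) (n + m) (\<lambda>(i, c). coeff (b c) i)"
  have dq: "degree q = n" and lq: "coeff q n = 1"
    by (simp_all add: q_def degree_root_poly lead_coeff_root_poly)
  have q0: "q \<noteq> 0" using lq by auto
  have db: "degree (b c) = c" for c
  proof (cases "c < n")
    case False
    then have "degree (monom 1 (c - n) * q) = c"
      using q0 by (subst degree_mult_eq) (auto simp: dq degree_monom_eq)
    then show ?thesis using False by (simp add: b_def)
  qed (simp add: b_def degree_monom_eq)
  have lb: "coeff (b c) c = 1" for c
    using lq by (auto simp: b_def coeff_monom_mult)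
  have A: "A \<in> carrier_mat (n + m) (n + m)" and U: "U \<in> carrier_mat (n + m) (n + m)"
    by (auto simp: A_def U_def)
  have "upper_triangular U"
    by (auto simp: upper_triangular_def U_def db intro!: coeff_eq_0)
  moreover have "diag_mat U = map (\<lambda>_. 1) [0..<n + m]"
    by (auto simp: diag_mat_def U_def lb intro!: map_cong)
  ultimately have detU: "Determinant.det U = 1"
    by (simp add: det_upper_triangular[OF _ U] map_replicate_const)
  have AU: "A * U = four_block_mat (Matrix.mat n n (\<lambda>(j, k). t j ^ k)) (0\<^sub>m n m)
      (Matrix.mat m n (\<lambda>(a, c). coeff (b c) (p (n + a))))
      (Matrix.mat m m (\<lambda>(a, k). coeff (monom 1 k * q) (p (n + a))))" (is "_ = ?R")
  proof (rule eq_matI)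
    fix i c assume "i < dim_row ?R" "c < dim_col ?R"
    then have i: "i < n + m" and c: "c < n + m" by auto
    have AUic: "(A * U) $$ (i, c) = (\<Sum>k<n + m. A $$ (i, k) * coeff (b c) k)"
      using i c A U by (auto simp: scalar_prod_def U_def lessThan_atLeast0 intro!: sum.cong)
    show "(A * U) $$ (i, c) = ?R $$ (i, c)"
    proof (cases "i < n")
      case True
      have "(A * U) $$ (i, c) = (\<Sum>k<n + m. coeff (b c) k * t i ^ k)"
        unfolding AUic using i True by (intro sum.cong) (auto simp: A_def)
      also have "\<dots> = poly (b c) (t i)"
        unfolding poly_altdef db using c
        by (intro sum.mono_neutral_right) (auto simp: db intro!: coeff_eq_0)
      also have "\<dots> = (if c < n then t i ^ c else 0)"
        using True by (auto simp: b_def poly_monom q_def poly_root_poly)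
      finally show ?thesis using True c i by auto
    next
      case False
      have pi: "p i < n + m" using permutes_in_image[OF p, of i] i by simp
      have "(A * U) $$ (i, c) = (\<Sum>k<n + m. if k = p i then coeff (b c) k else 0)"
        unfolding AUic using i False by (intro sum.cong) (auto simp: A_def)
      also have "\<dots> = coeff (b c) (p i)"
        using pi by (subst sum.delta) auto
      finally show ?thesis using False c i by (auto simp: b_def)
    qed
  qed (use A U in auto)
  have detA: "Determinant.det A = power_alternant n (\<lambda>k. k) t * coeff_det m q (\<lambda>a. p (n + a))"
  proof -
    have "Determinant.det A = Determinant.det (A * U)"
      by (subst Determinant.det_mult[OF A U]) (simp add: detU)
    also have "\<dots> = power_alternant n (\<lambda>k. k) t * coeff_det m q (\<lambda>a. p (n + a))"
      unfolding AU power_alternant_def coeff_det_def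
      by (rule det_four_block_mat_upper_right_zero) auto
    finally show ?thesis .
  qed
  have inj: "p i = p j \<longleftrightarrow> i = j" for i j
    using permutes_inj[OF p] by (auto dest: injD)
  \<comment> \<open>Second evaluation of the determinant of \<open>A\<close>: reading its columns in
    the order \<open>p\<close> turns the unit rows into an identity block and leaves the alternant
    with exponents \<open>p\<close> as the other diagonal block.\<close>
  have "Matrix.mat (n + m) (n + m) (\<lambda>(i, j). A $$ (i, p j))
      = four_block_mat (Matrix.mat n n (\<lambda>(j, k). t j ^ p k))
          (Matrix.mat n m (\<lambda>(j, k). t j ^ p (n + k))) (0\<^sub>m m n) (1\<^sub>m m)" (is "_ = ?R")
  proof (rule eq_matI)
    fix i j assume ij: "i < dim_row ?R" "j < dim_col ?R"
    then have "p j < n + m" using permutes_in_image[OF p, of j] by simp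
    then show "Matrix.mat (n + m) (n + m) (\<lambda>(i, j). A $$ (i, p j)) $$ (i, j) = ?R $$ (i, j)"
      using ij by (auto simp: A_def inj)
  qed auto
  moreover have "Determinant.det \<dots> = power_alternant n p t * 1"
    unfolding power_alternant_def
    by (subst det_four_block_mat_lower_left_zero[where n = n and m = m]) auto
  ultimately have "signof p * Determinant.det A = power_alternant n p t"
    using det_permute_cols[OF A p] by simp
  then show ?thesis by (simp add: detA q_def mult_ac)
qed

section \<open>Haar measure and reflections\<close>

no_notation Matrix.vec_index (infixl "$" 100)

abbreviation cdet :: "'a::comm_ring_1^'n^'n \<Rightarrow> 'a" where "cdet \<equiv> Determinants.det"
abbreviation cmat :: "'a::zero \<Rightarrow> 'a^'n^'n" where "cmat \<equiv> Finite_Cartesian_Product.mat"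

section \<open>Rank-one perturbations, characteristic polynomials and inverses of matrices\<close>

lemma det_replace_unit_row:
  fixes v :: "'a::field^'n"
  shows "cdet (\<chi> i. if i = k then v else (\<chi> j. if i = j then 1 else 0)) = v $ k"
proof -
  let ?E = "(\<chi> i. if i = k then v else (\<chi> j. if i = j then 1 else 0)) :: 'a^'n^'n"
  have "cdet (\<chi> i. if i = k then (\<Sum>i\<in>UNIV. v $ i *s Finite_Cartesian_Product.row i (cmat 1 :: 'a^'n^'n))
      else Finite_Cartesian_Product.row i (cmat 1)) = v $ k"
    using cramer_lemma_transpose[of k v "cmat 1 :: 'a^'n^'n"] by simp
  also have "(\<chi> i. if i = k then (\<Sum>i\<in>UNIV. v $ i *s Finite_Cartesian_Product.row i (cmat 1 :: 'a^'n^'n))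
      else Finite_Cartesian_Product.row i (cmat 1)) = ?E"
    by (auto simp: Finite_Cartesian_Product.vec_eq_iff Finite_Cartesian_Product.row_def Finite_Cartesian_Product.mat_def
        sum.delta if_distrib[of "\<lambda>x. _ * x"] cong: if_cong)
  finally show ?thesis .
qed

lemma det_add_rank_one:
  fixes a b :: "'n::finite \<Rightarrow> 'a::field"
  shows "cdet (\<chi> i j. (if i = j then 1 else 0) + a i * b j) = 1 + (\<Sum>i\<in>UNIV. a i * b i)"
proof -
  \<comment> \<open>The perturbation is switched on row by row, so that each step is linear in a
    single row.\<close>
  have "cdet (\<chi> i j. (if i = j then 1 else 0) + (if i \<in> S then a i else 0) * b j)
      = 1 + (\<Sum>i\<in>S. a i * b i)" if "finite S" for S
    using that
  proof (induction S)
    case empty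
    have "(\<chi> i j. if i = j then 1 else 0) = (cmat 1 :: 'a^'n^'n)"
      by (simp add: Finite_Cartesian_Product.mat_def)
    then show ?case by simp
  next
    case (insert k S)
    define c where "c i = (if i \<in> S then a i else 0)" for i
    define e :: "'n \<Rightarrow> 'a^'n" where "e i = (\<chi> j. if i = j then 1 else 0)" for i
    define f where "f i = (e i + c i *s (\<chi> j. b j))" for i
    have ck: "c k = 0" using insert by (simp add: c_def)
    have "cdet (\<chi> i j. (if i = j then 1 else 0) + (if i \<in> insert k S then a i else 0) * b j)
        = cdet (\<chi> i. if i = k then e i + a i *s (\<chi> j. b j) else f i)"
      using insert by (intro arg_cong[of _ _ cdet]) (auto simp: Finite_Cartesian_Product.vec_eq_iff e_def f_def c_def)
    also have "\<dots> = cdet (\<chi> i. if i = k then e i else f i)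
        + cdet (\<chi> i. if i = k then a i *s (\<chi> j. b j) else f i)"
      by (rule Determinants.det_row_add)
    also have "cdet (\<chi> i. if i = k then e i else f i) = 1 + (\<Sum>i\<in>S. a i * b i)"
    proof -
      have "(\<chi> i. if i = k then e i else f i) = (\<chi> i j. (if i = j then 1 else 0) + c i * b j)"
        using ck by (auto simp: Finite_Cartesian_Product.vec_eq_iff e_def f_def)
      then show ?thesis using insert by (simp add: c_def)
    qed
    also have "cdet (\<chi> i. if i = k then a i *s (\<chi> j. b j) else f i) =
        cdet (\<chi> i. if i = k then a k *s (\<chi> j. b j) else f i)"
      by (intro arg_cong[of _ _ cdet]) (auto simp: Finite_Cartesian_Product.vec_eq_iff)
    also have "\<dots> = a k * cdet (\<chi> i. if i = k then (\<chi> j. b j) else f i)"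
      by (rule Determinants.det_row_mul)
    also have "cdet (\<chi> i. if i = k then (\<chi> j. b j) else f i) = b k"
    proof -
      \<comment> \<open>Row \<open>k\<close> is now \<open>b\<close>, and every other row is a unit
        row plus a multiple of \<open>b\<close>. The matrix factors into \<open>E\<close>, which is
        the identity except in row \<open>k\<close>, and the transpose of \<open>T\<close>, which
        adds the multiples of row \<open>k\<close> to the other rows.\<close>
      define E :: "'a^'n^'n" where "E = (\<chi> i. if i = k then (\<chi> j. b j) else e i)"
      define v :: "'a^'n" where "v = (\<chi> j. (if j = k then 1 else 0) + c j)"
      define T :: "'a^'n^'n" where "T = (\<chi> i. if i = k then v else (\<chi> j. if i = j then 1 else 0))"
      have "(transpose T ** E) $ i $ j = (if i = k then b j else f i $ j)" for i j
      proof -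
        have "(transpose T ** E) $ i $ j = (\<Sum>l\<in>UNIV. T $ l $ i * E $ l $ j)"
          by (simp add: matrix_matrix_mult_def Finite_Cartesian_Product.transpose_def)
        also have "\<dots> = (\<Sum>l\<in>UNIV. (if l = i then E $ l $ j else 0) + (if l = k then c i * E $ l $ j else 0))"
          by (intro sum.cong) (auto simp: T_def v_def ck algebra_simps)
        also have "\<dots> = E $ i $ j + c i * b j"
          by (simp add: sum.distrib E_def)
        finally show ?thesis using ck by (auto simp: E_def f_def e_def)
      qed
      then have "transpose T ** E = (\<chi> i. if i = k then (\<chi> j. b j) else f i)"
        by (auto simp: Finite_Cartesian_Product.vec_eq_iff)
      moreover have "cdet T = 1" "cdet E = b k"
        unfolding T_def E_def e_def by (simp_all only: det_replace_unit_row v_def) (simp_all add: ck)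
      ultimately show ?thesis by (metis Determinants.det_transpose det_mul mult_1)
    qed
    finally show ?case using insert by simp
  qed
  from this[of UNIV] show ?thesis by simp
qed

lemma poly_det: "poly (cdet A) x = cdet (\<chi> i j. poly (A $ i $ j) x)"
proof -
  have s: "poly (of_int (sign p)) x = of_int (sign p)" for p :: "'b \<Rightarrow> 'b"
    by (simp add: sign_def)
  show ?thesis by (simp add: Determinants.det_def poly_sum poly_prod s)
qed

lemma poly_charpoly: "poly (charpoly g) x = cdet (cmat x - g)"
  unfolding charpoly_def poly_det
  by (intro arg_cong[of _ _ cdet])
     (auto simp: Finite_Cartesian_Product.vec_eq_iff Finite_Cartesian_Product.mat_def)

lemma continuous_on_matrix_mult [continuous_intros]:
  fixes f h :: "'b::topological_space \<Rightarrow> complex^'n^'n"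
  assumes "continuous_on S f" "continuous_on S h"
  shows "continuous_on S (\<lambda>x. f x ** h x)"
  unfolding matrix_matrix_mult_def by (intro continuous_intros assms)

lemma continuous_on_cdet [continuous_intros]:
  fixes f :: "'b::topological_space \<Rightarrow> complex^'n^'n"
  assumes "continuous_on S f"
  shows "continuous_on S (\<lambda>x. cdet (f x))"
  unfolding Determinants.det_def by (intro continuous_intros assms)

lemma matrix_inv_inverse:
  fixes Y :: "complex^'n^'n"
  assumes "cdet Y \<noteq> 0"
  shows "Y ** matrix_inv Y = cmat 1" "matrix_inv Y ** Y = cmat 1"
proof -
  have "\<exists>Y'. Y ** Y' = cmat 1 \<and> Y' ** Y = cmat 1"
    using assms by (simp add: invertible_det_nz[symmetric] invertible_def)
  then show "Y ** matrix_inv Y = cmat 1" "matrix_inv Y ** Y = cmat 1"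
    unfolding Finite_Cartesian_Product.matrix_inv_def by (metis (mono_tags, lifting) someI_ex)+
qed

lemma matrix_diff_mult:
  fixes A B C :: "complex^'n^'n"
  shows "(A - B) ** C = A ** C - B ** C" "C ** (A - B) = C ** A - C ** B" "(A + B) ** C = A ** C + B ** C"
  by (simp_all add: matrix_matrix_mult_def Finite_Cartesian_Product.vec_eq_iff algebra_simps sum_subtractf sum.distrib)

text \<open>Cramer's rule entrywise. It makes the inverse continuous where the determinant does not
  vanish, and it recognizes the minors that arise on differentiating the characteristic
  polynomial.\<close>

lemma matrix_inv_entry:
  fixes Y :: "complex^'n^'n"
  assumes Y: "cdet Y \<noteq> 0"
  shows "matrix_inv Y $ k $ l = cdet (\<chi> i j. if j = k then (if i = l then 1 else 0) else Y $ i $ j) / cdet Y"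
proof -
  note inv = matrix_inv_inverse(1)[OF Y]
  have "Y *v (\<chi> i. matrix_inv Y $ i $ l) = (\<chi> i. (Y ** matrix_inv Y) $ i $ l)"
    by (simp add: matrix_vector_mult_def matrix_matrix_mult_def)
  also have "\<dots> = (\<chi> i. if i = l then 1 else 0)"
    unfolding inv by (auto simp: Finite_Cartesian_Product.vec_eq_iff Finite_Cartesian_Product.mat_def)
  finally have "(\<chi> i. matrix_inv Y $ i $ l) = (\<chi> k. cdet (\<chi> i j. if j = k then (\<chi> i. if i = l then 1 else 0) $ i else Y $ i $ j) / cdet Y)"
    unfolding cramer[OF Y] .
  then have "matrix_inv Y $ k $ l = cdet (\<chi> i j. if j = k then (\<chi> i. if i = l then 1 else 0) $ i else Y $ i $ j) / cdet Y"
    by (simp add: Finite_Cartesian_Product.vec_eq_iff)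
  then show ?thesis by (simp cong: if_cong)
qed

lemma continuous_on_matrix_inv [continuous_intros]:
  fixes f :: "'b::topological_space \<Rightarrow> complex^'n^'n"
  assumes f: "continuous_on S f" and nz: "\<And>x. x \<in> S \<Longrightarrow> cdet (f x) \<noteq> 0"
  shows "continuous_on S (\<lambda>x. matrix_inv (f x))"
proof -
  have "continuous_on S (\<lambda>x. matrix_inv (f x) $ k $ l)" for k l
  proof -
    have "continuous_on S (\<lambda>x. cdet (\<chi> i j. if j = k then (if i = l then 1 else 0) else f x $ i $ j) / cdet (f x))"
    proof (intro continuous_intros)
      show "continuous_on S (\<lambda>x. if j = k then (if i = l then 1 else 0) else f x $ i $ j)" for i j
        by (cases "j = k") (auto intro!: continuous_intros f)
    qed (use f nz in auto)
    then show ?thesis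
      by (rule continuous_on_eq) (simp add: matrix_inv_entry nz)
  qed
  then have "continuous_on S (\<lambda>x. \<chi> k l. matrix_inv (f x) $ k $ l)"
    by (intro continuous_on_vec_lambda)
  then show ?thesis by simp
qed

section \<open>The unitary group, its reflections and resolvents\<close>

lemma continuous_on_conj_transpose [continuous_intros]:
  "continuous_on S f \<Longrightarrow> continuous_on S (\<lambda>x. conj_transpose (f x))"
  unfolding conj_transpose_def by (intro continuous_intros)

lemma conj_transpose_mult: "conj_transpose (A ** B) = conj_transpose B ** conj_transpose A"
  by (simp add: conj_transpose_def matrix_matrix_mult_def Finite_Cartesian_Product.vec_eq_iff mult.commute)

lemma unitary_group_iff:
  "g \<in> unitary_group \<longleftrightarrow> g ** conj_transpose g = cmat 1"
  by (auto simp: unitary_group_def matrix_left_right_inverse)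

lemma unitary_mult: "g \<in> unitary_group \<Longrightarrow> h \<in> unitary_group \<Longrightarrow> g ** h \<in> unitary_group"
  unfolding unitary_group_iff conj_transpose_mult
  by (metis matrix_mul_assoc matrix_mul_rid)

lemma unitary_entry:
  fixes g :: "complex^'n^'n"
  assumes "g \<in> unitary_group"
  shows "norm (g $ i $ j) \<le> 1"
proof -
  have "(g ** conj_transpose g) $ i $ i = 1"
    using assms by (simp add: unitary_group_iff Finite_Cartesian_Product.mat_def)
  then have "complex_of_real (\<Sum>j\<in>UNIV. (norm (g $ i $ j))\<^sup>2) = 1"
    by (simp add: matrix_matrix_mult_def conj_transpose_def complex_norm_square of_real_power[symmetric] del: of_real_power)
  then have "(\<Sum>j\<in>UNIV. (norm (g $ i $ j))\<^sup>2) = 1"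
    using of_real_eq_1_iff by blast
  moreover have "(norm (g $ i $ j))\<^sup>2 \<le> (\<Sum>j\<in>UNIV. (norm (g $ i $ j))\<^sup>2)"
    by (rule member_le_sum) auto
  ultimately have "(norm (g $ i $ j))\<^sup>2 \<le> 1" by simp
  then show ?thesis using abs_square_le_1[of "norm (g $ i $ j)"] by simp
qed

lemma compact_unitary_group: "compact (unitary_group :: (complex^'n^'n) set)"
proof -
  have "closed (unitary_group :: (complex^'n^'n) set)"
    unfolding unitary_group_iff[abs_def, unfolded Collect_mem_eq, symmetric]
    by (subst Collect_mem_eq[of unitary_group, symmetric], unfold unitary_group_iff)
       (intro closed_Collect_eq continuous_intros)
  moreover have "norm g \<le> (\<Sum>i\<in>(UNIV::'n set). \<Sum>j\<in>(UNIV::'n set). 1)"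
    if "g \<in> unitary_group" for g :: "complex^'n^'n"
  proof -
    have "norm g \<le> (\<Sum>i\<in>UNIV. norm (g $ i))" by (simp add: norm_vec_def L2_set_le_sum)
    also have "\<dots> \<le> (\<Sum>i\<in>UNIV. \<Sum>j\<in>UNIV. norm (g $ i $ j))"
      by (intro sum_mono) (simp add: norm_vec_def L2_set_le_sum)
    also have "\<dots> \<le> (\<Sum>i\<in>(UNIV::'n set). \<Sum>j\<in>(UNIV::'n set). 1)"
      by (intro sum_mono unitary_entry that)
    finally show ?thesis .
  qed
  ultimately show ?thesis unfolding compact_eq_bounded_closed bounded_iff by blast
qed

lemma det_unitary_nz: "g \<in> unitary_group \<Longrightarrow> cdet g \<noteq> 0"
  by (metis unitary_group_iff det_mul Determinants.det_I mult_zero_left zero_neq_one)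

text \<open>Entries of a unitary matrix have modulus at most one; looking at a coordinate of maximal
  modulus of an eigenvector bounds every eigenvalue by the size of the matrix. This crude bound
  suffices because the evaluation points may be taken as large as desired.\<close>

lemma det_unitary_shift_nz:
  fixes g :: "complex^'n^'n"
  assumes g: "g \<in> unitary_group" and x: "norm x > CARD('n)"
  shows "cdet (cmat x - g) \<noteq> 0"
proof
  assume "cdet (cmat x - g) = 0"
  then have "\<not> invertible (cmat x - g)" by (simp add: invertible_det_nz)
  then obtain v where v: "(cmat x - g) *v v = 0" "v \<noteq> 0"
    by (metis invertible_def matrix_left_invertible_ker matrix_left_right_inverse)
  define m where "m = Max (range (\<lambda>i. norm (v $ i)))"
  have le: "norm (v $ i) \<le> m" for i unfolding m_def by (rule Max_ge) auto
  have "m \<in> range (\<lambda>i. norm (v $ i))" unfolding m_def by (rule Max_in) auto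
  then obtain i where i: "m = norm (v $ i)" by auto
  obtain j where "v $ j \<noteq> 0" using v(2) by (auto simp: Finite_Cartesian_Product.vec_eq_iff)
  then have m: "m > 0" using le[of j] by (metis norm_le_zero_iff not_le order_trans)
  have "(cmat x *v v) $ i = (g *v v) $ i"
    using v(1) by (simp add: matrix_vector_mult_diff_rdistrib)
  then have "x * v $ i = (\<Sum>j\<in>UNIV. g $ i $ j * v $ j)"
    by (simp add: matrix_vector_mult_def Finite_Cartesian_Product.mat_def if_distrib[of "\<lambda>x. x * _"] cong: if_cong)
  then have "norm x * m \<le> (\<Sum>j\<in>UNIV. norm (g $ i $ j * v $ j))"
    unfolding i by (metis norm_mult norm_sum)
  also have "\<dots> \<le> (\<Sum>j\<in>(UNIV::'n set). 1 * m)"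
    unfolding norm_mult by (intro sum_mono mult_mono unitary_entry g le) auto
  finally show False using x m by simp
qed

text \<open>The matrix multiplies the unit vector \<open>w\<close> by \<open>z\<close> and fixes its
  orthogonal complement. Unlike the eigenvalues of a general group element, \<open>z\<close> is a
  free parameter in which identities can be expanded.\<close>

lemma unitary_reflection:
  fixes w :: "'n::finite \<Rightarrow> complex"
  assumes w: "(\<Sum>i\<in>UNIV. w i * cnj (w i)) = 1" and z: "norm z = 1"
  defines "u \<equiv> (\<chi> i j. (if i = j then 1 else 0) + (z - 1) * w i * cnj (w j)) :: complex^'n^'n"
  shows "u \<in> unitary_group" "cdet u = z"
proof -
  have zz: "z * cnj z = 1" using z by (metis complex_norm_square of_real_1 one_power2)
  have w': "(\<Sum>i\<in>UNIV. cnj (w i) * w i) = 1" using w by (simp add: mult.commute)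
  have "(u ** conj_transpose u) $ i $ j = (if i = j then 1 else 0)" for i j
  proof -
    have "(u ** conj_transpose u) $ i $ j = (\<Sum>k\<in>UNIV. (if k = i then (if k = j then 1 else 0) else 0)
        + (if k = i then cnj (z - 1) * cnj (w j) * w k else 0)
        + (if k = j then (z - 1) * w i * cnj (w k) else 0)
        + (z - 1) * w i * cnj (z - 1) * cnj (w j) * (cnj (w k) * w k))"
      unfolding matrix_matrix_mult_def conj_transpose_def u_def
      by (auto intro!: sum.cong simp: algebra_simps)
    also have "\<dots> = (if i = j then 1 else 0) + cnj (z - 1) * cnj (w j) * w i
        + (z - 1) * w i * cnj (w j) + (z - 1) * w i * cnj (z - 1) * cnj (w j)"
      by (simp add: sum.distrib sum_distrib_left[symmetric] w')
    also have "\<dots> = (if i = j then 1 else 0) + (z * cnj z - 1) * w i * cnj (w j)"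
      by (simp add: algebra_simps)
    finally show ?thesis by (simp add: zz)
  qed
  then show "u \<in> unitary_group"
    by (simp add: unitary_group_iff Finite_Cartesian_Product.vec_eq_iff Finite_Cartesian_Product.mat_def)
  show "cdet u = z"
    unfolding u_def using det_add_rank_one[of "\<lambda>i. (z - 1) * w i" "\<lambda>i. cnj (w i)"]
    by (simp add: sum_distrib_left[symmetric] mult.assoc w)
qed

text \<open>The additional factor \<open>g\<close> is there because translation multiplies
  \<open>g\<close>: the change of \<open>x - g\<close> is \<open>(u - 1) g\<close>, which relative
  to \<open>x - g\<close> is \<open>u - 1\<close> times this matrix.\<close>

definition resolvent :: "complex^'n^'n \<Rightarrow> complex \<Rightarrow> complex^'n^'n" where
  "resolvent g x = g ** matrix_inv (cmat x - g)"

text \<open>Here \<open>x - u g = K (x - g)\<close>, where \<open>K\<close> is the identity minus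
  the rank-one matrix \<open>(z - 1) w w*\<close> times the resolvent, so its determinant is affine
  in \<open>z - 1\<close>.\<close>

lemma det_shift_reflection:
  fixes w :: "'n::finite \<Rightarrow> complex" and g :: "complex^'n^'n"
  assumes nz: "cdet (cmat x - g) \<noteq> 0"
  shows "cdet (cmat x - (\<chi> i j. (if i = j then 1 else 0) + (z - 1) * w i * cnj (w j)) ** g)
    = cdet (cmat x - g) * (1 - (z - 1) * (\<Sum>i\<in>UNIV. \<Sum>j\<in>UNIV. cnj (w i) * resolvent g x $ i $ j * w j))"
proof -
  define Y where "Y = cmat x - g"
  have inv: "matrix_inv Y ** Y = cmat 1"
    using nz by (simp add: matrix_inv_inverse Y_def)
  define K :: "complex^'n^'n" where "K = (\<chi> i j. (if i = j then 1 else 0)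
      + (- (z - 1) * w i) * (\<Sum>k\<in>UNIV. cnj (w k) * resolvent g x $ k $ j))"
  define V :: "complex^'n^'n" where "V = (\<chi> i j. (z - 1) * w i * cnj (w j))"
  have "(\<chi> i j. (if i = j then 1 else 0) + (z - 1) * w i * cnj (w j)) = cmat 1 + V"
    by (simp add: V_def Finite_Cartesian_Product.vec_eq_iff Finite_Cartesian_Product.mat_def)
  moreover have "cmat x - (cmat 1 + V) ** g = K ** Y"
  proof -
    have "K = cmat 1 - V ** resolvent g x"
      unfolding K_def V_def Finite_Cartesian_Product.vec_eq_iff matrix_matrix_mult_def
          Finite_Cartesian_Product.mat_def
      by (simp add: sum_distrib_left sum_negf[symmetric] sum.distrib[symmetric] algebra_simps)
    then have "K ** Y = Y - V ** (g ** (matrix_inv Y ** Y))"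
      by (simp add: matrix_diff_mult resolvent_def Y_def[symmetric] matrix_mul_assoc)
    then show ?thesis
      unfolding inv by (simp add: Y_def matrix_diff_mult algebra_simps)
  qed
  moreover have "cdet K = 1 - (z - 1) * (\<Sum>i\<in>UNIV. \<Sum>j\<in>UNIV. cnj (w i) * resolvent g x $ i $ j * w j)"
    unfolding K_def det_add_rank_one sum.swap[of "\<lambda>i j. cnj (w i) * resolvent g x $ i $ j * w j"]
    by (simp add: sum_distrib_left sum.distrib[symmetric] algebra_simps)
  ultimately show ?thesis by (simp add: det_mul Y_def mult.commute)
qed

lemma continuous_on_poly_charpoly [continuous_intros]:
  "continuous_on S (\<lambda>g. poly (charpoly g) x)"
  unfolding poly_charpoly by (intro continuous_intros)

lemma continuous_on_resolvent [continuous_intros]: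
  assumes "norm x > CARD('n)"
  shows "continuous_on unitary_group (\<lambda>g :: complex^'n^'n. resolvent g x)"
  unfolding resolvent_def using assms by (intro continuous_intros det_unitary_shift_nz) auto

text \<open>Signed elementary symmetric functions. The second one is doubled so that it runs over
  ordered pairs, where traces can be summed independently.\<close>

lemma coeff_prod_linear:
  fixes r :: "'b \<Rightarrow> complex"
  assumes "finite S"
  shows "coeff (\<Prod>a\<in>S. [:1, - r a:]) 0 = 1" "coeff (\<Prod>a\<in>S. [:1, - r a:]) 1 = - (\<Sum>a\<in>S. r a)"
    "2 * coeff (\<Prod>a\<in>S. [:1, - r a:]) 2 = (\<Sum>a\<in>S. \<Sum>b\<in>S - {a}. r a * r b)"
proof -
  have step: "coeff ([:1, - c:] * q) (Suc n) = coeff q (Suc n) - c * coeff q n" for c :: complex and q n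
    by simp
  have *: "coeff (\<Prod>a\<in>S. [:1, - r a:]) 0 = 1 \<and> coeff (\<Prod>a\<in>S. [:1, - r a:]) 1 = - (\<Sum>a\<in>S. r a) \<and>
    2 * coeff (\<Prod>a\<in>S. [:1, - r a:]) 2 = (\<Sum>a\<in>S. r a)\<^sup>2 - (\<Sum>a\<in>S. (r a)\<^sup>2)"
    using assms
  proof (induction S)
    case (insert c S)
    then have IH: "coeff (\<Prod>a\<in>S. [:1, - r a:]) 0 = 1" "coeff (\<Prod>a\<in>S. [:1, - r a:]) 1 = - (\<Sum>a\<in>S. r a)"
      "2 * coeff (\<Prod>a\<in>S. [:1, - r a:]) 2 = (\<Sum>a\<in>S. r a)\<^sup>2 - (\<Sum>a\<in>S. (r a)\<^sup>2)" by auto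
    have 2: "coeff (\<Prod>a\<in>insert c S. [:1, - r a:]) 2 = coeff (\<Prod>a\<in>S. [:1, - r a:]) 2 + r c * (\<Sum>a\<in>S. r a)"
      using step[of "r c" "\<Prod>a\<in>S. [:1, - r a:]" 1] insert IH(2) by (simp add: numeral_2_eq_2)
    show ?case
      using insert IH step[of "r c" "\<Prod>a\<in>S. [:1, - r a:]" 0] unfolding 2 distrib_left IH(3)
      by (simp add: power2_sum algebra_simps)
  qed auto
  have "(\<Sum>a\<in>S. r a)\<^sup>2 - (\<Sum>a\<in>S. (r a)\<^sup>2) = (\<Sum>a\<in>S. \<Sum>b\<in>S - {a}. r a * r b)"
  proof -
    have "(\<Sum>a\<in>S. r a)\<^sup>2 = (\<Sum>a\<in>S. (r a)\<^sup>2 + (\<Sum>b\<in>S - {a}. r a * r b))"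
      unfolding power2_eq_square sum_product
      using assms by (intro sum.cong refl) (simp add: sum.remove)
    then show ?thesis by (simp add: sum.distrib)
  qed
  then show "coeff (\<Prod>a\<in>S. [:1, - r a:]) 0 = 1" "coeff (\<Prod>a\<in>S. [:1, - r a:]) 1 = - (\<Sum>a\<in>S. r a)"
    "2 * coeff (\<Prod>a\<in>S. [:1, - r a:]) 2 = (\<Sum>a\<in>S. \<Sum>b\<in>S - {a}. r a * r b)"
    using * by auto
qed

lemma infinite_unit_circle: "infinite {z :: complex. norm z = 1}"
proof
  assume "finite {z :: complex. norm z = 1}"
  then have "finite (sphere (0 :: complex) 1)" by (simp add: sphere_def dist_norm)
  moreover have "connected (sphere (0 :: complex) 1)" by (rule connected_sphere) simp
  ultimately obtain a where "sphere (0 :: complex) 1 \<subseteq> {a}"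
    by (metis connected_finite_iff_sing empty_subsetI order_refl)
  moreover have "1 \<in> sphere (0 :: complex) 1" "- 1 \<in> sphere (0 :: complex) 1" by auto
  ultimately have "(1 :: complex) = - 1" by blast
  then show False by simp
qed

section \<open>Means over the unitary group\<close>

locale haar =
  fixes M :: "(complex^'n^'n) measure"
  assumes haar: "haar_prob M"
begin

lemma sets_M: "sets M = sets (restrict_space borel unitary_group)"
  using haar by (simp add: haar_prob_def)

lemma space_M: "space M = unitary_group"
  using sets_eq_imp_space_eq[OF sets_M] by (simp add: space_restrict_space)

sublocale finite_measure M
  using haar by (intro finite_measureI) (simp add: haar_prob_def)

lemma measure_M: "measure M unitary_group = 1"
  using haar unfolding haar_prob_def space_M by (simp add: Sigma_Algebra.measure_def)

lemma integrable_continuous: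
  fixes f :: "complex^'n^'n \<Rightarrow> complex"
  assumes "continuous_on unitary_group f"
  shows "integrable M f"
proof -
  have "bounded (f ` unitary_group)"
    by (intro compact_imp_bounded compact_continuous_image assms compact_unitary_group)
  then obtain B where "\<And>g. g \<in> unitary_group \<Longrightarrow> norm (f g) \<le> B"
    by (auto simp: bounded_iff)
  moreover have "f \<in> borel_measurable M"
    using borel_measurable_continuous_on_restrict[OF assms] measurable_cong_sets[OF sets_M refl] by auto
  ultimately show ?thesis
    by (intro integrable_const_bound[of _ B]) (auto simp: space_M)
qed

lemma integral_left_mult:
  fixes f :: "complex^'n^'n \<Rightarrow> complex"
  assumes h: "h \<in> unitary_group" and f: "continuous_on unitary_group f"
  shows "(LINT g|M. f (h ** g)) = (LINT g|M. f g)"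
proof -
  have "continuous_on unitary_group (\<lambda>g. h ** g)" by (intro continuous_intros)
  then have "(\<lambda>g. h ** g) \<in> borel_measurable (restrict_space borel unitary_group)"
    by (rule borel_measurable_continuous_on_restrict)
  then have "(\<lambda>g. h ** g) \<in> measurable M borel"
    using measurable_cong_sets[OF sets_M refl] by auto
  then have "(\<lambda>g. h ** g) \<in> measurable M (restrict_space borel unitary_group)"
    by (rule measurable_restrict_space2[rotated]) (auto simp: space_M unitary_mult h)
  then have m: "(\<lambda>g. h ** g) \<in> measurable M M"
    using measurable_cong_sets[OF refl sets_M] by auto
  have "(LINT g|M. f g) = (LINT g|distr M M (\<lambda>g. h ** g). f g)"
    using haar h by (simp add: haar_prob_def)
  also have "\<dots> = (LINT g|M. f (h ** g))"
    using integrable_continuous[OF f] by (intro integral_distr m) auto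
  finally show ?thesis by simp
qed

text \<open>The power of the determinant accounts for the shift that makes the exponents of a
  Laurent alternant nonnegative. Being multiplicative, it turns translation invariance into
  invariance up to the factor \<open>cdet h ^ p\<close>.\<close>

definition det_mean :: "nat \<Rightarrow> (complex^'n^'n \<Rightarrow> complex) \<Rightarrow> complex" where
  "det_mean p f = (LINT g|M. inverse (cdet g) ^ p * f g)"

lemma integrable_det_mean:
  assumes "continuous_on unitary_group f"
  shows "integrable M (\<lambda>g. inverse (cdet g) ^ p * f g)"
  by (intro integrable_continuous continuous_intros assms) (auto dest: det_unitary_nz)

lemma det_mean_add:
  assumes "continuous_on unitary_group f" "continuous_on unitary_group h"
  shows "det_mean p (\<lambda>g. f g + h g) = det_mean p f + det_mean p h"
  using assms unfolding det_mean_def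
  by (subst Bochner_Integration.integral_add[symmetric]) (auto simp: integrable_det_mean distrib_left)

lemma det_mean_cmult: "det_mean p (\<lambda>g. c * f g) = c * det_mean p f"
  unfolding det_mean_def by (subst integral_mult_right_zero[symmetric]) (simp add: mult_ac)

lemma det_mean_sum:
  assumes "\<And>i. i \<in> I \<Longrightarrow> continuous_on unitary_group (f i)"
  shows "det_mean p (\<lambda>g. \<Sum>i\<in>I. f i g) = (\<Sum>i\<in>I. det_mean p (f i))"
  using assms unfolding det_mean_def
  by (subst Bochner_Integration.integral_sum[symmetric]) (auto simp: integrable_det_mean sum_distrib_left)

lemma det_mean_cong: "(\<And>g. g \<in> unitary_group \<Longrightarrow> f g = h g) \<Longrightarrow> det_mean p f = det_mean p h"
  unfolding det_mean_def by (intro Bochner_Integration.integral_cong) (auto simp: space_M)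

lemma det_mean_left_mult:
  assumes h: "h \<in> unitary_group" and f: "continuous_on unitary_group f"
  shows "det_mean p (\<lambda>g. f (h ** g)) = cdet h ^ p * det_mean p f"
proof -
  have "det_mean p (\<lambda>g. f (h ** g)) = (LINT g|M. cdet h ^ p * (inverse (cdet (h ** g)) ^ p * f (h ** g)))"
    unfolding det_mean_def using det_unitary_nz[OF h]
    by (intro Bochner_Integration.integral_cong refl) (auto simp: det_mul power_mult_distrib field_simps)
  also have "\<dots> = cdet h ^ p * (LINT g|M. inverse (cdet (h ** g)) ^ p * f (h ** g))"
    by (rule integral_mult_right_zero)
  also have "(LINT g|M. inverse (cdet (h ** g)) ^ p * f (h ** g)) = det_mean p f"
    unfolding det_mean_def
    by (intro integral_left_mult[OF h, of "\<lambda>g. inverse (cdet g) ^ p * f g"] continuous_intros f)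
       (auto dest: det_unitary_nz)
  finally show ?thesis .
qed

end

section \<open>Moments of quadratic forms and traces of resolvents\<close>

locale haar_points = haar M for M :: "(complex^'n^'n) measure" +
  fixes p m :: nat and x :: "nat \<Rightarrow> complex"
  assumes x_large: "\<And>a. a < m \<Longrightarrow> norm (x a) > CARD('n)"
begin

definition char_prod :: "complex^'n^'n \<Rightarrow> complex" where
  "char_prod g = (\<Prod>a<m. poly (charpoly g) (x a))"

abbreviation res :: "complex^'n^'n \<Rightarrow> nat \<Rightarrow> complex^'n^'n" where
  "res g a \<equiv> resolvent g (x a)"

lemma continuous_char_prod [continuous_intros]: "continuous_on S char_prod"
  unfolding char_prod_def by (intro continuous_intros)

lemma continuous_res [continuous_intros]: "a < m \<Longrightarrow> continuous_on unitary_group (\<lambda>g. res g a)"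
  by (intro continuous_intros x_large)

context
  fixes w :: "'n \<Rightarrow> complex"
  assumes w: "(\<Sum>i\<in>UNIV. w i * cnj (w i)) = 1"
begin

definition quad :: "complex^'n^'n \<Rightarrow> nat \<Rightarrow> complex" where
  "quad g a = (\<Sum>i\<in>UNIV. \<Sum>j\<in>UNIV. cnj (w i) * res g a $ i $ j * w j)"

lemma continuous_quad [continuous_intros]: "a < m \<Longrightarrow> continuous_on unitary_group (\<lambda>g. quad g a)"
  unfolding quad_def by (intro continuous_intros)

lemma continuous_coeff_quad:
  "S \<subseteq> {..<m} \<Longrightarrow> continuous_on unitary_group (\<lambda>g. coeff (\<Prod>a\<in>S. [:1, - quad g a:]) k)"
proof (induction S arbitrary: k rule: infinite_finite_induct)
  case (insert c S)
  then have "c < m" "S \<subseteq> {..<m}" by auto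
  then show ?case
    using insert by (cases k) (auto simp: coeff_pCons intro!: continuous_intros)
qed auto

text \<open>
  Translation by the reflection with eigenvalue \<open>z\<close> multiplies the mean by \<open>z\<^sup>p\<close> and the product of
  characteristic polynomials by a polynomial in \<open>z - 1\<close>; the coefficients of \<open>(z - 1)\<^sup>k\<close> agree.
\<close>

lemma reflection_moments:
  "det_mean p (\<lambda>g. char_prod g * coeff (\<Prod>a<m. [:1, - quad g a:]) k)
    = of_nat (p choose k) * det_mean p char_prod"
proof -
  define c where "c k = det_mean p (\<lambda>g. char_prod g * coeff (\<Prod>a<m. [:1, - quad g a:]) k)" for k
  define Q where "Q = (\<Sum>k\<le>m. monom (c k) k)"
  have deg: "degree (\<Prod>a<m. [:1, - quad g a:]) \<le> m" for g
  proof -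
    have "degree (\<Prod>a<m. [:1, - quad g a:]) \<le> (\<Sum>a<m. degree [:1, - quad g a:])"
      using degree_prod_sum_le[of "{..<m}" "\<lambda>a. [:1, - quad g a:]"] by (simp add: o_def)
    also have "\<dots> \<le> (\<Sum>a<m. 1)" by (intro sum_mono) auto
    finally show ?thesis by simp
  qed
  have "poly Q (z - 1) = z ^ p * det_mean p char_prod" if z: "norm z = 1" for z
  proof -
    define u :: "complex^'n^'n" where "u = (\<chi> i j. (if i = j then 1 else 0) + (z - 1) * w i * cnj (w j))"
    note u = unitary_reflection[OF w z, folded u_def]
    have "z ^ p * det_mean p char_prod = det_mean p (\<lambda>g. char_prod (u ** g))"
      using det_mean_left_mult[OF u(1) continuous_char_prod] u(2) by simp
    also have "\<dots> = det_mean p (\<lambda>g. \<Sum>k\<le>m. (z - 1) ^ k * (char_prod g * coeff (\<Prod>a<m. [:1, - quad g a:]) k))"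
    proof (rule det_mean_cong)
      fix g :: "complex^'n^'n" assume g: "g \<in> unitary_group"
      have "char_prod (u ** g) = char_prod g * poly (\<Prod>a<m. [:1, - quad g a:]) (z - 1)"
        unfolding char_prod_def poly_prod prod.distrib[symmetric] poly_charpoly
        using det_shift_reflection[of _ g z w, OF det_unitary_shift_nz[OF g x_large]]
        by (intro prod.cong) (auto simp: u_def quad_def)
      also have "poly (\<Prod>a<m. [:1, - quad g a:]) (z - 1)
          = (\<Sum>k\<le>m. coeff (\<Prod>a<m. [:1, - quad g a:]) k * (z - 1) ^ k)"
        unfolding poly_altdef using deg[of g]
        by (intro sum.mono_neutral_left) (auto simp: coeff_eq_0)
      finally show "char_prod (u ** g) =
          (\<Sum>k\<le>m. (z - 1) ^ k * (char_prod g * coeff (\<Prod>a<m. [:1, - quad g a:]) k))"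
        by (simp add: sum_distrib_left mult_ac)
    qed
    also have "\<dots> = (\<Sum>k\<le>m. (z - 1) ^ k * c k)"
      unfolding c_def det_mean_cmult[symmetric]
      by (intro det_mean_sum continuous_intros continuous_coeff_quad) auto
    also have "\<dots> = poly Q (z - 1)"
      by (simp add: Q_def poly_sum poly_monom mult.commute)
    finally show ?thesis by simp
  qed
  then have "(\<lambda>z. z - 1) ` {z. norm z = 1} \<subseteq> {y. poly Q y = poly (Polynomial.smult (det_mean p char_prod) ([:1, 1:] ^ p)) y}"
    by (auto simp: algebra_simps)
  moreover have "infinite ((\<lambda>z::complex. z - 1) ` {z. norm z = 1})"
    using infinite_unit_circle by (simp add: finite_image_iff inj_on_def)
  ultimately have "infinite {y. poly (Q - Polynomial.smult (det_mean p char_prod) ([:1, 1:] ^ p)) y = 0}"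
    by (auto dest: finite_subset)
  then have "Q = Polynomial.smult (det_mean p char_prod) ([:1, 1:] ^ p)"
    by (metis eq_iff_diff_eq_0 poly_roots_finite)
  moreover have "coeff Q k = c k"
  proof (cases "k \<le> m")
    case False
    then have "c k = det_mean p (\<lambda>g. 0 * char_prod g)"
      unfolding c_def using deg by (intro det_mean_cong) (auto intro!: coeff_eq_0 le_less_trans[OF deg])
    also have "\<dots> = 0" by (subst det_mean_cmult) simp
    finally show ?thesis using False by (simp add: Q_def coeff_sum)
  qed (simp add: Q_def coeff_sum)
  ultimately show ?thesis
    unfolding c_def[symmetric] using coeff_linear_poly_power[of k p "1 :: complex" 1]
    by (cases "k \<le> p") (auto simp: coeff_eq_0 degree_linear_power mult.commute)
qed

text \<open>The cases \<open>k = 1\<close> and \<open>k = 2\<close> of the reflection identity, with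
  the signs of the symmetric functions removed and the second one doubled.\<close>

lemma quad_moments:
  "det_mean p (\<lambda>g. char_prod g * (\<Sum>a<m. quad g a)) = - of_nat p * det_mean p char_prod"
  "det_mean p (\<lambda>g. char_prod g * (\<Sum>a<m. \<Sum>b\<in>{..<m} - {a}. quad g a * quad g b))
    = of_nat p * (of_nat p - 1) * det_mean p char_prod"
proof -
  have "det_mean p (\<lambda>g. char_prod g * (\<Sum>a<m. quad g a))
      = det_mean p (\<lambda>g. - 1 * (char_prod g * coeff (\<Prod>a<m. [:1, - quad g a:]) 1))"
    by (rule det_mean_cong) (simp add: coeff_prod_linear(2)[of "{..<m}", simplified])
  then show "det_mean p (\<lambda>g. char_prod g * (\<Sum>a<m. quad g a)) = - of_nat p * det_mean p char_prod"
    unfolding det_mean_cmult reflection_moments by simp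
  have "det_mean p (\<lambda>g. char_prod g * (\<Sum>a<m. \<Sum>b\<in>{..<m} - {a}. quad g a * quad g b))
      = det_mean p (\<lambda>g. 2 * (char_prod g * coeff (\<Prod>a<m. [:1, - quad g a:]) 2))"
    by (rule det_mean_cong) (simp add: coeff_prod_linear(3)[of "{..<m}", simplified, symmetric])
  also have "\<dots> = of_nat (2 * (p choose 2)) * det_mean p char_prod"
    unfolding det_mean_cmult reflection_moments by simp
  also have "2 * (p choose 2) = p * (p - 1)"
    by (cases p) (simp_all add: choose_two)
  finally show "det_mean p (\<lambda>g. char_prod g * (\<Sum>a<m. \<Sum>b\<in>{..<m} - {a}. quad g a * quad g b))
    = of_nat p * (of_nat p - 1) * det_mean p char_prod"
    by (cases p) (auto simp: algebra_simps)
qed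

end

end

lemma trace_alt: "Determinants.trace A = (\<Sum>i\<in>UNIV. A $ i $ i)"
  by (simp add: Determinants.trace_def)

lemma trace_mult: "Determinants.trace (A ** B) = (\<Sum>i\<in>UNIV. \<Sum>j\<in>UNIV. A $ i $ j * B $ j $ i)"
  by (simp add: Determinants.trace_def matrix_matrix_mult_def)

lemma continuous_on_trace [continuous_intros]:
  fixes f :: "'b::topological_space \<Rightarrow> complex^'n^'n"
  assumes "continuous_on S f"
  shows "continuous_on S (\<lambda>x. Determinants.trace (f x))"
  unfolding trace_alt by (intro continuous_intros assms)

context haar_points
begin

text \<open>The quadratic forms of the coordinate vectors add up to the trace, and each of them has
  the same moment.\<close>

lemma trace_moment1:
  "det_mean p (\<lambda>g. char_prod g * (\<Sum>a<m. Determinants.trace (res g a)))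
    = - (of_nat p * of_nat CARD('n)) * det_mean p char_prod"
proof -
  have diag: "det_mean p (\<lambda>g. char_prod g * (\<Sum>a<m. res g a $ i $ i)) = - of_nat p * det_mean p char_prod" for i
  proof -
    define w :: "'n \<Rightarrow> complex" where "w k = (if k = i then 1 else 0)" for k
    have w: "(\<Sum>k\<in>UNIV. w k * cnj (w k)) = 1"
      by (simp add: w_def if_distrib cong: if_cong)
    have q: "quad w g a = res g a $ i $ i" for g a
      unfolding quad_def[OF w] by (simp add: w_def if_distrib[of cnj] if_distrib[of "\<lambda>x. x * _"] if_distrib[of "\<lambda>x. _ * x"] cong: if_cong)
    show ?thesis using quad_moments(1)[OF w] by (simp add: q)
  qed
  have "det_mean p (\<lambda>g. char_prod g * (\<Sum>a<m. Determinants.trace (res g a)))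
      = det_mean p (\<lambda>g. \<Sum>i\<in>UNIV. char_prod g * (\<Sum>a<m. res g a $ i $ i))"
    by (rule det_mean_cong) (simp add: trace_alt sum_distrib_left sum.swap[of _ UNIV])
  also have "\<dots> = (\<Sum>i\<in>UNIV. det_mean p (\<lambda>g. char_prod g * (\<Sum>a<m. res g a $ i $ i)))"
    by (rule det_mean_sum) (auto intro!: continuous_intros)
  finally show ?thesis by (simp add: diag)
qed

text \<open>
  The bilinear identity for the traces is obtained by polarization, averaging over the unit vectors
  \<open>(e\<^sub>i + \<omega> e\<^sub>j) / \<surd>2\<close> with \<open>\<omega>\<^sup>4 = 1\<close>.
\<close>

lemma trace_moment2:
  "det_mean p (\<lambda>g. char_prod g * (\<Sum>a<m. \<Sum>b\<in>{..<m} - {a}.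
      Determinants.trace (res g a) * Determinants.trace (res g b) + Determinants.trace (res g a ** res g b)))
    = of_nat CARD('n) * (of_nat CARD('n) + 1) * (of_nat p * (of_nat p - 1)) * det_mean p char_prod"
proof -
  define c where "c = of_nat p * (of_nat p - 1) * det_mean p char_prod"
  define E where "E f = det_mean p (\<lambda>g. char_prod g * (\<Sum>a<m. \<Sum>b\<in>{..<m} - {a}. f (res g a) (res g b)))"
    for f :: "complex^'n^'n \<Rightarrow> complex^'n^'n \<Rightarrow> complex"
  \<comment> \<open>Additivity of the mean needs integrability, here supplied by continuity in both
    matrices. All uses of linearity below go through this fact, which is why short sums and
    multiples appear as sums over \<open>k < 2\<close>, \<open>k < 3\<close> or
    \<open>k < 4\<close>.\<close>
  have E_sum: "E (\<lambda>A B. \<Sum>i\<in>I. f i A B) = (\<Sum>i\<in>I. E (f i))"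
    if "\<And>i. continuous_on UNIV (\<lambda>X. f i (fst X) (snd X))"
    for I :: "'d set" and f :: "'d \<Rightarrow> complex^'n^'n \<Rightarrow> complex^'n^'n \<Rightarrow> complex"
  proof -
    have cont: "continuous_on unitary_group (\<lambda>g. f i (res g a) (res g b))" if "a < m" "b < m" for i a b
    proof -
      have "continuous_on unitary_group (\<lambda>g. (res g a, res g b))"
        by (intro continuous_intros that)
      then show ?thesis using continuous_on_compose2[OF \<open>\<And>i. continuous_on UNIV (\<lambda>X. f i (fst X) (snd X))\<close>] by fastforce
    qed
    have "E (\<lambda>A B. \<Sum>i\<in>I. f i A B) =
        det_mean p (\<lambda>g. \<Sum>i\<in>I. char_prod g * (\<Sum>a<m. \<Sum>b\<in>{..<m} - {a}. f i (res g a) (res g b)))"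
      unfolding E_def
      by (rule det_mean_cong) (simp add: sum_distrib_left sum.swap[of _ I])
    also have "\<dots> = (\<Sum>i\<in>I. E (f i))"
      unfolding E_def by (rule det_mean_sum) (auto intro!: continuous_intros cont)
    finally show ?thesis .
  qed
  have E_cong: "E f = E h" if "\<And>A B. f A B = h A B" for f h
    using that by (simp add: E_def)
  have diag: "E (\<lambda>A B. A $ i $ i * B $ i $ i) = c" for i
  proof -
    define w :: "'n \<Rightarrow> complex" where "w k = (if k = i then 1 else 0)" for k
    have w: "(\<Sum>k\<in>UNIV. w k * cnj (w k)) = 1"
      by (simp add: w_def if_distrib cong: if_cong)
    have q: "quad w g a = res g a $ i $ i" for g a
      unfolding quad_def[OF w] by (simp add: w_def if_distrib[of cnj] if_distrib[of "\<lambda>x. x * _"] if_distrib[of "\<lambda>x. _ * x"] cong: if_cong)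
    show ?thesis using quad_moments(2)[OF w] by (simp add: q E_def c_def)
  qed
  define pair where "pair i j A B = A $ i $ i * B $ j $ j + A $ j $ j * B $ i $ i
      + A $ i $ j * B $ j $ i + A $ j $ i * B $ i $ j" for i j :: 'n and A B :: "complex^'n^'n"
  have off: "E (pair i j) = 2 * c" if ij: "i \<noteq> j" for i j
  proof -
    \<comment> \<open>Summing over these four values kills every term in which \<open>om\<close> or
      its conjugate occurs to the first or second power. Signs alone would leave the terms with
      \<open>om^2\<close>. What survives is \<open>pair i j\<close> and the two diagonal
      products.\<close>
    define I where "I = {1, -1, \<i>, -\<i>}"
    define Q where "Q om A = (A $ i $ i + A $ j $ j + om * A $ i $ j + cnj om * A $ j $ i) / 2"
      for om and A :: "complex^'n^'n"
    have sI: "(\<Sum>om\<in>I. f om) = f 1 + f (-1) + f \<i> + f (-\<i>)" for f :: "complex \<Rightarrow> complex"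
      by (simp add: I_def complex_eq_iff add.assoc)
    have "E (\<lambda>A B. Q om A * Q om B) = c" if "om \<in> I" for om
    proof -
      have om: "om * cnj om = 1" "cnj om * om = 1" using that by (auto simp: I_def)
      define s where "s = complex_of_real (1 / sqrt 2)"
      have s: "s * s = 1 / 2" "cnj s = s"
        by (simp_all add: s_def flip: of_real_mult)
      define w :: "'n \<Rightarrow> complex" where "w k = (if k = i then s else if k = j then s * om else 0)" for k
      have split: "(\<Sum>k\<in>UNIV. f k * w k) = f i * s + f j * (s * om)" for f :: "'n \<Rightarrow> complex"
      proof -
        have "(\<Sum>k\<in>UNIV. f k * w k) = (\<Sum>k\<in>{i, j}. f k * w k)"
          by (rule sum.mono_neutral_right) (auto simp: w_def)
        then show ?thesis using ij by (simp add: w_def)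
      qed
      have split': "(\<Sum>k\<in>UNIV. cnj (w k) * f k) = s * f i + s * cnj om * f j" for f :: "'n \<Rightarrow> complex"
      proof -
        have "(\<Sum>k\<in>UNIV. cnj (w k) * f k) = (\<Sum>k\<in>{i, j}. cnj (w k) * f k)"
          by (rule sum.mono_neutral_right) (auto simp: w_def)
        then show ?thesis using ij by (simp add: w_def s)
      qed
      have w: "(\<Sum>k\<in>UNIV. w k * cnj (w k)) = 1"
      proof -
        have "(\<Sum>k\<in>UNIV. w k * cnj (w k)) = s * s + s * s * (cnj om * om)"
          using split'[of w] ij by (simp add: w_def mult_ac)
        then show ?thesis by (simp add: s om)
      qed
      have q: "quad w g a = Q om (res g a)" for g a
      proof -
        have "quad w g a = (s * s) * (res g a $ i $ i + res g a $ i $ j * om + cnj om * res g a $ j $ i + (cnj om * om) * res g a $ j $ j)"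
          unfolding quad_def[OF w] mult.assoc sum_distrib_left[symmetric] split split'
          by (simp add: algebra_simps)
        then show ?thesis by (simp add: s om Q_def algebra_simps)
      qed
      show ?thesis using quad_moments(2)[OF w] by (simp add: q E_def c_def)
    qed
    then have "(\<Sum>om\<in>I. E (\<lambda>A B. Q om A * Q om B)) = (\<Sum>om\<in>I. c)"
      by (intro sum.cong) auto
    then have "4 * c = (\<Sum>om\<in>I. E (\<lambda>A B. Q om A * Q om B))"
      by (simp add: sI del: sum_constant)
    also have "\<dots> = E (\<lambda>A B. \<Sum>om\<in>I. Q om A * Q om B)"
      by (rule E_sum[symmetric]) (auto simp: Q_def intro!: continuous_intros)
    also have "\<dots> = E (\<lambda>A B. \<Sum>k<3. [pair i j A B, A $ i $ i * B $ i $ i, A $ j $ j * B $ j $ j] ! k)"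
      by (rule E_cong) (simp add: sI Q_def pair_def numeral_3_eq_3 field_simps)
    also have "\<dots> = (\<Sum>k<3. E (\<lambda>A B. [pair i j A B, A $ i $ i * B $ i $ i, A $ j $ j * B $ j $ j] ! k))"
    proof (rule E_sum)
      fix k
      show "continuous_on UNIV (\<lambda>X. [pair i j (fst X) (snd X), fst X $ i $ i * snd X $ i $ i, fst X $ j $ j * snd X $ j $ j] ! k)"
        by (cases k; cases "k - 1"; cases "k - 2") (auto simp: pair_def nth_Cons split: nat.splits intro!: continuous_intros)
    qed
    also have "\<dots> = E (pair i j) + c + c"
      using diag[of i] diag[of j] by (simp add: numeral_3_eq_3)
    finally show ?thesis by simp
  qed
  have diag2: "E (pair i i) = 4 * c" for i
  proof -
    have "E (pair i i) = E (\<lambda>A B. \<Sum>k<4::nat. A $ i $ i * B $ i $ i)"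
      by (rule E_cong) (simp add: pair_def)
    also have "\<dots> = (\<Sum>k<4::nat. E (\<lambda>A B. A $ i $ i * B $ i $ i))"
      by (rule E_sum) (auto intro!: continuous_intros)
    finally show ?thesis by (simp add: diag)
  qed
  have pc: "continuous_on UNIV (\<lambda>X. pair i j (fst X) (snd X))" for i j
    unfolding pair_def by (intro continuous_intros)
  \<comment> \<open>Over all ordered pairs of indices, \<open>pair\<close> yields each of tr A tr B
    and tr(AB) twice. The diagonal pairs contribute \<open>4 c\<close> instead of
    \<open>2 c\<close>, which turns n^2 into n (n + 1).\<close>
  have "E (\<lambda>A B. \<Sum>k<2::nat. Determinants.trace A * Determinants.trace B + Determinants.trace (A ** B))
      = E (\<lambda>A B. \<Sum>i\<in>UNIV. \<Sum>j\<in>UNIV. pair i j A B)"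
  proof (rule E_cong)
    fix A B :: "complex^'n^'n"
    have 1: "(\<Sum>i\<in>UNIV. \<Sum>j\<in>UNIV. A $ j $ j * B $ i $ i) = (\<Sum>i\<in>UNIV. \<Sum>j\<in>UNIV. A $ i $ i * B $ j $ j)"
      by (rule sum.swap)
    have 2: "(\<Sum>i\<in>UNIV. \<Sum>j\<in>UNIV. A $ j $ i * B $ i $ j) = (\<Sum>i\<in>UNIV. \<Sum>j\<in>UNIV. A $ i $ j * B $ j $ i)"
      by (rule sum.swap)
    show "(\<Sum>k<2::nat. Determinants.trace A * Determinants.trace B + Determinants.trace (A ** B))
        = (\<Sum>i\<in>UNIV. \<Sum>j\<in>UNIV. pair i j A B)"
      unfolding trace_mult unfolding trace_alt by (simp add: pair_def sum.distrib 1 2 sum_product)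
  qed
  also have "\<dots> = (\<Sum>i\<in>(UNIV::'n set). \<Sum>j\<in>(UNIV::'n set). E (pair i j))"
    by (subst E_sum, (intro continuous_intros pc), subst E_sum) (auto intro: pc)
  also have "\<dots> = (\<Sum>i\<in>(UNIV::'n set). \<Sum>j\<in>(UNIV::'n set). 2 * c + (if i = j then 2 * c else 0))"
    by (intro sum.cong refl) (auto simp: off diag2)
  also have "\<dots> = 2 * (of_nat CARD('n) * (of_nat CARD('n) + 1)) * c"
    by (simp add: sum.distrib algebra_simps)
  also have "E (\<lambda>A B. \<Sum>k<2::nat. Determinants.trace A * Determinants.trace B + Determinants.trace (A ** B))
      = (\<Sum>k<2::nat. E (\<lambda>A B. Determinants.trace A * Determinants.trace B + Determinants.trace (A ** B)))"
    by (rule E_sum) (intro continuous_intros)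
  finally have "2 * E (\<lambda>A B. Determinants.trace A * Determinants.trace B + Determinants.trace (A ** B))
      = 2 * (of_nat CARD('n) * (of_nat CARD('n) + 1) * c)"
    by (simp only: sum_constant card_lessThan of_nat_numeral mult.assoc)
  then have "E (\<lambda>A B. Determinants.trace A * Determinants.trace B + Determinants.trace (A ** B))
      = of_nat CARD('n) * (of_nat CARD('n) + 1) * c"
    by (simp only: mult_cancel_left) simp
  then show ?thesis by (simp only: E_def c_def mult.assoc)
qed

end

section \<open>Means of coefficient determinants\<close>

lemma pderiv_sum: "pderiv (\<Sum>i\<in>I. f i) = (\<Sum>i\<in>I. pderiv (f i))"
  by (induction I rule: infinite_finite_induct) (simp_all add: pderiv_add)

lemma pderiv_det:
  fixes A :: "('a::{idom,ring_char_0} poly)^'n^'n"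
  shows "pderiv (cdet A) = (\<Sum>k\<in>UNIV. cdet (\<chi> i. if i = k then (\<chi> j. pderiv (A $ i $ j)) else A $ i))"
proof -
  have s: "pderiv (of_int (sign p) * q) = of_int (sign p) * pderiv q" for p :: "'n \<Rightarrow> 'n" and q :: "'a poly"
    by (simp add: sign_def pderiv_minus)
  have "pderiv (cdet A) = (\<Sum>p\<in>{p. p permutes UNIV}. \<Sum>k\<in>UNIV. of_int (sign p) *
      (pderiv (A $ k $ p k) * (\<Prod>i\<in>UNIV - {k}. A $ i $ p i)))"
    by (simp add: Determinants.det_def pderiv_sum s pderiv_prod sum_distrib_left mult.commute)
  also have "\<dots> = (\<Sum>p\<in>{p. p permutes UNIV}. \<Sum>k\<in>UNIV. of_int (sign p) *
      (\<Prod>i\<in>UNIV. (if i = k then (\<chi> j. pderiv (A $ i $ j)) else A $ i) $ p i))"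
    by (intro sum.cong refl, subst prod.remove[of _ k for k]) (auto intro!: sum.cong prod.cong)
  also have "\<dots> = (\<Sum>k\<in>UNIV. \<Sum>p\<in>{p. p permutes UNIV}. of_int (sign p) *
      (\<Prod>i\<in>UNIV. (if i = k then (\<chi> j. pderiv (A $ i $ j)) else A $ i) $ p i))"
    by (rule sum.swap)
  finally show ?thesis by (simp add: Determinants.det_def)
qed

text \<open>The logarithmic derivative of the characteristic polynomial is the trace of the inverse
  of \<open>x - g\<close>, and \<open>x\<close> times this inverse is the identity plus the
  resolvent.\<close>

lemma pderiv_charpoly:
  fixes g :: "complex^'n^'n"
  assumes nz: "cdet (cmat x - g) \<noteq> 0"
  shows "x * poly (pderiv (charpoly g)) x
    = poly (charpoly g) x * (of_nat CARD('n) + Determinants.trace (resolvent g x))"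
proof -
  define Y where "Y = cmat x - g"
  \<comment> \<open>The transpose is used because differentiation replaces rows by unit rows,
    whereas the entries of the inverse are given by replacing columns.\<close>
  define C :: "complex poly^'n^'n" where "C = (\<chi> i j. (if i = j then [:0, 1:] else 0) - [:g $ j $ i:])"
  have Y0: "cdet Y \<noteq> 0" using nz by (simp add: Y_def)
  have "charpoly g = cdet (transpose C)"
    unfolding charpoly_def
    by (intro arg_cong[of _ _ cdet]) (auto simp: C_def Finite_Cartesian_Product.transpose_def Finite_Cartesian_Product.vec_eq_iff)
  then have "charpoly g = cdet C" by simp
  then have "poly (pderiv (charpoly g)) x
      = (\<Sum>k\<in>UNIV. cdet (\<chi> i j. poly ((if i = k then (\<chi> j. pderiv (C $ i $ j)) else C $ i) $ j) x))"
    by (simp add: pderiv_det poly_sum poly_det)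
  also have "\<dots> = (\<Sum>k\<in>UNIV. cdet Y * matrix_inv Y $ k $ k)"
  proof (rule sum.cong)
    fix k :: 'n
    have "cdet Y * matrix_inv Y $ k $ k = cdet (transpose (\<chi> i j. if j = k then (if i = k then 1 else 0) else Y $ i $ j))"
      using Y0 by (simp add: matrix_inv_entry)
    also have "transpose (\<chi> i j. if j = k then (if i = k then 1 else 0) else Y $ i $ j)
        = (\<chi> i j. poly ((if i = k then (\<chi> j. pderiv (C $ i $ j)) else C $ i) $ j) x)"
      by (auto simp: Finite_Cartesian_Product.vec_eq_iff Finite_Cartesian_Product.transpose_def C_def Y_def
          Finite_Cartesian_Product.mat_def pderiv_diff pderiv_pCons)
    finally show "cdet (\<chi> i j. poly ((if i = k then (\<chi> j. pderiv (C $ i $ j)) else C $ i) $ j) x) = cdet Y * matrix_inv Y $ k $ k"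
      by simp
  qed simp
  also have "\<dots> = cdet Y * Determinants.trace (matrix_inv Y)"
    by (simp add: trace_alt sum_distrib_left)
  finally have 1: "poly (pderiv (charpoly g)) x = cdet Y * Determinants.trace (matrix_inv Y)" .
  have "cmat x ** matrix_inv Y - resolvent g x = cmat 1"
    using matrix_inv_inverse(1)[OF Y0] by (simp add: resolvent_def Y_def matrix_diff_mult(1)[symmetric])
  then have "Determinants.trace (cmat x ** matrix_inv Y) = of_nat CARD('n) + Determinants.trace (resolvent g x)"
    by (metis Determinants.trace_I trace_sub diff_add_cancel)
  moreover have "Determinants.trace (cmat x ** matrix_inv Y) = x * Determinants.trace (matrix_inv Y)"
    unfolding trace_alt by (simp add: matrix_matrix_mult_def Finite_Cartesian_Product.mat_def sum_distrib_left
        if_distrib[of "\<lambda>x. x * _"] cong: if_cong)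
  ultimately show ?thesis by (simp add: 1 poly_charpoly Y_def[symmetric] mult_ac)
qed

lemma cmat_mult: "cmat x ** A = (\<chi> i j. x * A $ i $ j)" "A ** cmat x = (\<chi> i j. x * A $ i $ j)" for A :: "complex^'n^'n"
  by (auto simp: Finite_Cartesian_Product.vec_eq_iff matrix_matrix_mult_def Finite_Cartesian_Product.mat_def
        if_distrib[of "\<lambda>x. x * _"] if_distrib[of "\<lambda>x. _ * x"] cong: if_cong)

text \<open>From \<open>(y - x) S T = S - T\<close> for the two inverses \<open>S\<close>,
  \<open>T\<close>. It expresses the trace of a product of resolvents by single traces, hence by
  logarithmic derivatives.\<close>

lemma resolvent_identity:
  fixes g :: "complex^'n^'n"
  assumes x: "cdet (cmat x - g) \<noteq> 0" and y: "cdet (cmat y - g) \<noteq> 0"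
  shows "(x - y) * Determinants.trace (resolvent g x ** resolvent g y)
    = y * Determinants.trace (resolvent g y) - x * Determinants.trace (resolvent g x)"
proof -
  define S where "S = matrix_inv (cmat x - g)"
  define T where "T = matrix_inv (cmat y - g)"
  note SS = matrix_inv_inverse[OF x, folded S_def] and TT = matrix_inv_inverse[OF y, folded T_def]
  have Sg: "S ** g = cmat x ** S - cmat 1"
    using SS(2) by (simp add: matrix_diff_mult cmat_mult algebra_simps)
  have "S ** ((cmat y - g) - (cmat x - g)) ** T = S - T"
  proof -
    have "S ** ((cmat y - g) - (cmat x - g)) ** T = S ** ((cmat y - g) ** T) - (S ** (cmat x - g)) ** T"
      unfolding matrix_diff_mult(2)[of _ "cmat y - g" "cmat x - g"]
      by (subst matrix_diff_mult(1)) (simp only: matrix_mul_assoc)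
    then show ?thesis unfolding SS(2) TT(1) by simp
  qed
  moreover have "(cmat y - g) - (cmat x - g) = (cmat (y - x) :: complex^'n^'n)"
    by (auto simp: Finite_Cartesian_Product.vec_eq_iff Finite_Cartesian_Product.mat_def)
  ultimately have ST: "cmat (y - x) ** (S ** T) = S - T"
    by (simp add: cmat_mult) (simp add: Finite_Cartesian_Product.vec_eq_iff matrix_matrix_mult_def sum_distrib_left mult_ac)
  have tc: "Determinants.trace (cmat c ** A) = c * Determinants.trace A" for c and A :: "complex^'n^'n"
    by (simp add: trace_alt cmat_mult sum_distrib_left)
  have "resolvent g x ** resolvent g y = g ** (S ** g) ** T"
    by (simp add: resolvent_def S_def T_def matrix_mul_assoc)
  also have "\<dots> = g ** (cmat x ** S) ** T - g ** T"
    by (simp add: Sg matrix_diff_mult)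
  also have "g ** (cmat x ** S) ** T = cmat x ** (g ** (S ** T))"
    by (simp add: matrix_mul_assoc) (simp add: cmat_mult)
  finally have 1: "Determinants.trace (resolvent g x ** resolvent g y)
      = x * Determinants.trace (g ** (S ** T)) - Determinants.trace (resolvent g y)"
    by (simp add: trace_sub tc resolvent_def T_def)
  have 2: "(y - x) * Determinants.trace (g ** (S ** T)) = Determinants.trace (resolvent g x) - Determinants.trace (resolvent g y)"
  proof -
    have "(y - x) * Determinants.trace (g ** (S ** T)) = Determinants.trace (g ** (cmat (y - x) ** (S ** T)))"
      by (subst tc[symmetric]) (simp add: matrix_mul_assoc, simp add: cmat_mult)
    also have "\<dots> = Determinants.trace (g ** S) - Determinants.trace (g ** T)"
      unfolding ST by (simp add: matrix_diff_mult trace_sub)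
    finally show ?thesis by (simp add: resolvent_def S_def T_def)
  qed
  have "(x - y) * Determinants.trace (resolvent g x ** resolvent g y)
      = - x * ((y - x) * Determinants.trace (g ** (S ** T))) - (x - y) * Determinants.trace (resolvent g y)"
    unfolding 1 by (simp add: algebra_simps)
  then show ?thesis unfolding 2 by (simp add: algebra_simps)
qed

section \<open>Euler operators acting on Vandermonde determinants\<close>

text \<open>The Leibniz expansion of the Vandermonde determinant with a weight on the term with
  exponents \<open>p\<close>. The weight \<open>p a\<close> is the effect of the Euler operator
  \<open>x_a d/dx_a\<close>.\<close>

definition vandermonde_sum :: "nat \<Rightarrow> (nat \<Rightarrow> complex) \<Rightarrow> ((nat \<Rightarrow> nat) \<Rightarrow> complex) \<Rightarrow> complex" where
  "vandermonde_sum m x f = (\<Sum>p | p permutes {0..<m}. signof p * (\<Prod>a=0..<m. x a ^ p a) * f p)"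

lemma vandermonde_sum_one: "vandermonde_sum m x (\<lambda>_. 1) = power_alternant m (\<lambda>k. k) x"
  unfolding vandermonde_sum_def power_alternant_def
  by (subst det_def'[of _ m]) (auto intro!: sum.cong prod.cong dest: permutes_in_image)

lemma vandermonde_sum_const:
  "(\<And>p. p permutes {0..<m} \<Longrightarrow> f p = c) \<Longrightarrow> vandermonde_sum m x f = power_alternant m (\<lambda>k. k) x * c"
  unfolding vandermonde_sum_one[symmetric] unfolding vandermonde_sum_def
  by (simp add: sum_distrib_right)

lemma vandermonde_sum_add: "vandermonde_sum m x (\<lambda>p. f p + h p) = vandermonde_sum m x f + vandermonde_sum m x h"
  by (simp add: vandermonde_sum_def distrib_left sum.distrib)

lemma vandermonde_sum_mult: "vandermonde_sum m x (\<lambda>p. f p * c) = vandermonde_sum m x f * c"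
  by (simp add: vandermonde_sum_def sum_distrib_right mult.assoc)

lemma vandermonde_sum_sum: "vandermonde_sum m x (\<lambda>p. \<Sum>i\<in>I. f i p) = (\<Sum>i\<in>I. vandermonde_sum m x (f i))"
  unfolding vandermonde_sum_def sum_distrib_left by (rule sum.swap)

lemma coeff_det_leibniz:
  "coeff_det m q s = (\<Sum>p | p permutes {0..<m}. signof p * (\<Prod>a=0..<m. coeff (monom 1 (p a) * q) (s a)))"
  unfolding coeff_det_def
  by (subst det_def'[of _ m]) (auto intro!: sum.cong prod.cong dest: permutes_in_image)

text \<open>The determinants \<open>coeff_det m q s\<close> are the coefficients of the Vandermonde
  determinant times the product of all \<open>q (x a)\<close>, and the weight \<open>s a\<close> is
  the effect of \<open>x_a d/dx_a\<close>. On \<open>X^k q\<close> this operator gives the factor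
  \<open>k + u a\<close>, where \<open>u a\<close> is the logarithmic derivative of
  \<open>q\<close>. Applied below with \<open>T\<close> of at most two elements.\<close>

lemma coeff_det_moment:
  assumes T: "T \<subseteq> {0..<m}"
    and u: "\<And>a. a < m \<Longrightarrow> x a * poly (pderiv q) (x a) = poly q (x a) * u a"
  shows "(\<Sum>s\<in>PiE {0..<m} (\<lambda>_. {..<m + degree q}). (\<Prod>a=0..<m. x a ^ s a) * coeff_det m q s * (\<Prod>a\<in>T. of_nat (s a)))
    = (\<Prod>a=0..<m. poly q (x a)) * vandermonde_sum m x (\<lambda>p. \<Prod>a\<in>T. of_nat (p a) + u a)"
proof -
  let ?n = "m + degree q"
  have T_prod: "(\<Prod>a\<in>T. f a) = (\<Prod>a=0..<m. if a \<in> T then f a else 1)" for f :: "nat \<Rightarrow> complex"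
    using T by (intro prod.mono_neutral_cong_left) auto
  \<comment> \<open>After the Leibniz expansion the variables separate, and each contributes one
    such sum. The bound \<open>?n\<close> exceeds the degree of \<open>X^k q\<close> for every
    \<open>k < m\<close>.\<close>
  have row: "(\<Sum>i<?n. x a ^ i * coeff (monom 1 k * q) i * (if a \<in> T then of_nat i else 1))
      = poly q (x a) * (x a ^ k * (if a \<in> T then of_nat k + u a else 1))"
    if a: "a < m" and k: "k < m" for a k
  proof -
    define r where "r = monom 1 k * q"
    have eval: "poly r y = (\<Sum>i<?n. coeff r i * y ^ i)" for y
    proof -
      have "degree r \<le> k + degree q" unfolding r_def
        by (rule order_trans[OF degree_mult_le]) (simp add: degree_monom_le)
      then show ?thesis using k unfolding poly_altdef
        by (intro sum.mono_neutral_left) (auto simp: coeff_eq_0)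
    qed
    show ?thesis
    proof (cases "a \<in> T")
      case False
      then show ?thesis using eval[of "x a"] by (simp add: r_def[symmetric] mult.commute)
        (simp add: r_def poly_monom mult.commute)
    next
      case True
      have "x a * poly (pderiv r) (x a) = (\<Sum>i<?n. x a ^ i * coeff r i * of_nat i)"
      proof -
        have "r = (\<Sum>i<?n. monom (coeff r i) i)"
        proof (rule poly_eqI)
          fix j
          have "degree r \<le> k + degree q" unfolding r_def
            by (rule order_trans[OF degree_mult_le]) (simp add: degree_monom_le)
          then show "coeff r j = coeff (\<Sum>i<?n. monom (coeff r i) i) j"
            using k by (cases "j < ?n") (auto simp: coeff_sum coeff_eq_0)
        qed
        then have "poly (pderiv r) (x a) = (\<Sum>i<?n. poly (pderiv (monom (coeff r i) i)) (x a))"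
          by (metis (no_types, lifting) pderiv_sum poly_sum sum.cong)
        also have "x a * \<dots> = (\<Sum>i<?n. x a ^ i * coeff r i * of_nat i)"
          unfolding sum_distrib_left
        proof (rule sum.cong)
          fix i
          show "x a * poly (pderiv (monom (coeff r i) i)) (x a) = x a ^ i * coeff r i * of_nat i"
            by (cases i) (simp_all add: pderiv_monom poly_monom mult_ac)
        qed simp
        finally show ?thesis .
      qed
      moreover have "x a * poly (pderiv r) (x a) = poly q (x a) * (x a ^ k * (of_nat k + u a))"
      proof -
        have "x a * poly (pderiv r) (x a) = x a ^ k * (x a * poly (pderiv q) (x a)) + x a * poly (pderiv (monom 1 k)) (x a) * poly q (x a)"
          by (simp add: r_def pderiv_mult poly_monom algebra_simps)
        also have "x a * poly (pderiv (monom 1 k)) (x a) = of_nat k * x a ^ k"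
          by (cases k) (simp_all add: pderiv_monom poly_monom)
        finally show ?thesis unfolding u[OF a] by (simp add: algebra_simps)
      qed
      ultimately show ?thesis using True by (simp add: r_def)
    qed
  qed
  have "(\<Sum>s\<in>PiE {0..<m} (\<lambda>_. {..<?n}). (\<Prod>a=0..<m. x a ^ s a) * coeff_det m q s * (\<Prod>a\<in>T. of_nat (s a)))
      = (\<Sum>s\<in>PiE {0..<m} (\<lambda>_. {..<?n}). \<Sum>p | p permutes {0..<m}. signof p *
          (\<Prod>a=0..<m. x a ^ s a * coeff (monom 1 (p a) * q) (s a) * (if a \<in> T then of_nat (s a) else 1)))"
    unfolding coeff_det_leibniz sum_distrib_left sum_distrib_right T_prod prod.distrib by (simp add: mult_ac)
  also have "\<dots> = (\<Sum>p | p permutes {0..<m}. signof p * (\<Sum>s\<in>PiE {0..<m} (\<lambda>_. {..<?n}).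
          (\<Prod>a=0..<m. x a ^ s a * coeff (monom 1 (p a) * q) (s a) * (if a \<in> T then of_nat (s a) else 1))))"
    by (subst sum.swap) (simp add: sum_distrib_left)
  also have "\<dots> = (\<Sum>p | p permutes {0..<m}. signof p *
      (\<Prod>a=0..<m. \<Sum>i<?n. x a ^ i * coeff (monom 1 (p a) * q) i * (if a \<in> T then of_nat i else 1)))"
    by (subst prod_sum_PiE) auto
  also have "\<dots> = (\<Sum>p | p permutes {0..<m}. signof p *
      (\<Prod>a=0..<m. poly q (x a) * (x a ^ p a * (if a \<in> T then of_nat (p a) + u a else 1))))"
    by (intro sum.cong refl arg_cong2[of _ _ _ _ "(*)"] prod.cong row) (auto dest: permutes_in_image)
  also have "\<dots> = (\<Prod>a=0..<m. poly q (x a)) * vandermonde_sum m x (\<lambda>p. \<Prod>a\<in>T. of_nat (p a) + u a)"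
    unfolding vandermonde_sum_def T_prod sum_distrib_left prod.distrib by (simp add: mult_ac)
  finally show ?thesis .
qed

lemma power_alternant_repeated:
  assumes "a < m" "c < m" "a \<noteq> c" "x a = x c"
  shows "power_alternant m l x = 0"
  unfolding power_alternant_def
  by (rule Determinant.det_identical_rows[of _ m a c]) (use assms in \<open>auto intro!: eq_vecI\<close>)

text \<open>As a function of \<open>x a\<close>, the Vandermonde determinant is a multiple of \<open>\<Prod>\<^sub>c (X - x c)\<close>.\<close>

lemma vandermonde_sum_exponent:
  assumes a: "a < m" and dist: "inj_on x {0..<m}"
  shows "vandermonde_sum m x (\<lambda>p. of_nat (p a)) = power_alternant m (\<lambda>k. k) x * (\<Sum>c\<in>{0..<m} - {a}. x a / (x a - x c))"
proof -
  define I where "I = {0..<m} - {a}"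
  have finI: "finite I" by (simp add: I_def)
  define D where "D = (\<Sum>p | p permutes {0..<m}. monom (signof p * (\<Prod>b\<in>I. x b ^ p b)) (p a))"
  define E where "E = (\<Prod>c\<in>I. [:- x c, 1:])"
  have remove: "(\<Prod>b=0..<m. f b) = f a * (\<Prod>b\<in>I. f b)" for f :: "nat \<Rightarrow> complex"
    unfolding I_def using a by (intro prod.remove) auto
  have evalD: "poly D y = power_alternant m (\<lambda>k. k) (x(a := y))" for y
    unfolding vandermonde_sum_one[symmetric] vandermonde_sum_def D_def poly_sum poly_monom remove
    by (intro sum.cong refl) (auto simp: I_def intro!: prod.cong)
  have degD: "degree D < m" unfolding D_def
  proof (rule degree_sum_less)
    fix p assume "p \<in> {p. p permutes {0..<m}}"
    then have "p a < m" using a permutes_in_image[of p "{0..<m}" a] by simp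
    then show "degree (monom (signof p * (\<Prod>b\<in>I. x b ^ p b)) (p a)) < m"
      by (rule le_less_trans[OF degree_monom_le])
  qed (use a in simp)
  have degE: "degree E < m" unfolding E_def
    using a by (subst degree_prod_sum_eq) (auto simp: I_def)
  have E0: "poly E (x a) \<noteq> 0"
    using dist a by (auto simp: E_def poly_prod I_def dest: inj_onD)
  have "Polynomial.smult (poly E (x a)) D = Polynomial.smult (poly D (x a)) E"
  proof (rule poly_eqI_degree[where A = "x ` {0..<m}"])
    fix y assume "y \<in> x ` {0..<m}"
    then obtain c where c: "c < m" "y = x c" by auto
    show "poly (Polynomial.smult (poly E (x a)) D) y = poly (Polynomial.smult (poly D (x a)) E) y"
    proof (cases "c = a")
      case False
      then have "poly D y = 0"
        unfolding evalD c using a c by (intro power_alternant_repeated[of a m c]) auto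
      moreover have "poly E y = 0"
        using False c by (auto simp: E_def poly_prod I_def)
      ultimately show ?thesis by simp
    qed (simp add: c)
  qed (use degD degE dist in \<open>auto simp: card_image intro: le_less_trans[OF degree_smult_le]\<close>)
  from arg_cong[OF this, of "\<lambda>p. poly (pderiv p) (x a)"]
  have "poly E (x a) * poly (pderiv D) (x a) = poly D (x a) * poly (pderiv E) (x a)"
    by (simp add: pderiv_smult)
  moreover have "poly (pderiv E) (x a) = poly E (x a) * (\<Sum>c\<in>I. 1 / (x a - x c))"
  proof -
    have 1: "poly (pderiv E) (x a) = (\<Sum>c\<in>I. \<Prod>b\<in>I - {c}. x a - x b)"
      unfolding E_def pderiv_prod poly_sum poly_mult poly_prod by (simp add: pderiv_pCons)
    have 2: "(\<Prod>b\<in>I - {c}. x a - x b) = poly E (x a) * (1 / (x a - x c))" if c: "c \<in> I" for c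
    proof -
      have "x a \<noteq> x c" using a c inj_on_eq_iff[OF dist, of a c] by (auto simp: I_def)
      moreover have "poly E (x a) = (\<Prod>b\<in>I. x a - x b)" unfolding E_def poly_prod by simp
      moreover have "(\<Prod>b\<in>I. x a - x b) = (x a - x c) * (\<Prod>b\<in>I - {c}. x a - x b)"
        by (rule prod.remove[OF finI c])
      ultimately show ?thesis by simp
    qed
    show ?thesis unfolding 1 sum_distrib_left by (rule sum.cong[OF refl 2])
  qed
  ultimately have "poly (pderiv D) (x a) = poly D (x a) * (\<Sum>c\<in>I. 1 / (x a - x c))"
    using E0 by simp
  moreover have "vandermonde_sum m x (\<lambda>p. of_nat (p a)) = x a * poly (pderiv D) (x a)"
  proof -
    have "x a * poly (pderiv (monom c k)) (x a) = of_nat k * (x a ^ k * c)" for c k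
      by (cases k) (simp_all add: pderiv_monom poly_monom)
    then show ?thesis
      unfolding vandermonde_sum_def D_def pderiv_sum poly_sum sum_distrib_left remove by (simp add: mult_ac)
  qed
  ultimately show ?thesis
    using evalD[of "x a"] by (simp add: I_def sum_distrib_left mult.commute)
qed

definition off_diag :: "'b set \<Rightarrow> ('b \<Rightarrow> 'b \<Rightarrow> complex) \<Rightarrow> complex" where
  "off_diag S f = (\<Sum>a\<in>S. \<Sum>b\<in>S - {a}. f a b)"

lemma off_diag_alt: "finite S \<Longrightarrow> off_diag S f = (\<Sum>a\<in>S. \<Sum>b\<in>S. if a = b then 0 else f a b)"
  unfolding off_diag_def by (intro sum.cong refl sum.mono_neutral_cong_left) auto

lemma off_diag_swap: "finite S \<Longrightarrow> off_diag S f = off_diag S (\<lambda>a b. f b a)"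
  unfolding off_diag_alt by (subst sum.swap) (intro sum.cong refl, auto)

lemma off_diag_add: "off_diag S (\<lambda>a b. f a b + h a b) = off_diag S f + off_diag S h"
  by (simp add: off_diag_def sum.distrib)

lemma off_diag_cmult: "off_diag S (\<lambda>a b. c * f a b) = c * off_diag S f"
  by (simp add: off_diag_def sum_distrib_left)

lemma off_diag_cong:
  "(\<And>a b. a \<in> S \<Longrightarrow> b \<in> S \<Longrightarrow> a \<noteq> b \<Longrightarrow> f a b = h a b) \<Longrightarrow> off_diag S f = off_diag S h"
  unfolding off_diag_def by (intro sum.cong) auto

lemma off_diag_prod:
  "finite S \<Longrightarrow> off_diag S (\<lambda>a b. f a * h b) = (\<Sum>a\<in>S. f a) * (\<Sum>b\<in>S. h b) - (\<Sum>a\<in>S. f a * h a)"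
  unfolding off_diag_def sum_product sum_subtractf[symmetric]
  by (intro sum.cong refl) (simp add: sum.remove)

lemma off_diag_const: "finite S \<Longrightarrow> off_diag S (\<lambda>a b. c) = of_nat (card S) * (of_nat (card S) - 1) * c"
  using off_diag_prod[of S "\<lambda>_. c" "\<lambda>_. 1"] by (simp add: algebra_simps)

text \<open>\<open>T\<close> and \<open>W\<close> stand for the traces of resolvents and of their
  products. The cross terms produce difference quotients of \<open>x a * T a\<close>, which the
  resolvent identity turns into \<open>W\<close>; thus the second-order terms come in exactly the
  combination \<open>T a * T b + W a b\<close> whose mean is known from
  \<open>trace_moment2\<close>.\<close>

lemma vandermonde_pair_sum:
  fixes N :: complex
  assumes dist: "inj_on x {0..<m}"
    and W: "\<And>a b. a < m \<Longrightarrow> b < m \<Longrightarrow> a \<noteq> b \<Longrightarrow> (x a - x b) * W a b = x b * T b - x a * T a"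
  defines "S \<equiv> {0..<m}" and "C \<equiv> \<Sum>k=0..<m. complex_of_nat k"
  shows "vandermonde_sum m x (\<lambda>p. off_diag S (\<lambda>a b. (of_nat (p a) + (N + T a)) * (of_nat (p b) + (N + T b))))
    = power_alternant m (\<lambda>k. k) x * ((C\<^sup>2 - (\<Sum>k=0..<m. (of_nat k)\<^sup>2)) + 2 * C * (of_nat m * N)
        - of_nat m * (of_nat m - 1) * N + of_nat m * (of_nat m - 1) * N\<^sup>2
        + (2 * C + 2 * N * (of_nat m - 1)) * (\<Sum>a\<in>S. T a)
        + off_diag S (\<lambda>a b. T a * T b + W a b))"
proof -
  define V where "V = power_alternant m (\<lambda>k. k) x"
  define u where "u a = N + T a" for a
  define d where "d a = (\<Sum>c\<in>S - {a}. x a / (x a - x c))" for a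
  have fin: "finite S" by (simp add: S_def)
  have neq: "x a - x b \<noteq> 0" if "a \<in> S" "b \<in> S" "a \<noteq> b" for a b
    using that dist by (auto simp: S_def dest: inj_onD)
  \<comment> \<open>The terms for \<open>(a, c)\<close> and \<open>(c, a)\<close> add up to
    one.\<close>
  have C2: "2 * (\<Sum>a\<in>S. d a) = of_nat m * (of_nat m - 1)"
  proof -
    have "2 * (\<Sum>a\<in>S. d a) = off_diag S (\<lambda>a c. x a / (x a - x c)) + off_diag S (\<lambda>a c. x c / (x c - x a))"
      using off_diag_swap[OF fin, of "\<lambda>a c. x a / (x a - x c)"] by (simp add: off_diag_def d_def)
    also have "\<dots> = off_diag S (\<lambda>a c. 1)"
      unfolding off_diag_add[symmetric]
    proof (rule off_diag_cong)
      fix a b assume "a \<in> S" "b \<in> S" "a \<noteq> b"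
      from neq[OF this] neq[OF this(2,1) this(3)[symmetric]]
      show "x a / (x a - x b) + x b / (x b - x a) = 1"
        by (simp add: divide_simps) (simp add: algebra_simps)
    qed
    finally show ?thesis by (simp add: off_diag_const[OF fin]) (simp add: S_def)
  qed
  have C: "2 * C = of_nat m * (of_nat m - 1)"
    unfolding C_def by (induction m) (simp_all add: algebra_simps)
  have Vd: "vandermonde_sum m x (\<lambda>p. of_nat (p a)) = V * d a" if "a \<in> S" for a
    using vandermonde_sum_exponent[OF _ dist, of a] that by (simp add: V_def d_def S_def)
  have p1: "(\<Sum>a\<in>S. of_nat (p a)) = C" and p2: "(\<Sum>a\<in>S. (of_nat (p a))\<^sup>2) = (\<Sum>k=0..<m. (complex_of_nat k)\<^sup>2)"
    if p: "p permutes {0..<m}" for p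
    unfolding S_def C_def using sum.permute[OF p, of "\<lambda>k. complex_of_nat k"] sum.permute[OF p, of "\<lambda>k. (complex_of_nat k)\<^sup>2"]
    by (simp_all add: o_def)
  \<comment> \<open>The sum over pairs of \<open>p a * p b\<close> is the same for all permutations,
    so only the terms linear in \<open>p a\<close> require the derivative of the Vandermonde
    determinant.\<close>
  have "vandermonde_sum m x (\<lambda>p. off_diag S (\<lambda>a b. (of_nat (p a) + u a) * (of_nat (p b) + u b)))
      = vandermonde_sum m x (\<lambda>p. ((C\<^sup>2 - (\<Sum>k=0..<m. (of_nat k)\<^sup>2)) + off_diag S (\<lambda>a b. u a * u b))
          + (\<Sum>a\<in>S. of_nat (p a) * (2 * (\<Sum>b\<in>S - {a}. u b))))"
  proof -
    have "off_diag S (\<lambda>a b. (of_nat (p a) + u a) * (of_nat (p b) + u b))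
        = ((C\<^sup>2 - (\<Sum>k=0..<m. (of_nat k)\<^sup>2)) + off_diag S (\<lambda>a b. u a * u b))
          + (\<Sum>a\<in>S. of_nat (p a) * (2 * (\<Sum>b\<in>S - {a}. u b)))" if p: "p permutes {0..<m}" for p
    proof -
      have "off_diag S (\<lambda>a b. (of_nat (p a) + u a) * (of_nat (p b) + u b))
          = off_diag S (\<lambda>a b. of_nat (p a) * of_nat (p b)) + off_diag S (\<lambda>a b. u a * u b)
           + (off_diag S (\<lambda>a b. of_nat (p a) * u b) + off_diag S (\<lambda>a b. of_nat (p b) * u a))"
        unfolding off_diag_add[symmetric] by (intro off_diag_cong) (simp add: algebra_simps)
      also have "off_diag S (\<lambda>a b. of_nat (p b) * u a) = off_diag S (\<lambda>a b. of_nat (p a) * u b)"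
        by (rule off_diag_swap[OF fin])
      also have "off_diag S (\<lambda>a b. of_nat (p a) * of_nat (p b)) = C\<^sup>2 - (\<Sum>k=0..<m. (of_nat k)\<^sup>2)"
        unfolding off_diag_prod[OF fin] p1[OF p] power2_eq_square[symmetric] p2[OF p] ..
      finally show ?thesis by (simp add: off_diag_def sum_distrib_left mult.left_commute flip: mult_2)
    qed
    then show ?thesis unfolding vandermonde_sum_def by (intro sum.cong refl) simp
  qed
  also have "\<dots> = V * ((C\<^sup>2 - (\<Sum>k=0..<m. (of_nat k)\<^sup>2)) + off_diag S (\<lambda>a b. u a * u b))
      + (\<Sum>a\<in>S. V * d a * (2 * (\<Sum>b\<in>S - {a}. u b)))"
    by (subst vandermonde_sum_add, subst vandermonde_sum_sum, subst vandermonde_sum_mult)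
       (intro arg_cong2[of _ _ _ _ "(+)"] sum.cong, auto simp: Vd V_def intro: vandermonde_sum_const)
  also have "(\<Sum>a\<in>S. V * d a * (2 * (\<Sum>b\<in>S - {a}. u b))) = V * (2 * off_diag S (\<lambda>a b. d a * u b))"
    by (simp add: off_diag_def sum_distrib_left mult_ac)
  \<comment> \<open>The product of the two full sums also contains the diagonal terms
    \<open>d a * u a\<close>, which have to be subtracted.\<close>
  also have "2 * off_diag S (\<lambda>a b. d a * u b) = 2 * C * (\<Sum>a\<in>S. u a) - 2 * (\<Sum>a\<in>S. d a * u a)"
    unfolding off_diag_prod[OF fin] C C2[symmetric] by (simp add: algebra_simps)
  \<comment> \<open>Symmetrized over \<open>a\<close> and \<open>b\<close>, the terms become the
    quotient of \<open>x a * u a - x b * u b\<close> by \<open>x a - x b\<close>, to which the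
    hypothesis on \<open>W\<close> applies.\<close>
  also have "2 * (\<Sum>a\<in>S. d a * u a) = off_diag S (\<lambda>a b. N + (- 1) * W a b)"
  proof -
    have "2 * (\<Sum>a\<in>S. d a * u a) = off_diag S (\<lambda>a b. x a / (x a - x b) * u a) + off_diag S (\<lambda>a b. x b / (x b - x a) * u b)"
      unfolding off_diag_swap[OF fin, of "\<lambda>a b. x b / (x b - x a) * u b"]
      by (simp add: off_diag_def d_def sum_distrib_right)
    also have "\<dots> = off_diag S (\<lambda>a b. N + (- 1) * W a b)"
      unfolding off_diag_add[symmetric]
    proof (rule off_diag_cong)
      fix a b assume ab: "a \<in> S" "b \<in> S" "a \<noteq> b"
      have n: "x a - x b \<noteq> 0" by (rule neq[OF ab])
      have e: "(x a - x b) * W a b = x b * T b - x a * T a" using W[of a b] ab by (simp add: S_def)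
      have "x b / (x b - x a) * u b = - (x b / (x a - x b)) * u b"
        by (metis minus_diff_eq minus_divide_right)
      then have "(x a - x b) * (x a / (x a - x b) * u a + x b / (x b - x a) * u b) = x a * u a - x b * u b"
        using n by (simp only: distrib_left mult_minus_left mult_minus_right) simp
      also have "\<dots> = (x a - x b) * (N + (- 1) * W a b)"
        unfolding distrib_left mult.left_commute[of _ "- 1"] e by (simp add: u_def algebra_simps)
      finally show "x a / (x a - x b) * u a + x b / (x b - x a) * u b = N + (- 1) * W a b"
        using n by (simp only: mult_cancel_left) simp
    qed
    finally show ?thesis .
  qed
  also have "off_diag S (\<lambda>a b. N + (- 1) * W a b) = of_nat m * (of_nat m - 1) * N - off_diag S W"
    unfolding off_diag_add off_diag_cmult off_diag_const[OF fin] by (simp add: S_def)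
  also have "off_diag S (\<lambda>a b. u a * u b) = of_nat m * (of_nat m - 1) * N\<^sup>2 + 2 * N * (of_nat m - 1) * (\<Sum>a\<in>S. T a)
      + off_diag S (\<lambda>a b. T a * T b)"
    unfolding off_diag_prod[OF fin] u_def
    by (simp add: S_def sum.distrib power2_eq_square algebra_simps sum_distrib_left[symmetric] sum_distrib_right[symmetric])
  also have "(\<Sum>a\<in>S. u a) = of_nat m * N + (\<Sum>a\<in>S. T a)"
    by (simp add: u_def sum.distrib S_def)
  finally show ?thesis
    unfolding off_diag_add u_def V_def by (simp add: algebra_simps)
qed

section \<open>Comparison of coefficients of the generating function\<close>

lemma base_expansion_inj:
  fixes B :: nat
  assumes "(\<Sum>a<m. s a * B ^ a) = (\<Sum>a<m. t a * B ^ a)"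
    and "\<And>a. a < m \<Longrightarrow> s a < B" "\<And>a. a < m \<Longrightarrow> t a < B" and "a < m"
  shows "s a = t a"
  using assms
proof (induction m arbitrary: s t a)
  case (Suc m)
  have shift: "(\<Sum>a<Suc m. f a * B ^ a) = f 0 + B * (\<Sum>a<m. f (Suc a) * B ^ a)" for f
    by (subst sum.lessThan_Suc_shift) (simp add: sum_distrib_left mult_ac)
  have B: "s 0 < B" "t 0 < B" using Suc.prems by auto
  have eq: "s 0 + B * (\<Sum>a<m. s (Suc a) * B ^ a) = t 0 + B * (\<Sum>a<m. t (Suc a) * B ^ a)"
    using Suc.prems(1) unfolding shift .
  from arg_cong[OF eq, of "\<lambda>n. n mod B"] arg_cong[OF eq, of "\<lambda>n. n div B"] B
  have 0: "s 0 = t 0" and "(\<Sum>a<m. s (Suc a) * B ^ a) = (\<Sum>a<m. t (Suc a) * B ^ a)"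
    by simp_all
  then have "s (Suc b) = t (Suc b)" if "b < m" for b
    using that Suc.prems(2,3) by (intro Suc.IH[of "\<lambda>a. s (Suc a)" "\<lambda>a. t (Suc a)"]) auto
  with 0 show ?case using Suc.prems(4) by (cases a) auto
qed simp

text \<open>
  The points \<open>x a = y ^ (B ^ a)\<close> separate the monomials of degree below \<open>B\<close> in each variable, and they
  can be taken distinct and arbitrarily large, where resolvents of unitary matrices exist.
\<close>

lemma monomial_coeffs_zero:
  fixes c :: "(nat \<Rightarrow> nat) \<Rightarrow> complex" and K :: real
  assumes z: "\<And>y. y > K \<Longrightarrow> (\<Sum>s\<in>PiE {0..<m} (\<lambda>_. {..<n}). c s * (\<Prod>a=0..<m. (of_real y ^ (B ^ a)) ^ s a)) = 0"
    and B: "n \<le> B" and s: "s \<in> PiE {0..<m} (\<lambda>_. {..<n})"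
  shows "c s = 0"
proof -
  define I where "I = PiE {0..<m} (\<lambda>_. {..<n})"
  define enc where "enc s = (\<Sum>a<m. s a * B ^ a)" for s :: "nat \<Rightarrow> nat"
  define Q where "Q = (\<Sum>s\<in>I. monom (c s) (enc s))"
  have fin: "finite I" unfolding I_def by (intro finite_PiE) auto
  have inj: "s = t" if "s \<in> I" "t \<in> I" "enc s = enc t" for s t
  proof (rule PiE_ext[OF that(1,2)[unfolded I_def]])
    fix a assume "a \<in> {0..<m}"
    then show "s a = t a"
      using that B by (intro base_expansion_inj[where s = s and t = t and m = m and B = B]) (auto simp: I_def enc_def PiE_def Pi_def intro: less_le_trans)
  qed
  have "poly Q (of_real y) = 0" if "y > K" for y
  proof -
    have "poly Q (of_real y) = (\<Sum>s\<in>I. c s * (\<Prod>a=0..<m. (of_real y ^ (B ^ a)) ^ s a))"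
      unfolding Q_def poly_sum poly_monom enc_def
      by (intro sum.cong refl) (simp add: power_mult[symmetric] power_sum mult.commute lessThan_atLeast0)
    then show ?thesis using z[OF that] by (simp add: I_def)
  qed
  then have "complex_of_real ` {K<..} \<subseteq> {y. poly Q y = 0}" by auto
  moreover have "infinite (complex_of_real ` {K<..})"
    by (subst finite_image_iff) (auto simp: inj_on_def infinite_Ioi)
  ultimately have "Q = 0" using poly_roots_finite finite_subset by blast
  then have "0 = coeff Q (enc s)" by simp
  also have "\<dots> = (\<Sum>t\<in>I. if t = s then c t else 0)"
    unfolding Q_def coeff_sum using inj s by (intro sum.cong) (auto simp: I_def)
  also have "\<dots> = c s" using fin s by (simp add: I_def)
  finally show ?thesis by simp
qed

text \<open>A permutation other than the identity moves some index, and entries off the diagonal are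
  constants, so all terms collected in \<open>R\<close> have smaller degree.\<close>

lemma charpoly_degree_coeff:
  fixes g :: "complex^'n^'n"
  shows "degree (charpoly g) = CARD('n)" "coeff (charpoly g) CARD('n) = 1"
proof -
  define A :: "complex poly^'n^'n" where "A = (\<chi> i j. (if i = j then [:0, 1:] else 0) - [:g $ i $ j:])"
  define R where "R = (\<Sum>p\<in>{p. p permutes (UNIV::'n set)} - {id}. of_int (sign p) * (\<Prod>i\<in>UNIV. A $ i $ p i))"
  have "charpoly g = (\<Prod>i\<in>UNIV. A $ i $ i) + R"
    unfolding charpoly_def A_def[symmetric] Determinants.det_def R_def
    by (subst sum.remove[of _ id]) (auto simp: permutes_id)
  also have "(\<Prod>i\<in>UNIV. A $ i $ i) = (\<Prod>i\<in>UNIV. [:- (g $ i $ i), 1:])"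
    by (intro prod.cong) (auto simp: A_def)
  finally have split: "charpoly g = (\<Prod>i\<in>UNIV. [:- (g $ i $ i), 1:]) + R" .
  have d1: "degree (\<Prod>i\<in>UNIV. [:- (g $ i $ i), 1:]) = CARD('n)"
    by (subst degree_prod_sum_eq) auto
  have c1: "coeff (\<Prod>i\<in>UNIV. [:- (g $ i $ i), 1:]) CARD('n) = 1"
    using lead_coeff_prod[of "\<lambda>i. [:- (g $ i $ i), 1:]" UNIV] by (simp add: d1)
  have dR: "degree R < CARD('n)"
    unfolding R_def
  proof (rule degree_sum_less)
    fix p :: "'n \<Rightarrow> 'n" assume p: "p \<in> {p. p permutes UNIV} - {id}"
    then obtain i where i: "p i \<noteq> i" by fastforce
    have "degree (of_int (sign p) * (\<Prod>i\<in>UNIV. A $ i $ p i)) = degree (\<Prod>i\<in>UNIV. A $ i $ p i)"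
      by (simp add: sign_def)
    also have "\<dots> \<le> (\<Sum>i\<in>UNIV. degree (A $ i $ p i))"
      using degree_prod_sum_le[of UNIV "\<lambda>i. A $ i $ p i"] by (simp add: o_def)
    also have "\<dots> \<le> (\<Sum>i\<in>(UNIV::'n set). if p i = i then 1 else 0)"
      by (intro sum_mono) (auto simp: A_def)
    also have "\<dots> < (\<Sum>i\<in>(UNIV::'n set). 1)"
      by (rule sum_strict_mono_ex1) (use i in auto)
    finally show "degree (of_int (sign p) * (\<Prod>i\<in>UNIV. A $ i $ p i)) < CARD('n)" by simp
  qed simp
  show "degree (charpoly g) = CARD('n)"
    unfolding split using dR d1 by (simp add: degree_add_eq_left)
  show "coeff (charpoly g) CARD('n) = 1"
    unfolding split using dR c1 by (simp add: coeff_eq_0)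
qed

lemma continuous_on_coeff_charpoly [continuous_intros]:
  "continuous_on S (\<lambda>g :: complex^'n^'n. coeff (charpoly g) k)"
proof -
  have prod: "continuous_on S (\<lambda>g. coeff (\<Prod>i\<in>I. q i g) k)"
    if "finite I" "\<And>i k. continuous_on S (\<lambda>g. coeff (q i g) k)"
    for I :: "'n set" and q :: "'n \<Rightarrow> complex^'n^'n \<Rightarrow> complex poly" and k
    using that(1)
    by (induction I arbitrary: k) (auto simp: coeff_mult intro!: continuous_intros that)
  have entry: "continuous_on S (\<lambda>g. coeff ((if i = j then [:0, 1:] else 0) - [:g $ i $ j:]) k)" for i j k
    by (cases k) (auto simp: coeff_pCons split: nat.splits intro!: continuous_intros)
  have scalar: "coeff (of_int (sign p) * q) k = of_int (sign p) * coeff q k" for p :: "'n \<Rightarrow> 'n" and q :: "complex poly"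
    by (simp add: sign_def)
  show ?thesis
    unfolding charpoly_def Determinants.det_def coeff_sum scalar
    by (intro continuous_intros prod) (use entry in auto)
qed

lemma continuous_on_coeff_det [continuous_intros]:
  "continuous_on S (\<lambda>g :: complex^'n^'n. coeff_det m (charpoly g) s)"
proof -
  have "continuous_on S (\<lambda>g :: complex^'n^'n. coeff (monom 1 k * charpoly g) i)" for k i
    by (cases "k \<le> i") (auto simp: coeff_monom_mult intro!: continuous_intros)
  then show ?thesis
    unfolding coeff_det_leibniz by (intro continuous_intros)
qed

context haar
begin

text \<open>By the two trace moments, weighting the generating function of the means with the sum of
  the \<open>s a\<close>, or with the sum of \<open>s a * s b\<close> over ordered pairs, multiplies
  it by a constant. A nonzero coefficient must therefore carry exactly that weight.\<close>

lemma det_mean_coeff_det: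
  fixes m p :: nat
  assumes s: "s \<in> PiE {0..<m} (\<lambda>_. {..<m + CARD('n)})"
    and nz: "det_mean p (\<lambda>g. coeff_det m (charpoly g) s) \<noteq> 0"
  defines "C \<equiv> (\<Sum>k=0..<m. complex_of_nat k)" and "N \<equiv> complex_of_nat CARD('n)"
  shows "(\<Sum>a=0..<m. complex_of_nat (s a)) = C + of_nat m * N - of_nat p * N"
    and "off_diag {0..<m} (\<lambda>a b. of_nat (s a) * of_nat (s b)) =
      C\<^sup>2 - (\<Sum>k=0..<m. (of_nat k)\<^sup>2) + 2 * C * (of_nat m * N) - of_nat m * (of_nat m - 1) * N
      + of_nat m * (of_nat m - 1) * N\<^sup>2
      - (2 * C + 2 * N * (of_nat m - 1)) * (of_nat p * N) + N * (N + 1) * (of_nat p * (of_nat p - 1))"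
      (is "_ = ?K2")
proof -
  define I where "I = PiE {0..<m} (\<lambda>_. {..<m + CARD('n)})"
  \<comment> \<open>Larger than every exponent, so that the powers separate monomials, and at least
    two, so that the points are distinct.\<close>
  define B where "B = m + CARD('n) + 1"
  define om where "om t = det_mean p (\<lambda>g. coeff_det m (charpoly g) t)" for t
  define S where "S = {0..<m}"
  have fin: "finite S" by (simp add: S_def)
  have finI: "finite I" unfolding I_def by (intro finite_PiE) auto
  define K0 where "K0 = C\<^sup>2 - (\<Sum>k=0..<m. (of_nat k)\<^sup>2) + 2 * C * (of_nat m * N) - of_nat m * (of_nat m - 1) * N
      + of_nat m * (of_nat m - 1) * N\<^sup>2"
  define K1 where "K1 = 2 * C + 2 * N * (of_nat m - 1)"
  have K2: "?K2 = K0 - K1 * (of_nat p * N) + N * (N + 1) * (of_nat p * (of_nat p - 1))"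
    by (simp add: K0_def K1_def)
  have main: "(\<Sum>t\<in>I. om t * (\<Prod>a=0..<m. x a ^ t a) * (\<Sum>a\<in>S. of_nat (t a)))
        = (C + of_nat m * N - of_nat p * N) * (\<Sum>t\<in>I. om t * (\<Prod>a=0..<m. x a ^ t a))" (is ?A)
    "(\<Sum>t\<in>I. om t * (\<Prod>a=0..<m. x a ^ t a) * off_diag S (\<lambda>a b. of_nat (t a) * of_nat (t b)))
        = ?K2 * (\<Sum>t\<in>I. om t * (\<Prod>a=0..<m. x a ^ t a))" (is ?B)
    if large: "\<And>a. a < m \<Longrightarrow> norm (x a) > CARD('n)" and dist: "inj_on x {0..<m}" for x :: "nat \<Rightarrow> complex"
  proof -
    interpret haar_points M p m x
      by unfold_locales (use large in auto)
    define T where "T g a = Determinants.trace (res g a)" for g a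
    define W where "W g a b = Determinants.trace (res g a ** res g b)" for g a b
    define V where "V = power_alternant m (\<lambda>k. k) x"
    have prod_S: "(\<Prod>a=0..<m. poly (charpoly g) (x a)) = char_prod g" for g
      by (simp add: char_prod_def lessThan_atLeast0)
    have exch: "(\<Sum>t\<in>I. om t * (\<Prod>a=0..<m. x a ^ t a) * f t)
        = det_mean p (\<lambda>g. \<Sum>t\<in>I. (\<Prod>a=0..<m. x a ^ t a) * coeff_det m (charpoly g) t * f t)" for f
    proof -
      have "det_mean p (\<lambda>g. \<Sum>t\<in>I. (\<Prod>a=0..<m. x a ^ t a) * coeff_det m (charpoly g) t * f t)
          = (\<Sum>t\<in>I. det_mean p (\<lambda>g. ((\<Prod>a=0..<m. x a ^ t a) * f t) * coeff_det m (charpoly g) t))"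
        by (subst det_mean_sum[symmetric]) (auto intro!: continuous_intros simp: mult_ac)
      then show ?thesis unfolding det_mean_cmult by (simp add: om_def mult_ac)
    qed
    have u: "x a * poly (pderiv (charpoly g)) (x a) = poly (charpoly g) (x a) * (N + T g a)"
      if "g \<in> unitary_group" "a < m" for g a
      unfolding N_def T_def by (rule pderiv_charpoly) (intro det_unitary_shift_nz that x_large)
    have mom: "(\<Sum>t\<in>I. (\<Prod>a=0..<m. x a ^ t a) * coeff_det m (charpoly g) t * (\<Prod>a\<in>D. of_nat (t a)))
        = char_prod g * vandermonde_sum m x (\<lambda>q. \<Prod>a\<in>D. of_nat (q a) + (N + T g a))"
      if "g \<in> unitary_group" "D \<subseteq> S" for g D
      using coeff_det_moment[of D m x "charpoly g" "\<lambda>a. N + T g a"] u that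
      unfolding prod_S charpoly_degree_coeff I_def[symmetric] S_def by simp
    have tot: "(\<Sum>t\<in>I. om t * (\<Prod>a=0..<m. x a ^ t a)) = V * det_mean p char_prod"
    proof -
      have "(\<Sum>t\<in>I. om t * (\<Prod>a=0..<m. x a ^ t a) * 1) = det_mean p (\<lambda>g. V * char_prod g)"
        unfolding exch V_def vandermonde_sum_one[symmetric]
        by (rule det_mean_cong) (use mom[of _ "{}"] in simp)
      then show ?thesis by (simp add: det_mean_cmult)
    qed
    have contT: "continuous_on unitary_group (\<lambda>g. char_prod g * (\<Sum>a<m. T g a))"
      unfolding T_def by (auto intro!: continuous_intros)
    have contW: "continuous_on unitary_group (\<lambda>g. char_prod g * (\<Sum>a<m. \<Sum>b\<in>{..<m} - {a}. T g a * T g b + W g a b))"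
      unfolding T_def W_def by (auto intro!: continuous_intros)
    note mom1 = trace_moment1[folded T_def N_def]
    note mom2 = trace_moment2[folded T_def W_def N_def]
    show ?A
    proof -
      have "(\<Sum>t\<in>I. om t * (\<Prod>a=0..<m. x a ^ t a) * (\<Sum>a\<in>S. of_nat (t a)))
          = det_mean p (\<lambda>g. (V * (C + of_nat m * N)) * char_prod g + V * (char_prod g * (\<Sum>a<m. T g a)))"
        unfolding exch
      proof (rule det_mean_cong)
        fix g :: "complex^'n^'n" assume g: "g \<in> unitary_group"
        have "(\<Sum>t\<in>I. (\<Prod>a=0..<m. x a ^ t a) * coeff_det m (charpoly g) t * (\<Sum>a\<in>S. of_nat (t a)))
            = (\<Sum>a\<in>S. \<Sum>t\<in>I. (\<Prod>a=0..<m. x a ^ t a) * coeff_det m (charpoly g) t * (\<Prod>a\<in>{a}. of_nat (t a)))"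
          by (subst sum.swap) (simp add: sum_distrib_left)
        also have "\<dots> = char_prod g * vandermonde_sum m x (\<lambda>q. \<Sum>a\<in>S. of_nat (q a) + (N + T g a))"
          unfolding vandermonde_sum_sum sum_distrib_left using g by (intro sum.cong refl) (subst mom, auto)
        also have "vandermonde_sum m x (\<lambda>q. \<Sum>a\<in>S. of_nat (q a) + (N + T g a)) = V * (C + of_nat m * N + (\<Sum>a<m. T g a))"
          unfolding V_def
        proof (rule vandermonde_sum_const)
          fix q assume q: "q permutes {0..<m}"
          have "(\<Sum>a\<in>S. complex_of_nat (q a)) = C"
            unfolding S_def C_def using sum.permute[OF q, of complex_of_nat] by (simp add: o_def)
          then show "(\<Sum>a\<in>S. of_nat (q a) + (N + T g a)) = C + of_nat m * N + (\<Sum>a<m. T g a)"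
            by (simp add: sum.distrib) (simp add: S_def lessThan_atLeast0)
        qed
        finally show "(\<Sum>t\<in>I. (\<Prod>a=0..<m. x a ^ t a) * coeff_det m (charpoly g) t * (\<Sum>a\<in>S. of_nat (t a)))
            = (V * (C + of_nat m * N)) * char_prod g + V * (char_prod g * (\<Sum>a<m. T g a))"
          by (simp add: algebra_simps)
      qed
      also have "\<dots> = V * (C + of_nat m * N) * det_mean p char_prod + V * (- (of_nat p * N) * det_mean p char_prod)"
        by (subst det_mean_add, (intro continuous_intros contT)+, subst (1 2) det_mean_cmult, subst mom1) (rule refl)
      finally show ?thesis unfolding tot by (simp add: algebra_simps)
    qed
    show ?B
    proof -
      have "(\<Sum>t\<in>I. om t * (\<Prod>a=0..<m. x a ^ t a) * off_diag S (\<lambda>a b. of_nat (t a) * of_nat (t b)))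
          = det_mean p (\<lambda>g. (V * K0) * char_prod g + ((V * K1) * (char_prod g * (\<Sum>a<m. T g a))
              + V * (char_prod g * (\<Sum>a<m. \<Sum>b\<in>{..<m} - {a}. T g a * T g b + W g a b))))"
        unfolding exch
      proof (rule det_mean_cong)
        fix g :: "complex^'n^'n" assume g: "g \<in> unitary_group"
        have "(\<Sum>t\<in>I. (\<Prod>a=0..<m. x a ^ t a) * coeff_det m (charpoly g) t * off_diag S (\<lambda>a b. of_nat (t a) * of_nat (t b)))
            = (\<Sum>a\<in>S. \<Sum>b\<in>S - {a}. \<Sum>t\<in>I. (\<Prod>a=0..<m. x a ^ t a) * coeff_det m (charpoly g) t * (of_nat (t a) * of_nat (t b)))"
          unfolding off_diag_def sum_distrib_left by (subst sum.swap, intro sum.cong refl, rule sum.swap)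
        also have "\<dots> = (\<Sum>a\<in>S. \<Sum>b\<in>S - {a}. \<Sum>t\<in>I. (\<Prod>a=0..<m. x a ^ t a) * coeff_det m (charpoly g) t * (\<Prod>a\<in>{a, b}. of_nat (t a)))"
          by (intro sum.cong refl) auto
        also have "\<dots> = (\<Sum>a\<in>S. \<Sum>b\<in>S - {a}. char_prod g *
            vandermonde_sum m x (\<lambda>q. (of_nat (q a) + (N + T g a)) * (of_nat (q b) + (N + T g b))))"
          using g by (intro sum.cong refl) (subst mom, auto)
        also have "\<dots> = char_prod g * vandermonde_sum m x
            (\<lambda>q. off_diag S (\<lambda>a b. (of_nat (q a) + (N + T g a)) * (of_nat (q b) + (N + T g b))))"
          by (simp add: off_diag_def vandermonde_sum_sum sum_distrib_left)
        also have "\<dots> = char_prod g * (V * (K0 + K1 * (\<Sum>a\<in>S. T g a) + off_diag S (\<lambda>a b. T g a * T g b + W g a b)))"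
        proof -
          have "(x a - x b) * W g a b = x b * T g b - x a * T g a" if ab: "a < m" "b < m" "a \<noteq> b" for a b
            unfolding W_def T_def by (rule resolvent_identity) (intro det_unitary_shift_nz g x_large ab)+
          then show ?thesis
            using vandermonde_pair_sum[OF dist, of "W g" "T g" N] unfolding V_def S_def C_def K0_def K1_def by simp
        qed
        finally show "(\<Sum>t\<in>I. (\<Prod>a=0..<m. x a ^ t a) * coeff_det m (charpoly g) t * off_diag S (\<lambda>a b. of_nat (t a) * of_nat (t b)))
            = (V * K0) * char_prod g + ((V * K1) * (char_prod g * (\<Sum>a<m. T g a))
              + V * (char_prod g * (\<Sum>a<m. \<Sum>b\<in>{..<m} - {a}. T g a * T g b + W g a b)))"
          unfolding off_diag_def S_def atLeast0LessThan
          by (simp add: algebra_simps)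
      qed
      also have "\<dots> = V * K0 * det_mean p char_prod + (V * K1 * (- (of_nat p * N) * det_mean p char_prod)
          + V * (N * (N + 1) * (of_nat p * (of_nat p - 1)) * det_mean p char_prod))"
        by (subst det_mean_add, (intro continuous_intros contT contW)+, subst det_mean_add,
            (intro continuous_intros contT contW)+, subst (1 2 3) det_mean_cmult, subst mom1, subst mom2) (rule refl)
      also have "\<dots> = ?K2 * (V * det_mean p char_prod)"
        unfolding K2 by (simp add: algebra_simps)
      finally show ?thesis unfolding tot .
    qed
  qed
  \<comment> \<open>Both identities have the form of this hypothesis: moving the right-hand side
    over gives a polynomial with coefficients \<open>om t * (f t - c)\<close> that vanishes at all
    admissible points.\<close>
  have zero: "om s * (f s - c) = 0"
    if "\<And>x :: nat \<Rightarrow> complex. (\<And>a. a < m \<Longrightarrow> norm (x a) > CARD('n)) \<Longrightarrow> inj_on x {0..<m} \<Longrightarrow>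
      (\<Sum>t\<in>I. om t * (\<Prod>a=0..<m. x a ^ t a) * f t) = c * (\<Sum>t\<in>I. om t * (\<Prod>a=0..<m. x a ^ t a))"
    for f and c
  proof (rule monomial_coeffs_zero[where c = "\<lambda>t. om t * (f t - c)" and s = s and K = "CARD('n)" and B = B and n = "m + CARD('n)" and m = m])
    fix y :: real assume y: "y > CARD('n)"
    have c1: "1 \<le> CARD('n)" using zero_less_card_finite[where 'a = 'n] by linarith
    with y have y1: "y > 1" by linarith
    define x where "x a = complex_of_real y ^ (B ^ a)" for a
    have B2: "B \<ge> 2" unfolding B_def using c1 by linarith
    have "norm (x a) > CARD('n)" for a
    proof -
      have "y ^ 1 \<le> y ^ (B ^ a)" using y1 B2 by (intro power_increasing) auto
      then show ?thesis using y y1 by (simp add: x_def norm_power)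
    qed
    moreover have "inj_on x {0..<m}"
    proof (rule inj_onI)
      fix a b assume "x a = x b"
      then have "y ^ (B ^ a) = y ^ (B ^ b)"
        unfolding x_def by (metis of_real_eq_iff of_real_power)
      then show "a = b" using y1 B2 by (simp add: power_inject_exp)
    qed
    ultimately have "(\<Sum>t\<in>I. om t * (\<Prod>a=0..<m. x a ^ t a) * f t) = c * (\<Sum>t\<in>I. om t * (\<Prod>a=0..<m. x a ^ t a))"
      by (intro that)
    then have "(\<Sum>t\<in>I. om t * (f t - c) * (\<Prod>a=0..<m. x a ^ t a)) = 0"
      by (simp add: algebra_simps sum_subtractf sum_distrib_left)
    then show "(\<Sum>t\<in>PiE {0..<m} (\<lambda>_. {..<m + CARD('n)}). om t * (f t - c) * (\<Prod>a=0..<m. (complex_of_real y ^ (B ^ a)) ^ t a)) = 0"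
      by (simp add: x_def I_def)
  qed (use s in \<open>auto simp: B_def\<close>)
  show "(\<Sum>a=0..<m. complex_of_nat (s a)) = C + of_nat m * N - of_nat p * N"
    using zero[OF main(1)] nz by (simp add: om_def S_def)
  show "off_diag {0..<m} (\<lambda>a b. of_nat (s a) * of_nat (s b)) = ?K2"
    using zero[OF main(2)] nz by (simp add: om_def S_def)
qed

end

section \<open>Quotients of alternants and their integrals\<close>

definition int_alternant :: "nat \<Rightarrow> (nat \<Rightarrow> int) \<Rightarrow> (nat \<Rightarrow> complex) \<Rightarrow> complex" where
  "int_alternant n e t = Determinant.det (Matrix.mat n n (\<lambda>(j, k). t j powi e k))"

lemma alternant_eq_int_alternant: "alternant n l = int_alternant n (\<lambda>k. int n - 1 - int k + l k)"
  by (simp add: alternant_def int_alternant_def fun_eq_iff)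

lemma power_alternant_cong:
  assumes "\<And>k. k < n \<Longrightarrow> l k = l' k" "\<And>j. j < n \<Longrightarrow> t j = t' j"
  shows "power_alternant n l t = power_alternant n l' t'"
  unfolding power_alternant_def using assms by (intro arg_cong[of _ _ Determinant.det] eq_matI) auto

lemma int_alternant_cong:
  assumes "\<And>k. k < n \<Longrightarrow> e k = e' k" "\<And>j. j < n \<Longrightarrow> t j = t' j"
  shows "int_alternant n e t = int_alternant n e' t'"
  unfolding int_alternant_def using assms by (intro arg_cong[of _ _ Determinant.det] eq_matI) auto

lemma int_alternant_shift:
  assumes t: "\<And>j. j < n \<Longrightarrow> t j \<noteq> 0" and e: "\<And>k. k < n \<Longrightarrow> e k + int P \<ge> 0"
  shows "int_alternant n e t = inverse (\<Prod>j<n. t j) ^ P * power_alternant n (\<lambda>k. nat (e k + int P)) t"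
proof -
  have "power_alternant n (\<lambda>k. nat (e k + int P)) t = (\<Prod>j=0..<n. t j ^ P) * int_alternant n e t"
  proof -
    have entry: "t j ^ nat (e k + int P) = t j ^ P * t j powi e k" if "j < n" "k < n" for j k
    proof -
      have "t j ^ nat (e k + int P) = t j powi (e k + int P)"
        using e[OF that(2)] by (simp add: power_int_def)
      also have "\<dots> = t j powi e k * t j ^ P"
        using t[OF that(1)] by (simp add: power_int_add)
      finally show ?thesis by simp
    qed
    have "power_alternant n (\<lambda>k. nat (e k + int P)) t
        = Determinant.det (mat\<^sub>r n n (\<lambda>j. t j ^ P \<cdot>\<^sub>v Matrix.vec n (\<lambda>k. t j powi e k)))"
      unfolding power_alternant_def
      by (intro arg_cong[of _ _ Determinant.det] eq_matI) (auto simp: entry)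
    also have "\<dots> = (\<Prod>j=0..<n. t j ^ P) * Determinant.det (mat\<^sub>r n n (\<lambda>j. Matrix.vec n (\<lambda>k. t j powi e k)))"
      by (rule Determinant.det_rows_mul) auto
    also have "mat\<^sub>r n n (\<lambda>j. Matrix.vec n (\<lambda>k. t j powi e k)) = Matrix.mat n n (\<lambda>(j, k). t j powi e k)"
      by (intro eq_matI) auto
    finally show ?thesis by (simp add: int_alternant_def)
  qed
  moreover have "(\<Prod>j=0..<n. t j ^ P) = (\<Prod>j<n. t j) ^ P"
    by (simp add: prod_power_distrib lessThan_atLeast0)
  moreover have "(\<Prod>j<n. t j) \<noteq> 0" using t by simp
  ultimately show ?thesis by (simp add: power_inverse field_simps)
qed

lemma int_alternant_permute:
  assumes p: "p permutes {0..<n}"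
  shows "int_alternant n (\<lambda>k. e (p k)) t = signof p * int_alternant n e t"
proof -
  have "int_alternant n (\<lambda>k. e (p k)) t = Determinant.det (Matrix.mat n n (\<lambda>(i, j). Matrix.mat n n (\<lambda>(j, k). t j powi e k) $$ (i, p j)))"
    unfolding int_alternant_def using permutes_in_image[OF p]
    by (intro arg_cong[of _ _ Determinant.det] eq_matI) auto
  also have "\<dots> = signof p * int_alternant n e t"
    unfolding int_alternant_def by (rule det_permute_cols[OF _ p]) auto
  finally show ?thesis .
qed

lemma power_alternant_eq_int: "power_alternant n l t = int_alternant n (\<lambda>k. int (l k)) t"
  by (simp add: power_alternant_def int_alternant_def)

lemma int_alternant_repeated:
  assumes "k < n" "k' < n" "k \<noteq> k'" "e k = e k'"
  shows "int_alternant n e t = 0"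
  unfolding int_alternant_def
  by (rule det_identical_columns[of _ n k k']) (use assms in \<open>auto intro!: eq_vecI\<close>)

text \<open>A unipotent column operation replaces the last column by the values of the monic
  polynomial with roots \<open>t 0\<close>, ..., \<open>t (n - 1)\<close>, which vanish except in
  the last row.\<close>

lemma power_alternant_Suc:
  "power_alternant (Suc n) (\<lambda>k. k) t = power_alternant n (\<lambda>k. k) t * (\<Prod>i<n. t n - t i)"
proof -
  define q where "q = root_poly n t"
  define A where "A = Matrix.mat (n + 1) (n + 1) (\<lambda>(j, k). t j ^ k)"
  define U where "U = Matrix.mat (n + 1) (n + 1) (\<lambda>(i, c). if c < n then if i = c then 1 else 0 else coeff q i)"
  have A: "A \<in> carrier_mat (n + 1) (n + 1)" and U: "U \<in> carrier_mat (n + 1) (n + 1)"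
    by (auto simp: A_def U_def)
  have "upper_triangular U" by (auto simp: U_def upper_triangular_def)
  moreover have "diag_mat U = map (\<lambda>_. 1) [0..<n + 1]"
    unfolding diag_mat_def using U by (intro map_cong) (auto simp: U_def q_def lead_coeff_root_poly less_Suc_eq)
  ultimately have "Determinant.det U = 1"
    by (simp only: det_upper_triangular[OF _ U] map_replicate_const prod_list_replicate power_one)
  then have "power_alternant (Suc n) (\<lambda>k. k) t = Determinant.det (A * U)"
    unfolding Determinant.det_mult[OF A U] by (simp add: A_def power_alternant_def)
  also have "A * U = four_block_mat (Matrix.mat n n (\<lambda>(j, k). t j ^ k)) (0\<^sub>m n 1)
      (Matrix.mat 1 n (\<lambda>(_, k). t n ^ k)) (Matrix.mat 1 1 (\<lambda>_. poly q (t n)))" (is "_ = ?R")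
  proof (rule eq_matI)
    fix i c assume "i < dim_row ?R" "c < dim_col ?R"
    then have i: "i < n + 1" and c: "c < n + 1" by auto
    have "(A * U) $$ (i, c) = (\<Sum>k<n + 1. t i ^ k * (if c < n then if k = c then 1 else 0 else coeff q k))"
      using i c A U by (auto simp: scalar_prod_def A_def U_def lessThan_atLeast0 intro!: sum.cong)
    also have "\<dots> = (if c < n then t i ^ c else poly q (t i))"
    proof (cases "c < n")
      case False
      then show ?thesis
        by (simp add: poly_altdef q_def degree_root_poly lessThan_Suc_atMost mult.commute)
    qed (simp add: if_distrib[of "\<lambda>x. _ * x"] cong: if_cong)
    finally show "(A * U) $$ (i, c) = ?R $$ (i, c)"
      using i c by (auto simp: less_Suc_eq q_def poly_root_poly)
  qed (use A U in auto)
  also have "Determinant.det \<dots> = power_alternant n (\<lambda>k. k) t * poly q (t n)"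
    unfolding power_alternant_def
    by (subst det_four_block_mat_upper_right_zero[where n = n and m = 1]) (auto simp: det_single)
  finally show ?thesis by (simp add: q_def poly_root_poly)
qed

lemma vandermonde: "power_alternant n (\<lambda>k. k) t = (\<Prod>j<n. \<Prod>i<j. t j - t i)"
proof (induction n)
  case 0
  then show ?case by (simp add: power_alternant_def)
qed (simp add: power_alternant_Suc)

lemma vandermonde_nz_iff: "power_alternant n (\<lambda>k. k) t \<noteq> 0 \<longleftrightarrow> inj_on t {0..<n}"
proof -
  have "power_alternant n (\<lambda>k. k) t \<noteq> 0 \<longleftrightarrow> (\<forall>j<n. \<forall>i<j. t j \<noteq> t i)"
    unfolding vandermonde by (auto simp: prod_zero_iff)
  also have "\<dots> \<longleftrightarrow> inj_on t {0..<n}"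
  proof
    assume *: "\<forall>j<n. \<forall>i<j. t j \<noteq> t i"
    show "inj_on t {0..<n}"
    proof (rule inj_onI)
      fix x y assume "x \<in> {0..<n}" "y \<in> {0..<n}" "t x = t y"
      then show "x = y" using * linorder_neqE_nat[of x y] by (metis atLeastLessThan_iff)
    qed
  next
    assume "inj_on t {0..<n}"
    then show "\<forall>j<n. \<forall>i<j. t j \<noteq> t i"
      by (auto dest!: inj_onD)
  qed
  finally show ?thesis .
qed

text \<open>The exponents of \<open>alternant\<close> decrease and those of
  \<open>power_alternant\<close> increase; the constant is the sign of the reversal.\<close>

lemma alternant_zero_eq:
  obtains c where "c \<noteq> 0" "\<And>t. alternant n (\<lambda>_. 0) t = c * power_alternant n (\<lambda>k. k) t"
proof -
  define p where "p k = (if k < n then n - 1 - k else k)" for k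
  have "bij_betw p {0..<n} {0..<n}"
    by (rule bij_betw_byWitness[where f' = p]) (auto simp: p_def)
  then have p: "p permutes {0..<n}"
    by (rule bij_imp_permutes) (auto simp: p_def)
  have pk: "int n - 1 - int k = int (p k)" if "k < n" for k
    using that by (simp add: p_def of_nat_diff)
  have "alternant n (\<lambda>_. 0) t = int_alternant n (\<lambda>k. int (p k)) t" for t
    unfolding alternant_eq_int_alternant int_alternant_def
    by (intro arg_cong[of _ _ Determinant.det] eq_matI) (auto simp: pk)
  then have "alternant n (\<lambda>_. 0) t = signof p * power_alternant n (\<lambda>k. k) t" for t
    using int_alternant_permute[OF p, of int] by (simp add: power_alternant_eq_int)
  then show ?thesis by (intro that[of "signof p"]) (auto simp: sign_def)
qed

lemma alternant_zero_nz_iff: "alternant n (\<lambda>_. 0) t \<noteq> 0 \<longleftrightarrow> inj_on t {0..<n}"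
  using alternant_zero_eq vandermonde_nz_iff by (metis mult_eq_0_iff)

section \<open>Limits of quotients of alternants\<close>

text \<open>A relation rather than a value, so that the existence of the limit is part of every
  statement and the usual limit rules apply. Functions carry the product topology.\<close>

definition quotient_limit :: "nat \<Rightarrow> (nat \<Rightarrow> int) \<Rightarrow> (nat \<Rightarrow> complex) \<Rightarrow> complex \<Rightarrow> bool" where
  "quotient_limit n e t v \<longleftrightarrow>
     ((\<lambda>y. int_alternant n e y / alternant n (\<lambda>_. 0) y) \<longlongrightarrow> v) (at t within {y. alternant n (\<lambda>_. 0) y \<noteq> 0})"

lemma tendsto_coord: "((\<lambda>y :: nat \<Rightarrow> complex. y j) \<longlongrightarrow> t j) (at t within S)"
proof -
  have "\<forall>t\<in>UNIV. ((\<lambda>y :: nat \<Rightarrow> complex. y j) \<longlongrightarrow> t j) (at t within UNIV)"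
    unfolding continuous_on_def[symmetric] by simp
  then show ?thesis by (meson UNIV_I subset_UNIV tendsto_within_subset)
qed

text \<open>On the line with direction \<open>j\<close> in coordinate \<open>j\<close>, two given
  coordinates coincide for at most one parameter, so the first \<open>n\<close> are distinct close
  to \<open>t\<close>. Nontriviality of this filter makes the limits above unique.\<close>

lemma distinct_points_dense: "at t within {y. alternant n (\<lambda>_. 0) y \<noteq> 0} \<noteq> bot"
proof -
  define S where "S = {y. alternant n (\<lambda>_. 0) y \<noteq> 0}"
  define z where "z e = (\<lambda>j. t j + of_real e * of_nat j :: complex)" for e :: real
  have lim: "(z \<longlongrightarrow> t) (at_right 0)"
  proof -
    have "continuous_on UNIV z"
      by (rule continuous_on_coordinatewise_then_product) (auto simp: z_def intro!: continuous_intros)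
    then have "\<forall>e\<in>UNIV. (z \<longlongrightarrow> z e) (at e within UNIV)"
      unfolding continuous_on_def .
    then have "(z \<longlongrightarrow> z 0) (at 0 within {0<..})"
      by (meson UNIV_I subset_UNIV tendsto_within_subset)
    then show ?thesis by (simp add: z_def)
  qed
  have fin: "finite (\<Union>i<n. \<Union>j<n. {e :: real. i \<noteq> j \<and> z e i = z e j})"
  proof (intro finite_UN_I finite_lessThan)
    fix i j
    show "finite {e :: real. i \<noteq> j \<and> z e i = z e j}"
    proof (cases "i = j")
      case False
      have "e = e'" if "z e i = z e j" "z e' i = z e' j" for e e'
      proof -
        have "of_real e * (of_nat i - of_nat j) = t j - t i" "of_real e' * (of_nat i - of_nat j) = t j - t i"
          using that by (auto simp: z_def algebra_simps)
        then have "of_real e * (of_nat i - of_nat j) = of_real e' * (of_nat i - of_nat j :: complex)" by simp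
        then show ?thesis using False by simp
      qed
      then have "{e :: real. i \<noteq> j \<and> z e i = z e j} \<subseteq> {SOME e. z e i = z e j}"
        by (auto intro: someI2)
      then show ?thesis by (rule finite_subset) simp
    qed simp
  qed
  have ev: "eventually (\<lambda>e. z e \<in> S - {t}) (at_right 0)"
  proof -
    have "eventually (\<lambda>e. e \<notin> (\<Union>i<n. \<Union>j<n. {e :: real. i \<noteq> j \<and> z e i = z e j})) (at_right 0)"
      using eventually_ball_finite[OF fin, of "\<lambda>e y. e \<noteq> y" "at_right 0"]
      by (auto simp: eventually_neq_at_within elim!: eventually_mono)
    moreover have "eventually (\<lambda>e::real. e > 0) (at_right 0)"
      by (simp add: eventually_at_right_less)
    ultimately show ?thesis
    proof eventually_elim
      case (elim e)
      \<comment> \<open>The punctured filter also demands a point different from \<open>t\<close>.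
        Coordinate 1 always moves, even when it is not among the first \<open>n\<close>; coordinate
        0 does not.\<close>
      have "z e 1 \<noteq> t 1" using elim(2) by (simp add: z_def)
      moreover have "inj_on (z e) {0..<n}"
      proof (rule inj_onI)
        fix i j assume "i \<in> {0..<n}" "j \<in> {0..<n}" "z e i = z e j"
        then show "i = j" using elim(1) by auto
      qed
      ultimately show ?case by (auto simp: S_def alternant_zero_nz_iff)
    qed
  qed
  have "filterlim z (at t within S) (at_right 0)"
    using lim ev by (auto simp: filterlim_at eventually_conj_iff elim: eventually_mono)
  then show ?thesis unfolding S_def[symmetric]
    by (metis filterlim_def bot.extremum_uniqueI filtermap_bot_iff trivial_limit_at_right_real)
qed

lemma quotient_limit_unique: "quotient_limit n e t v \<Longrightarrow> quotient_limit n e t v' \<Longrightarrow> v = v'"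
  unfolding quotient_limit_def by (rule tendsto_unique[OF distinct_points_dense])

lemma quotient_limit_repeated:
  assumes "k < n" "k' < n" "k \<noteq> k'" "e k = e k'"
  shows "quotient_limit n e t 0"
  unfolding quotient_limit_def int_alternant_repeated[of k n k' e, OF assms] by simp

lemma quotient_limit_permute:
  assumes p: "p permutes {0..<n}" and e: "\<And>k. k < n \<Longrightarrow> e k = int n - 1 - int (p k)"
  shows "quotient_limit n e t (signof p)"
proof -
  have "int_alternant n e y = signof p * alternant n (\<lambda>_. 0) y" for y
  proof -
    have "int_alternant n e y = int_alternant n (\<lambda>k. int n - 1 - int (p k)) y"
      unfolding int_alternant_def by (intro arg_cong[of _ _ Determinant.det] eq_matI) (auto simp: e)
    then show ?thesis
      using int_alternant_permute[OF p, of "\<lambda>k. int n - 1 - int k"] by (simp add: alternant_eq_int_alternant)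
  qed
  then have "eventually (\<lambda>y. int_alternant n e y / alternant n (\<lambda>_. 0) y = signof p)
      (at t within {y. alternant n (\<lambda>_. 0) y \<noteq> 0})"
    by (auto simp: eventually_at_filter)
  then show ?thesis unfolding quotient_limit_def by (rule tendsto_eventually)
qed

lemma tendsto_coeff_root_poly:
  "((\<lambda>y. coeff (root_poly n y) k) \<longlongrightarrow> coeff (root_poly n t) k) (at t within S)"
proof (induction n arbitrary: k)
  case (Suc n)
  have "coeff (root_poly (Suc n) y) k = - y n * coeff (root_poly n y) k + (if k = 0 then 0 else coeff (root_poly n y) (k - 1))" for y
  proof -
    have "root_poly (Suc n) y = [:- y n, 1:] * root_poly n y"
      by (simp add: root_poly_def)
    then show ?thesis by (cases k) (simp_all add: coeff_pCons)
  qed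
  then show ?case
    by (cases "k = 0") (auto intro!: tendsto_intros Suc tendsto_coord)
qed (simp add: root_poly_def)

lemma tendsto_coeff_det:
  "((\<lambda>y. coeff_det m (root_poly n y) s) \<longlongrightarrow> coeff_det m (root_poly n t) s) (at t within S)"
proof -
  have "((\<lambda>y. coeff (monom 1 k * root_poly n y) i) \<longlongrightarrow> coeff (monom 1 k * root_poly n t) i) (at t within S)" for k i
    by (cases "k \<le> i") (auto simp: coeff_monom_mult intro!: tendsto_coeff_root_poly)
  then show ?thesis unfolding coeff_det_leibniz by (auto intro!: tendsto_intros)
qed

lemma eventually_coord_nz:
  fixes t :: "nat \<Rightarrow> complex"
  assumes "\<And>j. j < n \<Longrightarrow> t j \<noteq> 0"
  shows "eventually (\<lambda>y. \<forall>j\<in>{..<n}. y j \<noteq> 0) (at t within S)"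
proof (rule eventually_ball_finite)
  show "\<forall>j\<in>{..<n}. eventually (\<lambda>y. y j \<noteq> 0) (at t within S)"
  proof
    fix j assume "j \<in> {..<n}"
    then have "t j \<noteq> 0" using assms by simp
    then show "eventually (\<lambda>y. y j \<noteq> 0) (at t within S)"
      by (rule tendsto_imp_eventually_ne[OF tendsto_coord])
  qed
qed simp

text \<open>After the shift by \<open>P\<close> the complement formula cancels the Vandermonde
  determinant. What remains is continuous wherever the first \<open>n\<close> coordinates are
  nonzero, also where they coincide, and is thus the limit. The constant is independent of
  \<open>t\<close>, so it can leave the integral.\<close>

lemma quotient_limit_coeff_det:
  assumes p: "p permutes {0..<n + m}" and e: "\<And>k. k < n \<Longrightarrow> e k + int P = int (p k)"
  obtains c where "c \<noteq> 0" "\<And>t. (\<And>j. j < n \<Longrightarrow> t j \<noteq> 0) \<Longrightarrow>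
    quotient_limit n e t (inverse (\<Prod>j<n. t j) ^ P * (c * coeff_det m (root_poly n t) (\<lambda>a. p (n + a))))"
proof -
  obtain c where c: "c \<noteq> 0" "\<And>t. alternant n (\<lambda>_. 0) t = c * power_alternant n (\<lambda>k. k) t"
    by (rule alternant_zero_eq[of n]) blast
  define F where "F t = inverse (\<Prod>j<n. t j) ^ P * (signof p / c * coeff_det m (root_poly n t) (\<lambda>a. p (n + a)))"
    for t :: "nat \<Rightarrow> complex"
  have quot: "int_alternant n e y / alternant n (\<lambda>_. 0) y = F y"
    if "\<forall>j\<in>{..<n}. y j \<noteq> 0" "alternant n (\<lambda>_. 0) y \<noteq> 0" for y
  proof -
    have "int_alternant n e y = inverse (\<Prod>j<n. y j) ^ P * power_alternant n (\<lambda>k. nat (e k + int P)) y"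
      using that e by (intro int_alternant_shift) auto
    also have "power_alternant n (\<lambda>k. nat (e k + int P)) y = power_alternant n p y"
      by (rule power_alternant_cong) (auto simp: e)
    finally have "int_alternant n e y = c * power_alternant n (\<lambda>k. k) y * F y"
      unfolding power_alternant_complement[OF p] F_def using c(1) by simp
    then show ?thesis using that(2) unfolding c(2) by simp
  qed
  have "quotient_limit n e t (F t)" if t: "\<And>j. j < n \<Longrightarrow> t j \<noteq> 0" for t
    unfolding quotient_limit_def
  proof (rule Lim_transform_eventually)
    show "(F \<longlongrightarrow> F t) (at t within {y. alternant n (\<lambda>_. 0) y \<noteq> 0})"
      unfolding F_def using t by (intro tendsto_intros tendsto_coeff_det tendsto_coord) auto
    have "eventually (\<lambda>y. y \<in> {y. alternant n (\<lambda>_. 0) y \<noteq> 0}) (at t within {y. alternant n (\<lambda>_. 0) y \<noteq> 0})"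
      by (simp add: eventually_at_filter)
    moreover have "eventually (\<lambda>y. \<forall>j\<in>{..<n}. y j \<noteq> 0) (at t within {y. alternant n (\<lambda>_. 0) y \<noteq> 0})"
      by (rule eventually_coord_nz) (rule t)
    ultimately show "eventually (\<lambda>y. F y = int_alternant n e y / alternant n (\<lambda>_. 0) y)
        (at t within {y. alternant n (\<lambda>_. 0) y \<noteq> 0})"
      by eventually_elim (simp add: quot)
  qed
  then show ?thesis
    using c(1) by (intro that[of "signof p / c"]) (auto simp: F_def sign_def)
qed

lemma quotient_limit_at_distinct:
  assumes t: "\<And>j. j < n \<Longrightarrow> t j \<noteq> 0" and d: "alternant n (\<lambda>_. 0) t \<noteq> 0"
  shows "quotient_limit n e t (int_alternant n e t / alternant n (\<lambda>_. 0) t)"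
proof -
  have "((\<lambda>y. int_alternant n e y) \<longlongrightarrow> int_alternant n e t) (at t within S)" for e S
  proof -
    have "int_alternant n e y = (\<Sum>p | p permutes {0..<n}. signof p * (\<Prod>j=0..<n. y j powi e (p j)))" for y
      unfolding int_alternant_def
      by (subst det_def'[of _ n]) (auto intro!: sum.cong prod.cong dest: permutes_in_image)
    then show ?thesis using t by (auto intro!: tendsto_intros tendsto_coord)
  qed
  then show ?thesis
    unfolding quotient_limit_def using d unfolding alternant_eq_int_alternant by (intro tendsto_intros)
qed

text \<open>Treats both branches of \<open>schur\<close> alike: at distinct variables the quotient
  is continuous and equals its own limit.\<close>

lemma schur_eq_quotient_limit:
  assumes t: "\<And>j. j < n \<Longrightarrow> t j \<noteq> 0" and v: "quotient_limit n (\<lambda>k. int n - 1 - int k + l k) t v"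
  shows "schur n l t = v"
proof (cases "alternant n (\<lambda>_. 0) t = 0")
  case True
  then show ?thesis
    using v unfolding schur_def Let_def quotient_limit_def alternant_eq_int_alternant[symmetric]
    by (auto intro!: tendsto_Lim distinct_points_dense)
next
  case False
  then show ?thesis
    using quotient_limit_unique[OF v quotient_limit_at_distinct[OF t False]]
    by (simp add: schur_def Let_def alternant_eq_int_alternant)
qed

lemma extend_to_permutation:
  fixes l :: "nat \<Rightarrow> nat"
  assumes l: "inj_on l {0..<n}" "\<And>k. k < n \<Longrightarrow> l k < n + m"
  obtains p where "p permutes {0..<n + m}" "\<And>k. k < n \<Longrightarrow> p k = l k"
proof -
  have "card (l ` {0..<n}) = n" using l(1) by (simp add: card_image)
  moreover have sub: "l ` {0..<n} \<subseteq> {0..<n + m}" using l(2) by auto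
  ultimately have "card {n..<n + m} = card ({0..<n + m} - l ` {0..<n})"
    by (simp add: card_Diff_subset)
  then obtain g where g: "bij_betw g {n..<n + m} ({0..<n + m} - l ` {0..<n})"
    using finite_same_card_bij[of "{n..<n + m}" "{0..<n + m} - l ` {0..<n}"] by auto
  define p where "p k = (if k < n then l k else if k < n + m then g k else k)" for k
  have "bij_betw p {0..<n} (l ` {0..<n})"
    using l(1) by (subst bij_betw_cong[of _ _ l]) (auto simp: p_def inj_on_imp_bij_betw)
  moreover have "bij_betw p {n..<n + m} ({0..<n + m} - l ` {0..<n})"
    using g by (subst bij_betw_cong[of _ _ g]) (auto simp: p_def)
  ultimately have "bij_betw p ({0..<n} \<union> {n..<n + m}) (l ` {0..<n} \<union> ({0..<n + m} - l ` {0..<n}))"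
    by (rule bij_betw_combine) auto
  also have "{0..<n} \<union> {n..<n + m} = {0..<n + m}" by auto
  also have "l ` {0..<n} \<union> ({0..<n + m} - l ` {0..<n}) = {0..<n + m}" using sub by auto
  finally have "p permutes {0..<n + m}"
    by (rule bij_imp_permutes) (auto simp: p_def)
  then show ?thesis by (rule that) (simp add: p_def)
qed

section \<open>Eigenvalues as variables\<close>

lemma enum_mset_nth: obtains xs where "mset xs = E" "enum_mset E = nth xs"
  unfolding enum_mset_def using someI_ex[OF ex_mset[of E]] that by blast

lemma root_poly_nth: "root_poly (length xs) (nth xs) = (\<Prod>x\<leftarrow>xs. [:- x, 1:])"
  unfolding root_poly_def by (simp add: prod.list_conv_set_nth lessThan_atLeast0)

text \<open>The enumeration is an arbitrary choice at each \<open>g\<close>. Only symmetric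
  expressions in it become integrands, by way of \<open>root_poly_eig\<close> and
  \<open>prod_eig\<close>.\<close>

abbreviation eig :: "complex^'n^'n \<Rightarrow> nat \<Rightarrow> complex" where
  "eig g \<equiv> enum_mset (eigenvalues_mset g)"

lemma size_eigenvalues: "size (eigenvalues_mset g) = CARD('n)" for g :: "complex^'n^'n"
  by (simp add: eigenvalues_mset_def size_proots_complex charpoly_degree_coeff)

lemma root_poly_eig: "root_poly CARD('n) (eig g) = charpoly g" for g :: "complex^'n^'n"
proof -
  obtain xs where xs: "mset xs = eigenvalues_mset g" "eig g = nth xs"
    by (rule enum_mset_nth)
  have "length xs = CARD('n)"
    using xs(1) size_eigenvalues[of g] by (metis size_mset)
  then have "root_poly CARD('n) (eig g) = (\<Prod>x\<in>#eigenvalues_mset g. [:- x, 1:])"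
    using root_poly_nth[of xs] unfolding xs(2) unfolding xs(1)[symmetric] by (simp flip: prod_mset_prod_list)
  also have "\<dots> = charpoly g"
    using complex_poly_decompose_multiset[of "charpoly g"]
    by (simp add: eigenvalues_mset_def charpoly_degree_coeff)
  finally show ?thesis .
qed

lemma det_cmat: "cdet (cmat c :: complex^'n^'n) = c ^ CARD('n)"
  by (subst det_diagonal) (auto simp: Finite_Cartesian_Product.mat_def)

lemma prod_eig: "(\<Prod>j<CARD('n). x - eig g j) = cdet (cmat x - g)" "(\<Prod>j<CARD('n). eig g j) = cdet g"
  for g :: "complex^'n^'n"
proof -
  show *: "(\<Prod>j<CARD('n). x - eig g j) = cdet (cmat x - g)" for x
    unfolding poly_root_poly[symmetric] root_poly_eig poly_charpoly ..
  have "(- 1) ^ CARD('n) * (\<Prod>j<CARD('n). eig g j) = (\<Prod>j<CARD('n). 0 - eig g j)"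
    using prod.distrib[of "\<lambda>_. - 1" "eig g" "{..<CARD('n)}"] by simp
  also have "\<dots> = cdet (cmat (- 1) ** g)"
    unfolding * unfolding cmat_mult
    by (intro arg_cong[of _ _ cdet]) (auto simp: Finite_Cartesian_Product.vec_eq_iff Finite_Cartesian_Product.mat_def)
  finally show "(\<Prod>j<CARD('n). eig g j) = cdet g"
    by (simp add: det_mul det_cmat)
qed

lemma eig_nz: "g \<in> unitary_group \<Longrightarrow> j < CARD('n) \<Longrightarrow> eig g j \<noteq> 0" for g :: "complex^'n^'n"
  using prod_eig(2)[of g] det_unitary_nz[of g] by (metis finite_lessThan lessThan_iff prod_zero_iff)

section \<open>Exponents with nonvanishing integral\<close>

text \<open>An elimination. \<open>B\<close>, \<open>B2\<close> and \<open>C\<close>,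
  \<open>C2\<close> are the sums of k and k^2 below n and m; \<open>L\<close>, \<open>L2\<close>
  belong to the exponents \<open>p k\<close>, \<open>S\<close>, \<open>S2\<close> to the
  complementary ones, and \<open>E\<close>, \<open>E2\<close> to \<open>e k = p k - P\<close>. The
  equations for \<open>L + S\<close> and \<open>L2 + S2\<close> say that exponents and complement
  together fill \<open>{0..<n + m}\<close>.\<close>

lemma complement_moments:
  fixes C C2 B B2 S S2 L L2 N m P E E2 :: complex
  assumes B: "2 * B = N * (N - 1)" and S: "S = C + m * N - P * N"
    and S2: "S * S - S2 = C\<^sup>2 - C2 + 2 * C * (m * N) - m * (m - 1) * N + m * (m - 1) * N\<^sup>2
        - (2 * C + 2 * N * (m - 1)) * (P * N) + N * (N + 1) * (P * (P - 1))"
    and L: "L + S = C + (N * m + B)" and L2: "L2 + S2 = C2 + (N * m\<^sup>2 + 2 * m * B + B2)"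
    and E: "E = L - N * P" and E2: "E2 = L2 - 2 * P * L + N * P\<^sup>2"
  shows "E = B" "E2 = B2"
proof -
  have L': "L = B + N * P" using L S by (simp add: algebra_simps)
  show "E = B" by (simp add: E L')
  have mB: "2 * m * B = m * (N * (N - 1))" and PB: "2 * P * (B + N * P) = P * (N * (N - 1)) + 2 * (N * P * P)"
    using B by (simp_all only: distrib_left mult.assoc mult.left_commute[of 2]) (simp_all add: mult_ac)
  have L2': "L2 = C2 + (N * m\<^sup>2 + 2 * m * B + B2) - S2" using L2 by (simp only: eq_diff_eq)
  have S2': "S2 = S * S - (S * S - S2)" by simp
  show "E2 = B2"
    unfolding E2 L' L2' mB PB
    by (subst S2', unfold S2, unfold S) (simp add: algebra_simps power2_eq_square)
qed

text \<open>The polynomial \<open>x (x - (n - 1))\<close> is nonpositive at \<open>0, \<dots>, n - 1\<close> and positive at all other integers.\<close>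

lemma consecutive_exponents:
  fixes e :: "nat \<Rightarrow> int"
  assumes inj: "inj_on e {0..<n}"
    and sums: "(\<Sum>k=0..<n. e k * (e k - (int n - 1))) = (\<Sum>k=0..<n. int k * (int k - (int n - 1)))"
  shows "e ` {0..<n} = int ` {0..<n}"
proof -
  define S where "S = e ` {0..<n}"
  define T where "T = int ` {0..<n}"
  define f where "f x = x * (x - (int n - 1))" for x
  have fin: "finite S" "finite T" by (auto simp: S_def T_def)
  have card: "card S = n" "card T = n" using inj by (auto simp: S_def T_def card_image)
  have eq: "sum f S = sum f T"
    using sums inj by (simp add: S_def T_def f_def sum.reindex o_def)
  have pos: "f x > 0" if "x \<in> S - T" for x
  proof -
    have n: "n > 0" using that by (auto simp: S_def)
    have "x < 0 \<or> x > int n - 1"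
    proof (rule ccontr)
      assume "\<not> ?thesis"
      then have "x = int (nat x)" "nat x < n" by auto
      then show False using that unfolding T_def by (metis DiffD2 atLeastLessThan_iff image_eqI zero_le)
    qed
    then show ?thesis
    proof
      assume "x < 0"
      then show ?thesis unfolding f_def using n by (intro mult_neg_neg) auto
    next
      assume "x > int n - 1"
      moreover have "x \<noteq> 0" using that calculation n by (auto simp: T_def)
      ultimately have "x > 0" by linarith
      then show ?thesis unfolding f_def using \<open>x > int n - 1\<close> by simp
    qed
  qed
  have neg: "f x \<le> 0" if "x \<in> T" for x
    using that by (auto simp: f_def T_def intro!: mult_nonneg_nonpos)
  have "sum f (S - T) = sum f (T - S)"
    using eq fin sum.Int_Diff[of S f T] sum.Int_Diff[of T f S] by (simp add: Int_commute)
  also have "\<dots> \<le> 0" by (rule sum_nonpos) (use neg in auto)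
  finally have "S - T = {}"
    using sum_pos[of "S - T" f] fin pos by (metis finite_Diff not_le)
  then have "S \<subseteq> T" by auto
  then show ?thesis using card_subset_eq[OF fin(2)] card by (simp add: S_def T_def)
qed

lemma image_int_to_permutation:
  assumes inj: "inj_on e {0..<n}" and img: "e ` {0..<n} = int ` {0..<n}"
  obtains q where "q permutes {0..<n}" "\<And>k. k < n \<Longrightarrow> e k = int n - 1 - int (q k)"
proof -
  define q where "q k = (if k < n then nat (int n - 1 - e k) else k)" for k
  have qe: "e k = int n - 1 - int (q k)" "q k < n" if "k < n" for k
  proof -
    have "e k \<in> int ` {0..<n}" unfolding img[symmetric] using that by simp
    then obtain j where j: "e k = int j" "j \<in> {0..<n}" by (rule imageE)
    have "q k = nat (int n - 1 - int j)" unfolding q_def j(1) using that by (simp only: if_True)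
    moreover have "j < n" using j(2) by (simp only: atLeastLessThan_iff)
    ultimately show "e k = int n - 1 - int (q k)" "q k < n" unfolding j(1) by linarith+
  qed
  have "inj_on q {0..<n}"
  proof (rule inj_onI)
    fix i j assume ij: "i \<in> {0..<n}" "j \<in> {0..<n}" "q i = q j"
    then have "e i = e j" using qe(1)[of i] qe(1)[of j] by simp
    then show "i = j" using inj_onD[OF inj, of i j] ij by simp
  qed
  moreover have "q ` {0..<n} \<subseteq> {0..<n}" using qe(2) by auto
  ultimately have "bij_betw q {0..<n} {0..<n}"
    by (simp add: bij_betw_def endo_inj_surj)
  then have "q permutes {0..<n}"
    by (rule bij_imp_permutes) (auto simp: q_def)
  then show ?thesis using that qe(1) by blast
qed

lemma coeff_det_cong: "(\<And>a. a < m \<Longrightarrow> s a = s' a) \<Longrightarrow> coeff_det m q s = coeff_det m q s'"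
  unfolding coeff_det_def by (intro arg_cong[of _ _ Determinant.det] eq_matI) auto

context haar
begin

lemma det_mean_permutation:
  fixes m P :: nat and e :: "nat \<Rightarrow> int"
  assumes p: "p permutes {0..<CARD('n) + m}" and e: "\<And>k. k < CARD('n) \<Longrightarrow> e k + int P = int (p k)"
    and nz: "det_mean P (\<lambda>g. coeff_det m (charpoly g) (\<lambda>a. p (CARD('n) + a))) \<noteq> 0"
  shows "e ` {0..<CARD('n)} = int ` {0..<CARD('n)}"
proof -
  define n where "n = CARD('n)"
  define N where "N = complex_of_nat n"
  define s where "s = restrict (\<lambda>a. p (n + a)) {0..<m}"
  define C where "C = (\<Sum>k=0..<m. complex_of_nat k)"
  define C2 where "C2 = (\<Sum>k=0..<m. (complex_of_nat k)\<^sup>2)"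
  define B where "B = (\<Sum>k=0..<n. complex_of_nat k)"
  define B2 where "B2 = (\<Sum>k=0..<n. (complex_of_nat k)\<^sup>2)"
  define S where "S = (\<Sum>a=0..<m. complex_of_nat (s a))"
  define S2 where "S2 = (\<Sum>a=0..<m. (complex_of_nat (s a))\<^sup>2)"
  define L where "L = (\<Sum>k=0..<n. complex_of_nat (p k))"
  define L2 where "L2 = (\<Sum>k=0..<n. (complex_of_nat (p k))\<^sup>2)"
  define E where "E = (\<Sum>k=0..<n. complex_of_int (e k))"
  define E2 where "E2 = (\<Sum>k=0..<n. (complex_of_int (e k))\<^sup>2)"
  define Pc where "Pc = complex_of_nat P"
  define mc where "mc = complex_of_nat m"
  have s: "s \<in> PiE {0..<m} (\<lambda>_. {..<m + CARD('n)})"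
  proof (rule PiE_I)
    fix a assume "a \<in> {0..<m}"
    then show "s a \<in> {..<m + CARD('n)}"
      using permutes_in_image[OF p, of "n + a"] by (simp add: s_def n_def add.commute)
  qed (simp add: s_def)
  have nz': "det_mean P (\<lambda>g. coeff_det m (charpoly g) s) \<noteq> 0"
    using nz coeff_det_cong[of m s "\<lambda>a. p (CARD('n) + a)"] by (simp add: s_def n_def)
  note * = det_mean_coeff_det[OF s nz', folded n_def, folded N_def C_def C2_def S_def Pc_def mc_def]
  have B: "2 * B = N * (N - 1)"
    unfolding B_def N_def by (induction n) (simp_all add: algebra_simps)
  have S: "S = C + mc * N - Pc * N" by (rule *(1))
  have "off_diag {0..<m} (\<lambda>a b. of_nat (s a) * of_nat (s b)) = S * S - S2"
    by (subst off_diag_prod) (simp_all add: S_def S2_def power2_eq_square)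
  note S2 = *(2)[unfolded this]
  \<comment> \<open>The same total is divided once into exponents and complement, and once into the
    first \<open>m\<close> numbers and \<open>n\<close> numbers shifted by \<open>m\<close>. The
    second division makes the sums of 0, ..., n - 1 appear, with which those of \<open>e\<close> are
    to be compared.\<close>
  have split: "(\<Sum>i=0..<n + m. f (p i)) = (\<Sum>k=0..<n. f (p k)) + (\<Sum>a=0..<m. f (s a))"
    "(\<Sum>i=0..<n + m. f (p i)) = (\<Sum>k=0..<m. f k) + (\<Sum>k=0..<n. f (m + k))" for f :: "nat \<Rightarrow> complex"
  proof -
    have two: "(\<Sum>i=0..<a + b. h i) = (\<Sum>k=0..<a. h k) + (\<Sum>k=0..<b. h (a + k))" for a b :: nat and h :: "nat \<Rightarrow> complex"
      using sum.atLeastLessThan_concat[of 0 a "a + b" h] sum.shift_bounds_nat_ivl[of h 0 a b]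
      by (simp add: add.commute)
    show "(\<Sum>i=0..<n + m. f (p i)) = (\<Sum>k=0..<n. f (p k)) + (\<Sum>a=0..<m. f (s a))"
      unfolding two by (simp add: s_def)
    have "(\<Sum>i=0..<n + m. f (p i)) = (\<Sum>i=0..<n + m. f i)"
      using sum.permute[OF p, of f] by (simp add: n_def o_def)
    then show "(\<Sum>i=0..<n + m. f (p i)) = (\<Sum>k=0..<m. f k) + (\<Sum>k=0..<n. f (m + k))"
      using two[where a = m and b = n and h = f] by (simp add: add.commute)
  qed
  have L: "L + S = C + (N * mc + B)"
    using split[of complex_of_nat] by (simp add: L_def S_def C_def B_def N_def mc_def sum.distrib)
  have L2: "L2 + S2 = C2 + (N * mc\<^sup>2 + 2 * mc * B + B2)"
    using split[of "\<lambda>k. (complex_of_nat k)\<^sup>2"]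
    by (simp add: L2_def S2_def C2_def B_def B2_def N_def mc_def power2_sum sum.distrib sum_distrib_left mult_ac add_ac)
  have pe: "complex_of_int (e k) = complex_of_nat (p k) - Pc" if "k < n" for k
    using e[of k] that by (metis Pc_def add_diff_cancel_right' n_def of_int_add of_int_of_nat_eq)
  have E: "E = L - N * Pc"
    unfolding E_def L_def by (simp add: pe sum_subtractf N_def)
  have E2: "E2 = L2 - 2 * Pc * L + N * Pc\<^sup>2"
    unfolding E2_def L2_def L_def
    by (simp add: pe power2_diff sum_subtractf sum.distrib N_def sum_distrib_left mult_ac)
  have "E = B" "E2 = B2"
    by (rule complement_moments[OF B S S2 L L2 E E2])+
  have "complex_of_int (\<Sum>k=0..<n. f k * (f k - (int n - 1))) =
      (\<Sum>k=0..<n. (complex_of_int (f k))\<^sup>2) - (of_nat n - 1) * (\<Sum>k=0..<n. complex_of_int (f k))" for f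
    unfolding of_int_sum sum_distrib_left sum_subtractf[symmetric]
    by (intro sum.cong refl) (simp add: power2_eq_square algebra_simps)
  from this[of e] this[of int]
  have "complex_of_int (\<Sum>k=0..<n. e k * (e k - (int n - 1))) = complex_of_int (\<Sum>k=0..<n. int k * (int k - (int n - 1)))"
    using \<open>E = B\<close> \<open>E2 = B2\<close> unfolding E_def B_def E2_def B2_def of_int_of_nat_eq by simp
  then have sums: "(\<Sum>k=0..<n. e k * (e k - (int n - 1))) = (\<Sum>k=0..<n. int k * (int k - (int n - 1)))"
    by (simp only: of_int_eq_iff)
  have "inj_on e {0..<n}"
  proof (rule inj_onI)
    fix i j assume ij: "i \<in> {0..<n}" "j \<in> {0..<n}" "e i = e j"
    then have "p i = p j" using e[of i] e[of j] by (simp add: n_def)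
    then show "i = j" using permutes_inj[OF p] by (simp add: inj_eq)
  qed
  from consecutive_exponents[OF this sums] show ?thesis by (simp only: n_def)
qed

lemma integral_quotient_permutation:
  assumes p: "p permutes {0..<CARD('n)}" and e: "\<And>k. k < CARD('n) \<Longrightarrow> e k = int CARD('n) - 1 - int (p k)"
  shows "\<exists>F. continuous_on unitary_group F \<and> (\<forall>g\<in>unitary_group. quotient_limit CARD('n) e (eig g) (F g)) \<and>
    (LINT g|M. F g) = signof p"
  using quotient_limit_permute[OF p e] measure_M
  by (intro exI[of _ "\<lambda>_. signof p"]) (simp add: space_M[symmetric])

lemma integral_quotient_other:
  assumes no: "\<And>p. p permutes {0..<CARD('n)} \<Longrightarrow> \<exists>k<CARD('n). e k \<noteq> int CARD('n) - 1 - int (p k)"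
  shows "\<exists>F. continuous_on unitary_group F \<and> (\<forall>g\<in>unitary_group. quotient_limit CARD('n) e (eig g) (F g)) \<and>
    (LINT g|M. F g) = 0"
proof (cases "inj_on e {0..<CARD('n)}")
  case False
  then obtain k k' where "k < CARD('n)" "k' < CARD('n)" "k \<noteq> k'" "e k = e k'"
    by (auto simp: inj_on_def)
  then show ?thesis
    using quotient_limit_repeated[of k "CARD('n)" k' e] by (intro exI[of _ "\<lambda>_. 0"]) auto
next
  case inj: True
  define n where "n = CARD('n)"
  \<comment> \<open>Generous choices: \<open>P\<close> makes all shifted exponents nonnegative, and
    \<open>m\<close> leaves room for them below \<open>n + m\<close>.\<close>
  define P where "P = nat (\<Sum>k<n. \<bar>e k\<bar>)"
  define l where "l k = nat (e k + int P)" for k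
  define m where "m = (\<Sum>k<n. l k) + 1"
  have eP: "e k + int P = int (l k)" if "k < n" for k
  proof -
    have "\<bar>e k\<bar> \<le> (\<Sum>k<n. \<bar>e k\<bar>)" using that by (intro member_le_sum) auto
    then show ?thesis by (simp add: l_def P_def)
  qed
  have "inj_on l {0..<n}"
  proof (rule inj_onI)
    fix i j assume ij: "i \<in> {0..<n}" "j \<in> {0..<n}" "l i = l j"
    then have "e i = e j" using eP[of i] eP[of j] by simp
    then show "i = j" using inj_onD[OF inj, of i j] ij by (simp add: n_def)
  qed
  moreover have "l k < n + m" if "k < n" for k
  proof -
    have "l k \<le> (\<Sum>k<n. l k)" by (rule member_le_sum) (use that in auto)
    then show ?thesis unfolding m_def by linarith
  qed
  ultimately obtain p where p: "p permutes {0..<n + m}" "\<And>k. k < n \<Longrightarrow> p k = l k"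
    using extend_to_permutation[of l n m] by metis
  have ep: "e k + int P = int (p k)" if "k < n" for k using eP p(2) that by simp
  obtain c where c: "\<And>t. (\<And>j. j < n \<Longrightarrow> t j \<noteq> 0) \<Longrightarrow>
      quotient_limit n e t (inverse (\<Prod>j<n. t j) ^ P * (c * coeff_det m (root_poly n t) (\<lambda>a. p (n + a))))"
    by (rule quotient_limit_coeff_det[OF p(1) ep]) blast+
  define F where "F g = inverse (cdet g) ^ P * (c * coeff_det m (charpoly g) (\<lambda>a. p (n + a)))" for g :: "complex^'n^'n"
  have "continuous_on unitary_group F"
    unfolding F_def
    by (intro continuous_on_mult continuous_on_power continuous_on_inverse continuous_on_cdet
        continuous_on_id continuous_on_const continuous_on_coeff_det ballI det_unitary_nz)
  moreover have "quotient_limit n e (eig g) (F g)" if "g \<in> unitary_group" for g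
  proof -
    have "quotient_limit n e (eig g) (inverse (\<Prod>j<n. eig g j) ^ P * (c * coeff_det m (root_poly n (eig g)) (\<lambda>a. p (n + a))))"
    proof (rule c)
      fix j assume "j < n"
      then show "eig g j \<noteq> 0" using eig_nz[OF that, of j] unfolding n_def by blast
    qed
    then show ?thesis unfolding F_def by (simp only: n_def root_poly_eig prod_eig(2))
  qed
  moreover have "(LINT g|M. F g) = 0"
  proof -
    have "(LINT g|M. F g) = det_mean P (\<lambda>g. c * coeff_det m (charpoly g) (\<lambda>a. p (n + a)))"
      unfolding F_def det_mean_def ..
    also have "\<dots> = c * det_mean P (\<lambda>g. coeff_det m (charpoly g) (\<lambda>a. p (n + a)))"
      by (rule det_mean_cmult)
    also have "det_mean P (\<lambda>g. coeff_det m (charpoly g) (\<lambda>a. p (n + a))) = 0"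
    proof (rule ccontr)
      assume nz: "det_mean P (\<lambda>g. coeff_det m (charpoly g) (\<lambda>a. p (n + a))) \<noteq> 0"
      have img: "e ` {0..<n} = int ` {0..<n}"
        unfolding n_def
      proof (rule det_mean_permutation[OF p(1)[unfolded n_def] _ nz[unfolded n_def]])
        show "e k + int P = int (p k)" if "k < CARD('n)" for k
          using ep[of k] that unfolding n_def by blast
      qed
      obtain q where "q permutes {0..<n}" "\<And>k. k < n \<Longrightarrow> e k = int n - 1 - int (q k)"
        by (rule image_int_to_permutation[OF inj[folded n_def] img]) blast
      then show False using no[of q] unfolding n_def by blast
    qed
    finally show ?thesis by simp
  qed
  ultimately show ?thesis unfolding n_def by blast
qed

end

section \<open>The twisted moment as a determinant\<close>

text \<open>The Laurent polynomial h of the overview multiplied by the power \<open>size A\<close>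
  of the variable.\<close>

definition moment_poly :: "complex multiset \<Rightarrow> complex multiset \<Rightarrow> complex poly" where
  "moment_poly A B = (\<Prod>\<alpha>\<in>#A. [:- \<alpha>, 1:]) * (\<Prod>\<beta>\<in>#B. [:1, - \<beta>:])"

text \<open>The coefficient of h at the power \<open>i\<close>. The case distinction prevents
  \<open>nat\<close> from sending indices below the range to the constant coefficient.\<close>

definition moment_coeff :: "complex multiset \<Rightarrow> complex multiset \<Rightarrow> int \<Rightarrow> complex" where
  "moment_coeff A B i = (if i + int (size A) < 0 then 0 else coeff (moment_poly A B) (nat (i + int (size A))))"

definition moment_det :: "int list \<Rightarrow> complex multiset \<Rightarrow> complex multiset \<Rightarrow> complex" where
  "moment_det lam A B = Determinant.det (Matrix.mat (length lam) (length lam)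
     (\<lambda>(j, k). moment_coeff A B (int k - int j - lam ! k)))"

lemma moment_det_leibniz:
  "moment_det lam A B = (\<Sum>p | p permutes {0..<length lam}. signof p *
     (\<Prod>k=0..<length lam. moment_coeff A B (int k - int (p k) - lam ! k)))"
  unfolding moment_det_def
  by (subst mat_det_left_def[of _ "length lam"]) (auto intro!: sum.cong prod.cong dest: permutes_in_image)

lemma poly_moment_poly:
  "poly (moment_poly A B) x = (\<Prod>\<alpha>\<in>#A. x - \<alpha>) * (\<Prod>\<beta>\<in>#B. 1 - \<beta> * x)"
proof -
  have "poly (\<Prod>\<alpha>\<in>#A. [:- \<alpha>, 1:]) x = (\<Prod>\<alpha>\<in>#A. x - \<alpha>)"
    by (induction A) (simp_all add: algebra_simps)
  moreover have "poly (\<Prod>\<beta>\<in>#B. [:1, - \<beta>:]) x = (\<Prod>\<beta>\<in>#B. 1 - \<beta> * x)"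
    by (induction B) (simp_all add: algebra_simps)
  ultimately show ?thesis by (simp add: moment_poly_def)
qed

lemma degree_moment_poly: "degree (moment_poly A B) \<le> size A + size B"
proof -
  have "degree (\<Prod>\<alpha>\<in>#A. [:- \<alpha>, 1:]) \<le> size A"
    by (induction A) (auto intro!: order_trans[OF degree_mult_le] simp del: mult_pCons_left)
  moreover have "degree (\<Prod>\<beta>\<in>#B. [:1, - \<beta>:]) \<le> size B"
    by (induction B) (auto intro!: order_trans[OF degree_mult_le] simp del: mult_pCons_left intro: order_trans[OF degree_pCons_le])
  ultimately show ?thesis
    unfolding moment_poly_def by (rule order_trans[OF degree_mult_le add_mono])
qed

lemma prod_mset_prod_swap: "(\<Prod>a\<in>#A. \<Prod>j\<in>J. f a j) = (\<Prod>j\<in>J. \<Prod>a\<in>#A. (f a j :: complex))"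
  by (induction A) (simp_all add: prod.distrib)

text \<open>Multiplication by \<open>g\<close> on the right replaces the adjoint by the identity and
  leaves \<open>g - \<alpha>\<close>.\<close>

lemma det_one_minus_adjoint:
  fixes g :: "complex^'n^'n"
  assumes g: "g \<in> unitary_group"
  shows "cdet (cmat 1 - cmat \<alpha> ** conj_transpose g) = (\<Prod>j<CARD('n). (eig g j - \<alpha>) / eig g j)"
proof -
  have "(cmat 1 - cmat \<alpha> ** conj_transpose g) ** g = g - cmat \<alpha> ** (conj_transpose g ** g)"
    by (simp add: matrix_diff_mult(1) matrix_mul_assoc)
  also have "conj_transpose g ** g = cmat 1" using g by (simp add: unitary_group_def)
  also have "g - cmat \<alpha> ** cmat 1 = cmat (- 1) ** (cmat \<alpha> - g)"
    by (auto simp: Finite_Cartesian_Product.vec_eq_iff cmat_mult)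
  finally have "cdet ((cmat 1 - cmat \<alpha> ** conj_transpose g) ** g) = cdet (cmat (- 1) ** (cmat \<alpha> - g))" by simp
  then have "cdet (cmat 1 - cmat \<alpha> ** conj_transpose g) * (\<Prod>j<CARD('n). eig g j) = (- 1) ^ CARD('n) * (\<Prod>j<CARD('n). \<alpha> - eig g j)"
    unfolding det_mul det_cmat prod_eig .
  also have "\<dots> = (\<Prod>j<CARD('n). eig g j - \<alpha>)"
    using prod.distrib[of "\<lambda>_. - 1" "\<lambda>j. \<alpha> - eig g j" "{..<CARD('n)}"] by simp
  moreover have "(\<Prod>j<CARD('n). eig g j) \<noteq> 0"
    unfolding prod_eig by (rule det_unitary_nz[OF g])
  ultimately show ?thesis
    by (simp add: prod_dividef eq_divide_eq)
qed

lemma det_one_minus_scaled: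
  fixes g :: "complex^'n^'n"
  shows "cdet (cmat 1 - cmat \<beta> ** g) = (\<Prod>j<CARD('n). 1 - \<beta> * eig g j)"
proof (cases "\<beta> = 0")
  case True
  have "cmat 0 ** g = 0" by (simp add: cmat_mult Finite_Cartesian_Product.vec_eq_iff)
  then show ?thesis using True by simp
next
  case False
  then have "cmat 1 - cmat \<beta> ** g = cmat \<beta> ** (cmat (1 / \<beta>) - g)"
    unfolding cmat_mult
    by (auto simp: Finite_Cartesian_Product.vec_eq_iff Finite_Cartesian_Product.mat_def algebra_simps)
  then have "cdet (cmat 1 - cmat \<beta> ** g) = \<beta> ^ CARD('n) * (\<Prod>j<CARD('n). 1 / \<beta> - eig g j)"
    by (simp add: det_mul det_cmat prod_eig)
  also have "\<dots> = (\<Prod>j<CARD('n). \<beta> * (1 / \<beta> - eig g j))"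
    by (simp add: prod.distrib)
  also have "\<dots> = (\<Prod>j<CARD('n). 1 - \<beta> * eig g j)"
    using False by (intro prod.cong) (simp_all add: algebra_simps)
  finally show ?thesis .
qed

lemma int_alternant_leibniz:
  "int_alternant n e y = (\<Sum>p | p permutes {0..<n}. signof p * (\<Prod>k=0..<n. y (p k) powi e k))"
  unfolding int_alternant_def
  by (subst mat_det_left_def[of _ n]) (auto intro!: sum.cong prod.cong dest: permutes_in_image)

text \<open>The product over all variables is symmetric, so in the term of the permutation
  \<open>p\<close> it can be reindexed such that the factor in \<open>y (p k)\<close> meets the
  power with exponent \<open>e k\<close>. The function \<open>\<kappa>\<close> records the chosen
  degree in each factor.\<close>

lemma int_alternant_expand:
  assumes y: "\<And>j. j < n \<Longrightarrow> y j \<noteq> 0"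
  shows "(\<Prod>j=0..<n. \<Sum>d\<le>D. c d * y j powi (int d - P)) * int_alternant n e y
    = (\<Sum>\<kappa>\<in>PiE {0..<n} (\<lambda>_. {..D}). (\<Prod>k=0..<n. c (\<kappa> k)) * int_alternant n (\<lambda>k. e k + int (\<kappa> k) - P) y)"
proof -
  have "(\<Prod>j=0..<n. \<Sum>d\<le>D. c d * y j powi (int d - P)) * (signof p * (\<Prod>k=0..<n. y (p k) powi e k))
      = (\<Sum>\<kappa>\<in>PiE {0..<n} (\<lambda>_. {..D}). (\<Prod>k=0..<n. c (\<kappa> k)) * (signof p * (\<Prod>k=0..<n. y (p k) powi (e k + int (\<kappa> k) - P))))"
    if p: "p permutes {0..<n}" for p
  proof -
    have pk: "p k < n" if "k < n" for k using permutes_in_image[OF p, of k] that by simp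
    have "(\<Prod>j=0..<n. \<Sum>d\<le>D. c d * y j powi (int d - P)) = (\<Prod>k=0..<n. \<Sum>d\<le>D. c d * y (p k) powi (int d - P))"
      using prod.permute[OF p, of "\<lambda>j. \<Sum>d\<le>D. c d * y j powi (int d - P)"] by (simp add: o_def)
    then have "(\<Prod>j=0..<n. \<Sum>d\<le>D. c d * y j powi (int d - P)) * (signof p * (\<Prod>k=0..<n. y (p k) powi e k))
        = signof p * (\<Prod>k=0..<n. (\<Sum>d\<le>D. c d * y (p k) powi (int d - P)) * y (p k) powi e k)"
      by (simp add: prod.distrib)
    also have "(\<Prod>k=0..<n. (\<Sum>d\<le>D. c d * y (p k) powi (int d - P)) * y (p k) powi e k)
        = (\<Prod>k=0..<n. \<Sum>d\<le>D. c d * y (p k) powi (e k + int d - P))"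
    proof (rule prod.cong)
      fix k assume "k \<in> {0..<n}"
      then have "y (p k) \<noteq> 0" using y pk by simp
      then have "y (p k) powi (e k + int d - P) = y (p k) powi (int d - P) * y (p k) powi e k" for d
        by (subst power_int_add[symmetric]) (auto simp: algebra_simps)
      then show "(\<Sum>d\<le>D. c d * y (p k) powi (int d - P)) * y (p k) powi e k = (\<Sum>d\<le>D. c d * y (p k) powi (e k + int d - P))"
        by (simp add: sum_distrib_right mult.assoc)
    qed simp
    also have "\<dots> = (\<Sum>\<kappa>\<in>PiE {0..<n} (\<lambda>_. {..D}). \<Prod>k=0..<n. c (\<kappa> k) * y (p k) powi (e k + int (\<kappa> k) - P))"
      by (rule prod_sum_PiE) auto
    finally show ?thesis by (simp add: prod.distrib sum_distrib_left mult_ac)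
  qed
  then show ?thesis
    unfolding int_alternant_leibniz sum_distrib_left by (subst sum.swap) (intro sum.cong, auto)
qed

context haar
begin

text \<open>At most one permutation hits \<open>e\<close>, so at most one summand is nonzero.
  Writing the integral as a sum over permutations lets the expansion of the integrand recombine to a
  Leibniz formula.\<close>

lemma integral_quotient:
  fixes e :: "nat \<Rightarrow> int"
  defines "hits p \<equiv> (\<forall>k<CARD('n). e k = int CARD('n) - 1 - int (p k))"
  obtains F where "continuous_on unitary_group F"
    "\<And>g. g \<in> unitary_group \<Longrightarrow> quotient_limit CARD('n) e (eig g) (F g)"
    "(LINT g|M. F g) = (\<Sum>p | p permutes {0..<CARD('n)}. if hits p then signof p else 0)"
proof (cases "\<exists>p. p permutes {0..<CARD('n)} \<and> hits p")
  case True
  then obtain p where p: "p permutes {0..<CARD('n)}" "hits p" by blast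
  have uniq: "q = p" if q: "q permutes {0..<CARD('n)}" "hits q" for q
  proof
    fix k
    show "q k = p k"
    proof (cases "k < CARD('n)")
      case True
      then have "int (q k) = int (p k)" using p(2) q(2) unfolding hits_def by force
      then show ?thesis by simp
    next
      case False
      then show ?thesis using permutes_not_in[OF p(1), of k] permutes_not_in[OF q(1), of k] by simp
    qed
  qed
  have "(\<Sum>q | q permutes {0..<CARD('n)}. if hits q then signof q else 0 :: complex) =
      (\<Sum>q | q permutes {0..<CARD('n)}. if q = p then signof p else 0)"
  proof (intro sum.cong refl)
    fix q assume q: "q \<in> {q. q permutes {0..<CARD('n)}}"
    show "(if hits q then signof q else 0 :: complex) = (if q = p then signof p else 0)"
    proof (cases "q = p")
      case False
      then have "\<not> hits q" using uniq[of q] q by blast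
      then show ?thesis using False by (simp only: if_False)
    next
      case True
      then show ?thesis using p(2) by simp
    qed
  qed
  also have "\<dots> = signof p" using p(1) by (subst sum.delta) (auto simp: finite_permutations)
  finally have sp: "(\<Sum>q | q permutes {0..<CARD('n)}. if hits q then signof q else 0 :: complex) = signof p" .
  have e: "\<And>k. k < CARD('n) \<Longrightarrow> e k = int CARD('n) - 1 - int (p k)"
    using p(2) by (simp add: hits_def)
  obtain F where "continuous_on unitary_group F"
    "\<forall>g\<in>unitary_group. quotient_limit CARD('n) e (eig g) (F g)" "(LINT g|M. F g) = signof p"
    using integral_quotient_permutation[of p e, OF p(1) e] by blast
  then show ?thesis using sp by (intro that[of F]) auto
next
  case False
  then have "\<exists>F. continuous_on unitary_group F \<and> (\<forall>g\<in>unitary_group. quotient_limit CARD('n) e (eig g) (F g)) \<and> (LINT g|M. F g) = 0"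
    unfolding hits_def by (intro integral_quotient_other) blast
  then obtain F where "continuous_on unitary_group F"
    "\<forall>g\<in>unitary_group. quotient_limit CARD('n) e (eig g) (F g)" "(LINT g|M. F g) = 0" by blast
  moreover have "(\<Sum>q | q permutes {0..<CARD('n)}. if hits q then signof q else 0 :: complex) = 0"
    using False by (intro sum.neutral) auto
  ultimately show ?thesis by (intro that[of F]) auto
qed

theorem twisted_moment_eq_moment_det:
  assumes len: "length lam = CARD('n)"
  shows "twisted_moment M A B lam = moment_det lam A B"
proof -
  define n where "n = CARD('n)"
  define D where "D = size A + size B"
  define P where "P = int (size A)"
  define c where "c d = coeff (moment_poly A B) d" for d
  define e where "e k = int n - 1 - int k + lam ! k" for k
  define I where "I = PiE {0..<n} (\<lambda>_. {..D})"
  define h where "h x = (\<Sum>d\<le>D. c d * x powi (int d - P))" for x :: complex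
  define hits where "hits \<kappa> p = (\<forall>k<n. e k + int (\<kappa> k) - P = int n - 1 - int (p k))" for \<kappa> p
  have finI: "finite I" unfolding I_def by (intro finite_PiE) auto
  have h_eq: "h x = (\<Prod>\<alpha>\<in>#A. (x - \<alpha>) / x) * (\<Prod>\<beta>\<in>#B. 1 - \<beta> * x)" if x: "x \<noteq> 0" for x
  proof -
    have "h x = (\<Sum>d\<le>D. c d * x ^ d) / x ^ size A"
      using x unfolding h_def sum_divide_distrib by (intro sum.cong) (auto simp: power_int_diff P_def)
    also have "(\<Sum>d\<le>D. c d * x ^ d) = poly (moment_poly A B) x"
      unfolding poly_altdef c_def using degree_moment_poly[of A B]
      by (intro sum.mono_neutral_right) (auto simp: D_def coeff_eq_0)
    also have "\<dots> / x ^ size A = (\<Prod>\<alpha>\<in>#A. (x - \<alpha>) / x) * (\<Prod>\<beta>\<in>#B. 1 - \<beta> * x)"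
    proof -
      have "(\<Prod>\<alpha>\<in>#A. (x - \<alpha>) / x) = (\<Prod>\<alpha>\<in>#A. x - \<alpha>) / x ^ size A"
        by (induction A) simp_all
      then show ?thesis by (simp add: poly_moment_poly)
    qed
    finally show ?thesis .
  qed
  have "\<exists>F. continuous_on unitary_group F \<and>
      (\<forall>g\<in>unitary_group. quotient_limit n (\<lambda>k. e k + int (\<kappa> k) - P) (eig g) (F g)) \<and>
      (LINT g|M. F g) = (\<Sum>p | p permutes {0..<n}. if hits \<kappa> p then signof p else 0)" for \<kappa>
    unfolding n_def hits_def by (rule integral_quotient[of "\<lambda>k. e k + int (\<kappa> k) - P"]) blast
  then obtain F where F: "\<And>\<kappa>. continuous_on unitary_group (F \<kappa>)"
      "\<And>\<kappa> g. g \<in> unitary_group \<Longrightarrow> quotient_limit n (\<lambda>k. e k + int (\<kappa> k) - P) (eig g) (F \<kappa> g)"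
      "\<And>\<kappa>. (LINT g|M. F \<kappa> g) = (\<Sum>p | p permutes {0..<n}. if hits \<kappa> p then signof p else 0)"
    by metis
  \<comment> \<open>Supplies the limit that defines the Schur function at the eigenvalues, whether
    or not they are distinct.\<close>
  obtain F0 where F0: "\<And>g :: complex^'n^'n. g \<in> unitary_group \<Longrightarrow> quotient_limit n e (eig g) (F0 g)"
    unfolding n_def by (rule integral_quotient[of e]) blast
  have pointwise: "(\<Prod>\<alpha>\<in>#A. cdet (cmat 1 - cmat \<alpha> ** conj_transpose g)) * (\<Prod>\<beta>\<in>#B. cdet (cmat 1 - cmat \<beta> ** g)) *
      schur_weight lam (eigenvalues_mset g) = (\<Sum>\<kappa>\<in>I. (\<Prod>k=0..<n. c (\<kappa> k)) * F \<kappa> g)"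
    if g: "g \<in> unitary_group" for g
  proof -
    have nz: "eig g j \<noteq> 0" if "j < n" for j using eig_nz[OF g, of j] that unfolding n_def by blast
    have "schur_weight lam (eigenvalues_mset g) = F0 g"
      unfolding schur_weight_def len n_def[symmetric]
      by (rule schur_eq_quotient_limit) (use nz F0[OF g] in \<open>simp_all add: e_def[abs_def]\<close>)
    moreover have "(\<Prod>\<alpha>\<in>#A. cdet (cmat 1 - cmat \<alpha> ** conj_transpose g)) * (\<Prod>\<beta>\<in>#B. cdet (cmat 1 - cmat \<beta> ** g))
        = (\<Prod>j=0..<n. h (eig g j))"
      unfolding det_one_minus_adjoint[OF g] unfolding det_one_minus_scaled prod_mset_prod_swap prod.distrib[symmetric]
      unfolding n_def[symmetric] lessThan_atLeast0 using nz by (intro prod.cong refl) (simp add: h_eq)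
    \<comment> \<open>Eigenvalues may coincide, so the expansion is applied at nearby distinct
      points and both sides pass to the limit.\<close>
    moreover have "(\<Prod>j=0..<n. h (eig g j)) * F0 g = (\<Sum>\<kappa>\<in>I. (\<Prod>k=0..<n. c (\<kappa> k)) * F \<kappa> g)"
    proof (rule tendsto_unique[OF distinct_points_dense[of "eig g" n]])
      let ?q = "\<lambda>e y. int_alternant n e y / alternant n (\<lambda>_. 0) y"
      show "((\<lambda>y. (\<Prod>j=0..<n. h (y j)) * ?q e y) \<longlongrightarrow> (\<Prod>j=0..<n. h (eig g j)) * F0 g)
          (at (eig g) within {y. alternant n (\<lambda>_. 0) y \<noteq> 0})"
      proof (intro tendsto_mult tendsto_prod)
        show "((\<lambda>y. h (y j)) \<longlongrightarrow> h (eig g j)) (at (eig g) within {y. alternant n (\<lambda>_. 0) y \<noteq> 0})"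
          if "j \<in> {0..<n}" for j
          unfolding h_def using nz[of j] that
          by (intro tendsto_sum tendsto_mult tendsto_const tendsto_power_int tendsto_coord) auto
      qed (use F0[OF g] in \<open>simp add: quotient_limit_def\<close>)
      have "((\<lambda>y. \<Sum>\<kappa>\<in>I. (\<Prod>k=0..<n. c (\<kappa> k)) * ?q (\<lambda>k. e k + int (\<kappa> k) - P) y) \<longlongrightarrow>
          (\<Sum>\<kappa>\<in>I. (\<Prod>k=0..<n. c (\<kappa> k)) * F \<kappa> g)) (at (eig g) within {y. alternant n (\<lambda>_. 0) y \<noteq> 0})"
        using F(2)[OF g] unfolding quotient_limit_def by (intro tendsto_sum tendsto_mult tendsto_const)
      moreover have "eventually (\<lambda>y. (\<Sum>\<kappa>\<in>I. (\<Prod>k=0..<n. c (\<kappa> k)) * ?q (\<lambda>k. e k + int (\<kappa> k) - P) y)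
          = (\<Prod>j=0..<n. h (y j)) * ?q e y) (at (eig g) within {y. alternant n (\<lambda>_. 0) y \<noteq> 0})"
      proof (rule eventually_mono)
        show "eventually (\<lambda>y. \<forall>j\<in>{..<n}. y j \<noteq> 0) (at (eig g) within {y. alternant n (\<lambda>_. 0) y \<noteq> 0})"
          by (rule eventually_coord_nz) (rule nz)
        fix y :: "nat \<Rightarrow> complex" assume "\<forall>j\<in>{..<n}. y j \<noteq> 0"
        then have "(\<Prod>j=0..<n. h (y j)) * int_alternant n e y =
            (\<Sum>\<kappa>\<in>I. (\<Prod>k=0..<n. c (\<kappa> k)) * int_alternant n (\<lambda>k. e k + int (\<kappa> k) - P) y)"
          unfolding h_def I_def by (intro int_alternant_expand) auto
        then show "(\<Sum>\<kappa>\<in>I. (\<Prod>k=0..<n. c (\<kappa> k)) * ?q (\<lambda>k. e k + int (\<kappa> k) - P) y) = (\<Prod>j=0..<n. h (y j)) * ?q e y"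
          by (simp add: sum_divide_distrib)
      qed
      ultimately show "((\<lambda>y. (\<Prod>j=0..<n. h (y j)) * ?q e y) \<longlongrightarrow> (\<Sum>\<kappa>\<in>I. (\<Prod>k=0..<n. c (\<kappa> k)) * F \<kappa> g))
          (at (eig g) within {y. alternant n (\<lambda>_. 0) y \<noteq> 0})"
        by (rule Lim_transform_eventually)
    qed
    ultimately show ?thesis by simp
  qed
  have "twisted_moment M A B lam = (LINT g|M. (\<Sum>\<kappa>\<in>I. (\<Prod>k=0..<n. c (\<kappa> k)) * F \<kappa> g))"
    unfolding twisted_moment_def by (intro Bochner_Integration.integral_cong) (auto simp: space_M pointwise)
  also have "\<dots> = (\<Sum>\<kappa>\<in>I. (\<Prod>k=0..<n. c (\<kappa> k)) * (LINT g|M. F \<kappa> g))"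
    by (subst Bochner_Integration.integral_sum) (auto intro!: integrable_continuous continuous_intros F(1))
  \<comment> \<open>The condition \<open>hits\<close> determines each \<open>\<kappa> k\<close>
    separately, so its indicator is a product over \<open>k\<close>.\<close>
  also have "\<dots> = (\<Sum>\<kappa>\<in>I. \<Sum>p | p permutes {0..<n}. signof p * (\<Prod>k=0..<n. if int (\<kappa> k) = P + int k - int (p k) - lam ! k then c (\<kappa> k) else 0))"
  proof (intro sum.cong refl)
    fix \<kappa>
    have "(\<Prod>k=0..<n. c (\<kappa> k)) * (if hits \<kappa> p then signof p else 0) =
        signof p * (\<Prod>k=0..<n. if int (\<kappa> k) = P + int k - int (p k) - lam ! k then c (\<kappa> k) else 0)" for p
    proof (cases "hits \<kappa> p")
      case True
      then have "int (\<kappa> k) = P + int k - int (p k) - lam ! k" if "k < n" for k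
        using that unfolding hits_def e_def by force
      then show ?thesis using True by simp
    next
      case False
      then obtain k where "k < n" "int (\<kappa> k) \<noteq> P + int k - int (p k) - lam ! k"
        unfolding hits_def e_def by force
      then have "(\<Prod>k=0..<n. if int (\<kappa> k) = P + int k - int (p k) - lam ! k then c (\<kappa> k) else 0) = 0"
        by (intro prod_zero) auto
      then show ?thesis using False by simp
    qed
    then show "(\<Prod>k=0..<n. c (\<kappa> k)) * (LINT g|M. F \<kappa> g) = (\<Sum>p | p permutes {0..<n}. signof p *
        (\<Prod>k=0..<n. if int (\<kappa> k) = P + int k - int (p k) - lam ! k then c (\<kappa> k) else 0))"
      unfolding F(3) sum_distrib_left by simp
  qed
  \<comment> \<open>The sum over all \<open>\<kappa>\<close> factors into sums over one degree each,
    in which at most one term is nonzero.\<close>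
  also have "\<dots> = (\<Sum>p | p permutes {0..<n}. signof p * (\<Prod>k=0..<n. \<Sum>d\<le>D. if int d = P + int k - int (p k) - lam ! k then c d else 0))"
    by (subst sum.swap) (simp add: sum_distrib_left[symmetric] I_def prod_sum_PiE)
  also have "\<dots> = (\<Sum>p | p permutes {0..<n}. signof p * (\<Prod>k=0..<n. moment_coeff A B (int k - int (p k) - lam ! k)))"
  proof (intro sum.cong refl arg_cong2[of _ _ _ _ "(*)"] prod.cong)
    fix p k
    define i where "i = int k - int (p k) - lam ! k + P"
    have "(\<Sum>d\<le>D. if int d = i then c d else 0) = (if i < 0 then 0 else c (nat i))"
    proof (cases "i < 0")
      case False
      then have "(\<Sum>d\<le>D. if int d = i then c d else 0) = (\<Sum>d\<le>D. if d = nat i then c d else 0)"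
        by (intro sum.cong) auto
      also have "\<dots> = c (nat i)"
        using degree_moment_poly[of A B] coeff_eq_0[of "moment_poly A B" "nat i"] by (auto simp: c_def D_def)
      finally show ?thesis using False by simp
    qed auto
    then show "(\<Sum>d\<le>D. if int d = P + int k - int (p k) - lam ! k then c d else 0) = moment_coeff A B (int k - int (p k) - lam ! k)"
      by (simp add: moment_coeff_def i_def P_def c_def algebra_simps)
  qed
  also have "\<dots> = moment_det lam A B"
    unfolding moment_det_leibniz len n_def ..
  finally show ?thesis .
qed

end

section \<open>Signs of permutations from Vandermonde determinants\<close>

lemma vandermonde_permute:
  assumes p: "p permutes {0..<n}"
  shows "power_alternant n (\<lambda>k. k) (\<lambda>j. y (p j)) = signof p * power_alternant n (\<lambda>k. k) y"
proof -
  have "power_alternant n (\<lambda>k. k) (\<lambda>j. y (p j))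
      = Determinant.det (Matrix.mat n n (\<lambda>(i, j). Matrix.mat n n (\<lambda>(j, k). y j ^ k) $$ (p i, j)))"
    unfolding power_alternant_def using permutes_in_image[OF p]
    by (intro arg_cong[of _ _ Determinant.det] eq_matI) auto
  also have "\<dots> = signof p * power_alternant n (\<lambda>k. k) y"
    unfolding power_alternant_def by (rule Determinant.det_permute_rows[OF _ p]) auto
  finally show ?thesis .
qed

text \<open>Both sides are the sign of the Vandermonde determinant at the points \<open>p 0\<close>,
  ..., \<open>p (n - 1)\<close>: permuting rows gives the sign of \<open>p\<close> times a positive
  number, and the product formula gives one sign for each pair.\<close>

lemma sign_eq_prod:
  assumes p: "p permutes {0..<n}"
  shows "signof p = (\<Prod>j<n. \<Prod>i<j. if p i < p j then 1 else - 1 :: complex)"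
proof -
  define X where "X = (\<Prod>j<n. \<Prod>i<j. real j - real i)"
  define Y where "Y = (\<Prod>j<n. \<Prod>i<j. \<bar>real (p j) - real (p i)\<bar>)"
  define S where "S = (\<Prod>j<n. \<Prod>i<j. if p i < p j then 1 else - 1 :: real)"
  have inj: "p i \<noteq> p j" if "i \<noteq> j" for i j using permutes_inj[OF p] that by (auto dest: injD)
  have X: "X > 0" unfolding X_def by (intro prod_pos) auto
  have Y: "Y > 0" unfolding Y_def using inj by (intro prod_pos) (auto simp: neq_iff)
  have S: "S = 1 \<or> S = - 1"
  proof -
    have "\<bar>S\<bar> = 1" unfolding S_def abs_prod by (intro prod.neutral ballI) auto
    then show ?thesis by linarith
  qed
  have "complex_of_real (S * Y) = power_alternant n (\<lambda>k. k) (\<lambda>j. of_nat (p j))"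
    unfolding vandermonde S_def Y_def prod.distrib[symmetric] of_real_prod
  proof (intro prod.cong refl)
    fix j i :: nat assume "i \<in> {..<j}"
    then show "complex_of_real ((if p i < p j then 1 else - 1) * \<bar>real (p j) - real (p i)\<bar>) = of_nat (p j) - of_nat (p i)"
      using inj[of i j] by (auto simp: abs_if)
  qed
  also have "\<dots> = signof p * power_alternant n (\<lambda>k. k) of_nat"
    by (rule vandermonde_permute[OF p])
  also have "power_alternant n (\<lambda>k. k) of_nat = complex_of_real X"
    by (simp add: vandermonde X_def)
  finally have "complex_of_real (S * Y) = complex_of_real (of_int (sign p) * X)" by simp
  then have eq: "S * Y = of_int (sign p) * X" by (simp only: of_real_eq_iff)
  have "of_int (sign p) = S"
    using eq X Y S sign_cases[of p] by (smt (verit) mult_minus_left mult_pos_pos mult_1 of_int_1 of_int_minus)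
  then have "signof p = complex_of_real S"
    by (metis of_real_of_int_eq)
  also have "\<dots> = (\<Prod>j<n. \<Prod>i<j. if p i < p j then 1 else - 1 :: complex)"
    unfolding S_def of_real_prod by (intro prod.cong refl) auto
  finally show ?thesis .
qed

section \<open>The swap sum in general position\<close>

definition list_vandermonde :: "complex list \<Rightarrow> complex" where
  "list_vandermonde ys = (\<Prod>j<length ys. \<Prod>i<j. ys ! j - ys ! i)"

lemma list_vandermonde_eq: "list_vandermonde ys = power_alternant (length ys) (\<lambda>k. k) (nth ys)"
  by (simp add: list_vandermonde_def vandermonde)

lemma list_vandermonde_nz: "distinct ys \<Longrightarrow> list_vandermonde ys \<noteq> 0"
  unfolding list_vandermonde_eq vandermonde_nz_iff by (simp add: inj_on_nth)

lemma prod_add_split: "(\<Prod>j<a + b. f j) = (\<Prod>j<a. f j) * (\<Prod>j<b. f (a + j :: nat))"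
  for f :: "nat \<Rightarrow> complex"
  by (induction b) (simp_all add: mult.assoc)

lemma list_vandermonde_append:
  "list_vandermonde (xs @ ys) = list_vandermonde xs * list_vandermonde ys * (\<Prod>x\<leftarrow>xs. \<Prod>y\<leftarrow>ys. y - x)"
proof -
  let ?n = "length xs" and ?m = "length ys"
  have "list_vandermonde (xs @ ys) = (\<Prod>j<?n. \<Prod>i<j. xs ! j - xs ! i) *
      (\<Prod>j<?m. \<Prod>i<?n + j. ys ! j - (xs @ ys) ! i)"
    unfolding list_vandermonde_def length_append prod_add_split
    by (intro arg_cong2[of _ _ _ _ "(*)"] prod.cong refl) (auto simp: nth_append)
  also have "(\<Prod>j<?m. \<Prod>i<?n + j. ys ! j - (xs @ ys) ! i)
      = (\<Prod>j<?m. (\<Prod>i<?n. ys ! j - xs ! i) * (\<Prod>i<j. ys ! j - ys ! i))"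
    unfolding prod_add_split by (intro arg_cong2[of _ _ _ _ "(*)"] prod.cong refl) (auto simp: nth_append)
  also have "\<dots> = (\<Prod>j<?m. \<Prod>i<?n. ys ! j - xs ! i) * list_vandermonde ys"
    by (simp add: prod.distrib list_vandermonde_def)
  also have "(\<Prod>j<?m. \<Prod>i<?n. ys ! j - xs ! i) = (\<Prod>i<?n. \<Prod>j<?m. ys ! j - xs ! i)"
    by (rule prod.swap)
  also have "\<dots> = (\<Prod>x\<leftarrow>xs. \<Prod>y\<leftarrow>ys. y - x)"
    by (simp add: prod.list_conv_set_nth lessThan_atLeast0)
  finally show ?thesis by (simp add: list_vandermonde_def mult_ac)
qed

text \<open>
  Summing over all orderings makes the quotient of alternants a function of the set of variables.
\<close>

definition ordered_term :: "(nat \<Rightarrow> int) \<Rightarrow> complex list \<Rightarrow> complex" where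
  "ordered_term e ys = (\<Prod>k<length ys. ys ! k powi e k) / list_vandermonde ys"

definition alternant_ratio :: "(nat \<Rightarrow> int) \<Rightarrow> complex set \<Rightarrow> complex" where
  "alternant_ratio e X = (\<Sum>ys\<in>permutations_of_set X. ordered_term e ys)"

text \<open>The sign in the Leibniz formula is the one by which the Vandermonde determinant changes
  under the same reordering, so dividing each term by the Vandermonde determinant of its own
  ordering absorbs it.\<close>

lemma alternant_ratio_eq:
  assumes xs: "distinct xs" "length xs = n"
  shows "int_alternant n e (nth xs) / power_alternant n (\<lambda>k. k) (nth xs) = alternant_ratio e (set xs)"
proof -
  define f where "f p = map (\<lambda>k. xs ! p k) [0..<n]" for p :: "nat \<Rightarrow> nat"
  have f_permute: "f p = permute_list p xs" for p
    by (simp add: f_def permute_list_def xs)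
  have bij: "bij_betw f {p. p permutes {0..<n}} (permutations_of_set (set xs))"
  proof (rule bij_betw_imageI)
    show "inj_on f {p. p permutes {0..<n}}"
    proof (rule inj_onI, rule ext)
      fix p q k assume pq: "p \<in> {p. p permutes {0..<n}}" "q \<in> {p. p permutes {0..<n}}" "f p = f q"
      show "p k = q k"
      proof (cases "k < n")
        case True
        then have "p k < n" "q k < n"
          using pq permutes_in_image[of p "{0..<n}" k] permutes_in_image[of q "{0..<n}" k] by auto
        moreover have "xs ! p k = xs ! q k"
          using arg_cong[OF pq(3), of "\<lambda>ys. ys ! k"] True by (simp add: f_def)
        ultimately show ?thesis using xs by (simp add: nth_eq_iff_index_eq)
      next
        case False
        then show ?thesis using pq by (auto dest!: permutes_not_in[where x = k])
      qed
    qed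
    show "f ` {p. p permutes {0..<n}} = permutations_of_set (set xs)"
    proof (intro equalityI subsetI)
      fix ys assume "ys \<in> f ` {p. p permutes {0..<n}}"
      then obtain p where p: "p permutes {0..<n}" "ys = permute_list p xs" by (auto simp: f_permute)
      then have "p permutes {..<length xs}" by (simp add: xs lessThan_atLeast0)
      then show "ys \<in> permutations_of_set (set xs)"
        using p xs by (auto simp: permutations_of_set_def)
    next
      fix ys assume "ys \<in> permutations_of_set (set xs)"
      then have "mset ys = mset xs"
        using xs by (auto simp: permutations_of_set_def set_eq_iff_mset_eq_distinct)
      then obtain p where "p permutes {..<length xs}" "permute_list p xs = ys"
        by (rule mset_eq_permutation)
      then show "ys \<in> f ` {p. p permutes {0..<n}}"
        by (auto simp: f_permute xs lessThan_atLeast0 intro!: image_eqI[of _ _ p])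
    qed
  qed
  have each: "ordered_term e (f p) = signof p * (\<Prod>k=0..<n. xs ! p k powi e k) / power_alternant n (\<lambda>k. k) (nth xs)"
    if p: "p permutes {0..<n}" for p
  proof -
    have "list_vandermonde (f p) = power_alternant n (\<lambda>k. k) (\<lambda>j. xs ! p j)"
      unfolding list_vandermonde_eq by (auto simp: f_def intro!: power_alternant_cong)
    also have "\<dots> = signof p * power_alternant n (\<lambda>k. k) (nth xs)"
      by (rule vandermonde_permute[OF p])
    finally have "ordered_term e (f p) = (\<Prod>k=0..<n. xs ! p k powi e k) / (signof p * power_alternant n (\<lambda>k. k) (nth xs))"
      by (simp add: ordered_term_def f_def lessThan_atLeast0)
    moreover have "sign p = 1 \<or> sign p = - 1" by (rule sign_cases[of p]) simp_all
    ultimately show ?thesis by (elim disjE) simp_all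
  qed
  have "alternant_ratio e (set xs) = (\<Sum>p | p permutes {0..<n}. ordered_term e (f p))"
    unfolding alternant_ratio_def by (rule sum.reindex_bij_betw[OF bij, symmetric])
  also have "\<dots> = (\<Sum>p | p permutes {0..<n}. signof p * (\<Prod>k=0..<n. xs ! p k powi e k) / power_alternant n (\<lambda>k. k) (nth xs))"
    by (intro sum.cong refl each) simp
  also have "\<dots> = (\<Sum>p | p permutes {0..<n}. signof p * (\<Prod>k=0..<n. xs ! p k powi e k)) / power_alternant n (\<lambda>k. k) (nth xs)"
    by (rule sum_divide_distrib[symmetric])
  also have "(\<Sum>p | p permutes {0..<n}. signof p * (\<Prod>k=0..<n. xs ! p k powi e k)) = int_alternant n e (nth xs)"
    unfolding int_alternant_def
    by (subst mat_det_left_def[of _ n]) (auto intro!: sum.cong prod.cong dest: permutes_in_image)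
  finally show ?thesis by simp
qed

lemma prod_list_distinct: "distinct xs \<Longrightarrow> (\<Prod>x\<leftarrow>xs. f x) = (\<Prod>x\<in>set xs. f x)" for f :: "'b \<Rightarrow> complex"
  by (induction xs) auto

text \<open>Laplace expansion in quotient form: every ordering of \<open>T\<close> is cut after
  \<open>a\<close> entries, and its Vandermonde determinant is that of the two pieces times the
  differences across the cut.\<close>

lemma alternant_ratio_split:
  assumes T: "finite T" "card T = a + b"
  shows "alternant_ratio e T = (\<Sum>S | S \<subseteq> T \<and> card S = a.
    alternant_ratio e S * alternant_ratio (\<lambda>k. e (a + k)) (T - S) / (\<Prod>x\<in>S. \<Prod>y\<in>T - S. y - x))"
proof -
  define J where "J = (SIGMA S:{S. S \<subseteq> T \<and> card S = a}. permutations_of_set S \<times> permutations_of_set (T - S))"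
  have fin: "finite S" if "S \<subseteq> T" for S using that T(1) finite_subset by blast
  have bij: "bij_betw (\<lambda>(S, us, vs). us @ vs) J (permutations_of_set T)"
  proof (rule bij_betw_byWitness[where f' = "\<lambda>ys. (set (take a ys), take a ys, drop a ys)"])
    show "\<forall>x\<in>J. (\<lambda>ys. (set (take a ys), take a ys, drop a ys)) ((\<lambda>(S, us, vs). us @ vs) x) = x"
      using fin by (auto simp: J_def permutations_of_set_def distinct_card[symmetric])
    show "\<forall>ys\<in>permutations_of_set T. (\<lambda>(S, us, vs). us @ vs) (set (take a ys), take a ys, drop a ys) = ys"
      by simp
    show "(\<lambda>(S, us, vs). us @ vs) ` J \<subseteq> permutations_of_set T"
      by (auto simp: J_def permutations_of_set_def)
    show "(\<lambda>ys. (set (take a ys), take a ys, drop a ys)) ` permutations_of_set T \<subseteq> J"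
    proof
      fix x assume "x \<in> (\<lambda>ys. (set (take a ys), take a ys, drop a ys)) ` permutations_of_set T"
      then obtain ys where ys: "distinct ys" "set ys = T" "x = (set (take a ys), take a ys, drop a ys)"
        by (auto simp: permutations_of_set_def)
      have len: "length ys = a + b" using ys T by (metis distinct_card)
      have "T = set (take a ys) \<union> set (drop a ys)" unfolding ys(2)[symmetric] set_append[symmetric] by simp
      moreover have "set (take a ys) \<inter> set (drop a ys) = {}"
        using ys(1) by (metis append_take_drop_id distinct_append)
      ultimately have "T - set (take a ys) = set (drop a ys)" by auto
      moreover have "card (set (take a ys)) = a" using ys(1) len by (simp add: distinct_card)
      moreover have "set (take a ys) \<subseteq> T" using ys(2) set_take_subset by metis
      ultimately show "x \<in> J" using ys by (auto simp: J_def permutations_of_set_def)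
    qed
  qed
  have each: "ordered_term e (us @ vs) = ordered_term e us * ordered_term (\<lambda>k. e (a + k)) vs / (\<Prod>x\<in>S. \<Prod>y\<in>T - S. y - x)"
    if "S \<subseteq> T" "card S = a" "us \<in> permutations_of_set S" "vs \<in> permutations_of_set (T - S)" for S us vs
  proof -
    have u: "distinct us" "set us = S" "length us = a" and v: "distinct vs" "set vs = T - S"
      using that by (auto simp: permutations_of_set_def distinct_card)
    have "(\<Prod>k<length (us @ vs). (us @ vs) ! k powi e k) = (\<Prod>k<length us. us ! k powi e k) * (\<Prod>k<length vs. vs ! k powi e (a + k))"
      unfolding length_append prod_add_split u(3)
      by (intro arg_cong2[of _ _ _ _ "(*)"] prod.cong refl) (auto simp: nth_append u(3))
    moreover have "(\<Prod>x\<leftarrow>us. \<Prod>y\<leftarrow>vs. y - x) = (\<Prod>x\<in>S. \<Prod>y\<in>T - S. y - x)"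
      using u v by (simp add: prod_list_distinct)
    ultimately show ?thesis
      by (simp add: ordered_term_def list_vandermonde_append)
  qed
  have "alternant_ratio e T = (\<Sum>(S, us, vs)\<in>J. ordered_term e (us @ vs))"
    unfolding alternant_ratio_def using sum.reindex_bij_betw[OF bij, of "ordered_term e"]
    by (simp add: case_prod_unfold)
  also have "\<dots> = (\<Sum>(S, us, vs)\<in>J. ordered_term e us * ordered_term (\<lambda>k. e (a + k)) vs / (\<Prod>x\<in>S. \<Prod>y\<in>T - S. y - x))"
    by (intro sum.cong refl) (auto simp: J_def each)
  also have "\<dots> = (\<Sum>S | S \<subseteq> T \<and> card S = a. \<Sum>(us, vs)\<in>permutations_of_set S \<times> permutations_of_set (T - S).
      ordered_term e us * ordered_term (\<lambda>k. e (a + k)) vs / (\<Prod>x\<in>S. \<Prod>y\<in>T - S. y - x))"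
    unfolding J_def using T(1) by (subst sum.Sigma) (auto simp: case_prod_unfold)
  also have "\<dots> = (\<Sum>S | S \<subseteq> T \<and> card S = a.
    alternant_ratio e S * alternant_ratio (\<lambda>k. e (a + k)) (T - S) / (\<Prod>x\<in>S. \<Prod>y\<in>T - S. y - x))"
    unfolding alternant_ratio_def sum_product
    by (intro sum.cong refl) (simp add: sum.cartesian_product sum_divide_distrib case_prod_unfold)
  finally show ?thesis .
qed

lemma initial_segment:
  fixes N :: nat
  assumes "\<And>i k. i < k \<Longrightarrow> k < N \<Longrightarrow> P k \<Longrightarrow> P i"
  shows "{i. i < N \<and> P i} = {..<card {i. i < N \<and> P i}}"
  using assms
proof (induction N)
  case (Suc N)
  show ?case
  proof (cases "P N")
    case True
    then have "{i. i < Suc N \<and> P i} = {..<Suc N}"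
      using Suc.prems[of _ N] by (auto simp: less_Suc_eq)
    then show ?thesis by simp
  next
    case False
    then have "{i. i < Suc N \<and> P i} = {i. i < N \<and> P i}" by (auto simp: less_Suc_eq)
    then show ?thesis using Suc by simp
  qed
qed simp

section \<open>Schur functions of conjugate partitions as alternant ratios\<close>

text \<open>The sign of the reversal of \<open>n\<close> points, in the double-product form of
  \<open>sign_eq_prod\<close>.\<close>

definition reversal_sign :: "nat \<Rightarrow> complex" where
  "reversal_sign n = (\<Prod>j<n. \<Prod>i<j. - 1)"

lemma reversal_sign_square: "reversal_sign n * reversal_sign n = 1"
  unfolding reversal_sign_def prod.distrib[symmetric] by simp

lemma int_alternant_shift_powi:
  assumes y: "\<And>j. j < n \<Longrightarrow> y j \<noteq> 0"
  shows "int_alternant n (\<lambda>k. c + e k) y = (\<Prod>j<n. y j powi c) * int_alternant n e y"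
proof -
  have "int_alternant n (\<lambda>k. c + e k) y
      = Determinant.det (mat\<^sub>r n n (\<lambda>j. y j powi c \<cdot>\<^sub>v Matrix.vec n (\<lambda>k. y j powi e k)))"
    unfolding int_alternant_def
    by (intro arg_cong[of _ _ Determinant.det] eq_matI) (auto simp: power_int_add y)
  also have "\<dots> = (\<Prod>j=0..<n. y j powi c) * Determinant.det (mat\<^sub>r n n (\<lambda>j. Matrix.vec n (\<lambda>k. y j powi e k)))"
    by (rule Determinant.det_rows_mul) auto
  also have "mat\<^sub>r n n (\<lambda>j. Matrix.vec n (\<lambda>k. y j powi e k)) = Matrix.mat n n (\<lambda>(j, k). y j powi e k)"
    by (intro eq_matI) auto
  finally show ?thesis by (simp add: int_alternant_def lessThan_atLeast0)
qed

lemma int_alternant_scale_cols: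
  "Determinant.det (Matrix.mat n n (\<lambda>(j, k). c k * (y j :: complex) powi e k)) = (\<Prod>k<n. c k) * int_alternant n e y"
proof -
  have "Determinant.det (Matrix.mat n n (\<lambda>(j, k). c k * y j powi e k))
      = Determinant.det (transpose_mat (mat\<^sub>r n n (\<lambda>k. c k \<cdot>\<^sub>v Matrix.vec n (\<lambda>j. y j powi e k))))"
    by (intro arg_cong[of _ _ Determinant.det] eq_matI) auto
  also have "\<dots> = Determinant.det (mat\<^sub>r n n (\<lambda>k. c k \<cdot>\<^sub>v Matrix.vec n (\<lambda>j. y j powi e k)))"
    by (rule Determinant.det_transpose) auto
  also have "\<dots> = (\<Prod>k=0..<n. c k) * Determinant.det (mat\<^sub>r n n (\<lambda>k. Matrix.vec n (\<lambda>j. y j powi e k)))"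
    by (rule Determinant.det_rows_mul) auto
  also have "Determinant.det (mat\<^sub>r n n (\<lambda>k. Matrix.vec n (\<lambda>j. y j powi e k)))
      = Determinant.det (transpose_mat (mat\<^sub>r n n (\<lambda>k. Matrix.vec n (\<lambda>j. y j powi e k))))"
    by (rule Determinant.det_transpose[symmetric]) auto
  also have "transpose_mat (mat\<^sub>r n n (\<lambda>k. Matrix.vec n (\<lambda>j. y j powi e k))) = Matrix.mat n n (\<lambda>(j, k). y j powi e k)"
    by (intro eq_matI) auto
  finally show ?thesis by (simp add: int_alternant_def lessThan_atLeast0)
qed

lemma int_alternant_uminus:
  "int_alternant n e (\<lambda>j. - y j) = (\<Prod>k<n. (- 1) powi e k) * int_alternant n e y"
proof -
  have "int_alternant n e (\<lambda>j. - y j) = Determinant.det (Matrix.mat n n (\<lambda>(j, k). (- 1) powi e k * y j powi e k))"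
    unfolding int_alternant_def
    by (intro arg_cong[of _ _ Determinant.det] eq_matI)
       (auto simp: power_int_mult_distrib[symmetric])
  then show ?thesis by (simp only: int_alternant_scale_cols)
qed

lemma int_alternant_inverse: "int_alternant n e (\<lambda>j. inverse (y j)) = int_alternant n (\<lambda>k. - e k) y"
  unfolding int_alternant_def
  by (intro arg_cong[of _ _ Determinant.det] eq_matI) (auto simp: power_int_minus power_int_inverse)

text \<open>These are the exponents in the denominator of the Schur function; dividing an
  \<open>alternant_ratio\<close> by this sign therefore gives the Schur normalization.\<close>

lemma alternant_ratio_staircase:
  assumes X: "finite X" "card X = n"
  shows "alternant_ratio (\<lambda>k. int n - 1 - int k) X = reversal_sign n"
proof -
  obtain xs where xs: "set xs = X" "distinct xs" using X(1) finite_distinct_list by blast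
  then have len: "length xs = n" using X by (metis distinct_card)
  define p where "p k = (if k < n then n - 1 - k else k)" for k
  have "bij_betw p {0..<n} {0..<n}"
    by (rule bij_betw_byWitness[where f' = p]) (auto simp: p_def)
  then have p: "p permutes {0..<n}"
    by (rule bij_imp_permutes) (auto simp: p_def)
  have "int_alternant n (\<lambda>k. int n - 1 - int k) (nth xs) = int_alternant n (\<lambda>k. int (p k)) (nth xs)"
    by (rule int_alternant_cong) (auto simp: p_def of_nat_diff)
  also have "\<dots> = signof p * power_alternant n (\<lambda>k. k) (nth xs)"
    unfolding power_alternant_eq_int by (rule int_alternant_permute[OF p])
  also have "signof p = reversal_sign n"
    unfolding sign_eq_prod[OF p] reversal_sign_def
    by (intro prod.cong refl) (auto simp: p_def)
  finally have "alternant_ratio (\<lambda>k. int n - 1 - int k) X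
      = reversal_sign n * power_alternant n (\<lambda>k. k) (nth xs) / power_alternant n (\<lambda>k. k) (nth xs)"
    using alternant_ratio_eq[OF xs(2) len, of "\<lambda>k. int n - 1 - int k"] xs(1) by simp
  moreover have "power_alternant n (\<lambda>k. k) (nth xs) \<noteq> 0"
    using list_vandermonde_nz[OF xs(2)] by (simp add: list_vandermonde_eq len)
  ultimately show ?thesis by simp
qed

text \<open>Inversion negates exponents. Pulling out \<open>P + n - 1\<close> in the numerator and
  \<open>n - 1\<close> in the denominator leaves the exponents of a Schur function in
  \<open>D\<close>, and the two shifts differ by the power \<open>P\<close> of each inverse.\<close>

lemma alternant_ratio_inverse:
  assumes D: "finite D" "card D = n" "0 \<notin> D"
  shows "alternant_ratio (\<lambda>k. int P + int k - int (\<nu> k)) (inverse ` D)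
    = (\<Prod>d\<in>D. inverse d ^ P) * (alternant_ratio (\<lambda>k. int n - 1 - int k + int (\<nu> k)) D / reversal_sign n)"
proof -
  obtain ds where ds: "set ds = D" "distinct ds" using D(1) finite_distinct_list by blast
  then have len: "length ds = n" using D by (metis distinct_card)
  define es where "es = map inverse ds"
  have es: "set es = inverse ` D" "distinct es" "length es = n"
    using ds len by (auto simp: es_def distinct_map inj_on_def)
  have nz: "ds ! j \<noteq> 0" if "j < n" for j using that D(3) ds(1) len nth_mem by metis
  have esn: "int_alternant n e (nth es) = int_alternant n (\<lambda>k. - e k) (nth ds)" for e
    unfolding int_alternant_inverse[symmetric] by (rule int_alternant_cong) (auto simp: es_def len)
  let ?V = "int_alternant n (\<lambda>k. int n - 1 - int k) (nth ds)"
  have V: "?V = reversal_sign n * power_alternant n (\<lambda>k. k) (nth ds)"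
    using alternant_ratio_eq[OF ds(2) len, of "\<lambda>k. int n - 1 - int k"] alternant_ratio_staircase[OF D(1,2)]
      list_vandermonde_nz[OF ds(2)] by (simp add: ds(1) list_vandermonde_eq len field_simps)
  have pnz: "power_alternant n (\<lambda>k. k) (nth ds) \<noteq> 0"
    using list_vandermonde_nz[OF ds(2)] by (simp add: list_vandermonde_eq len)
  have rnz: "reversal_sign n \<noteq> 0" using reversal_sign_square[of n] by auto
  have sh: "(\<Prod>j<n. ds ! j powi c) * int_alternant n e (nth ds) = int_alternant n (\<lambda>k. c + e k) (nth ds)" for c e
    by (rule int_alternant_shift_powi[symmetric]) (rule nz)
  have num: "int_alternant n (\<lambda>k. int P + int k - int (\<nu> k)) (nth es)
      = (\<Prod>j<n. ds ! j powi (- (int P + int n - 1))) * int_alternant n (\<lambda>k. int n - 1 - int k + int (\<nu> k)) (nth ds)"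
    unfolding esn sh by (rule int_alternant_cong) auto
  have den: "power_alternant n (\<lambda>k. k) (nth es) = (\<Prod>j<n. ds ! j powi (- (int n - 1))) * ?V"
    unfolding power_alternant_eq_int esn sh by (rule int_alternant_cong) auto
  have "alternant_ratio (\<lambda>k. int P + int k - int (\<nu> k)) (inverse ` D)
      = ((\<Prod>j<n. ds ! j powi (- (int P + int n - 1))) / (\<Prod>j<n. ds ! j powi (- (int n - 1)))) *
        (int_alternant n (\<lambda>k. int n - 1 - int k + int (\<nu> k)) (nth ds) / ?V)"
    using alternant_ratio_eq[OF es(2,3), of "\<lambda>k. int P + int k - int (\<nu> k)"] unfolding num den es(1) by simp
  also have "(\<Prod>j<n. ds ! j powi (- (int P + int n - 1))) / (\<Prod>j<n. ds ! j powi (- (int n - 1))) = (\<Prod>j<n. inverse (ds ! j) ^ P)"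
    unfolding prod_dividef[symmetric]
  proof (intro prod.cong refl)
    fix j assume "j \<in> {..<n}"
    then have "ds ! j \<noteq> 0" using nz by simp
    then have "ds ! j powi (- (int P + int n - 1)) / ds ! j powi (- (int n - 1)) = ds ! j powi (- int P)"
      by (subst power_int_diff[symmetric]) auto
    then show "ds ! j powi (- (int P + int n - 1)) / ds ! j powi (- (int n - 1)) = inverse (ds ! j) ^ P"
      by (simp add: power_int_minus power_inverse)
  qed
  also have "\<dots> = (\<Prod>d\<in>D. inverse d ^ P)"
    using prod_list_distinct[OF ds(2), of "\<lambda>d. inverse d ^ P"] by (simp add: prod.list_conv_set_nth len ds(1) lessThan_atLeast0)
  also have "int_alternant n (\<lambda>k. int n - 1 - int k + int (\<nu> k)) (nth ds) / ?V
      = alternant_ratio (\<lambda>k. int n - 1 - int k + int (\<nu> k)) D / reversal_sign n"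
    using alternant_ratio_eq[OF ds(2) len, of "\<lambda>k. int n - 1 - int k + int (\<nu> k)"] pnz rnz
    unfolding V ds(1) by (simp add: field_simps)
  finally show ?thesis .
qed

lemma fold_max_less: "k < fold max xs a \<longleftrightarrow> k < a \<or> (\<exists>x\<in>set xs. k < x)" for k a :: nat
  by (induction xs arbitrary: a) (auto simp: less_max_iff_disj)

text \<open>Past the end of the list the default value 0 agrees with the counting formula, which can
  then be used for every \<open>k\<close>.\<close>

lemma conj_partition_nth:
  "(if k < length (conj_partition \<rho>) then conj_partition \<rho> ! k else 0) = card {i. i < length \<rho> \<and> k < \<rho> ! i}"
proof (cases "k < fold max \<rho> 0")
  case False
  then have "{i. i < length \<rho> \<and> k < \<rho> ! i} = {}"
    unfolding fold_max_less using nth_mem by blast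
  then have "card {i. i < length \<rho> \<and> k < \<rho> ! i} = 0" by (simp only: card.empty)
  then show ?thesis using False by (simp add: conj_partition_def)
qed (simp add: conj_partition_def)

lemma part_length_conj_partition: "part_length (conj_partition \<rho>) = fold max \<rho> 0"
proof -
  have "0 < card {i. i < length \<rho> \<and> j < \<rho> ! i}" if "j < fold max \<rho> 0" for j
    using that unfolding fold_max_less by (auto simp: card_gt_0_iff in_set_conv_nth)
  then have "filter (\<lambda>r. 0 < r) (conj_partition \<rho>) = conj_partition \<rho>"
    unfolding conj_partition_def by (intro filter_True) auto
  then show ?thesis by (simp add: part_length_def conj_partition_def)
qed

text \<open>The largest part of the partition is the length of its conjugate, which decides the
  vanishing case. Otherwise the variables are distinct, so \<open>schur\<close> is an honest
  quotient, and negating them extracts a sign from each exponent.\<close>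

lemma schur_partition_conj:
  fixes \<rho> :: "nat list"
  assumes X: "finite X" "card X = n"
  defines "\<mu> k \<equiv> card {i. i < length \<rho> \<and> k < \<rho> ! i}"
  shows "schur_partition (conj_partition \<rho>) (image_mset uminus (mset_set X)) =
    (if \<exists>r\<in>set \<rho>. n < r then 0
     else (\<Prod>k<n. (- 1) ^ \<mu> k) * (alternant_ratio (\<lambda>k. int n - 1 - int k + int (\<mu> k)) X / reversal_sign n))"
proof -
  define E where "E = image_mset uminus (mset_set X)"
  have sizeE: "size E = n" using X by (simp add: E_def)
  have long: "part_length (conj_partition \<rho>) > n \<longleftrightarrow> (\<exists>r\<in>set \<rho>. n < r)"
    unfolding part_length_conj_partition fold_max_less by simp
  obtain xs where xs: "mset xs = E" "enum_mset E = nth xs"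
    unfolding enum_mset_def using someI_ex[OF ex_mset[of E]] by blast
  define ys where "ys = map uminus xs"
  have ys: "mset ys = mset_set X"
    unfolding ys_def mset_map xs(1) E_def by (simp add: image_mset.compositionality o_def)
  have dist: "distinct ys" by (rule mset_eq_mset_set_imp_distinct[OF X(1) ys[symmetric]])
  have set: "set ys = X" using arg_cong[OF ys, of set_mset] X(1) by simp
  have len: "length ys = n" using arg_cong[OF ys, of size] X by simp
  have xn: "xs ! j = - (ys ! j)" if "j < n" for j using that len by (simp add: ys_def)
  have alt: "int_alternant n e (nth xs) = (\<Prod>k<n. (- 1) powi e k) * (power_alternant n (\<lambda>k. k) (nth ys) * alternant_ratio e X)" for e
  proof -
    have "int_alternant n e (nth xs) = int_alternant n e (\<lambda>j. - (ys ! j))"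
      by (rule int_alternant_cong) (auto simp: xn)
    also have "\<dots> = (\<Prod>k<n. (- 1) powi e k) * int_alternant n e (nth ys)" by (rule int_alternant_uminus)
    also have "int_alternant n e (nth ys) = power_alternant n (\<lambda>k. k) (nth ys) * alternant_ratio e X"
      using alternant_ratio_eq[OF dist len, of e] list_vandermonde_nz[OF dist] by (simp add: set list_vandermonde_eq len field_simps)
    finally show ?thesis .
  qed
  have pnz: "power_alternant n (\<lambda>k. k) (nth ys) \<noteq> 0"
    using list_vandermonde_nz[OF dist] by (simp add: list_vandermonde_eq len)
  have rnz: "reversal_sign n \<noteq> 0" using reversal_sign_square[of n] by auto
  have m1: "(\<Prod>k<n. (- 1 :: complex) powi (int n - 1 - int k)) \<noteq> 0" by simp
  have vdm: "alternant n (\<lambda>_. 0) (nth xs) = (\<Prod>k<n. (- 1) powi (int n - 1 - int k)) * (power_alternant n (\<lambda>k. k) (nth ys) * reversal_sign n)"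
    unfolding alternant_eq_int_alternant alt by (simp add: alternant_ratio_staircase[OF X])
  have vnz: "alternant n (\<lambda>_. 0) (nth xs) \<noteq> 0"
    unfolding vdm using pnz rnz m1 by simp
  have "schur n (\<lambda>k. if k < length (conj_partition \<rho>) then int (conj_partition \<rho> ! k) else 0) (nth xs)
      = alternant n (\<lambda>k. int (\<mu> k)) (nth xs) / alternant n (\<lambda>_. 0) (nth xs)"
  proof -
    have "(\<lambda>k. if k < length (conj_partition \<rho>) then int (conj_partition \<rho> ! k) else 0) = (\<lambda>k. int (\<mu> k))"
      unfolding \<mu>_def conj_partition_nth[symmetric] by auto
    then show ?thesis using vnz by (simp add: schur_def Let_def)
  qed
  also have "\<dots> = (\<Prod>k<n. (- 1) ^ \<mu> k) * (alternant_ratio (\<lambda>k. int n - 1 - int k + int (\<mu> k)) X / reversal_sign n)"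
  proof -
    have "(\<Prod>k<n. (- 1 :: complex) powi (int n - 1 - int k + int (\<mu> k))) = (\<Prod>k<n. (- 1) powi (int n - 1 - int k)) * (\<Prod>k<n. (- 1) ^ \<mu> k)"
      by (simp add: power_int_add prod.distrib)
    then show ?thesis
      unfolding vdm alternant_eq_int_alternant[of n "\<lambda>k. int (\<mu> k)"] alt using pnz rnz m1 by simp
  qed
  finally show ?thesis
    unfolding schur_partition_def E_def[symmetric] sizeE long xs(2) by simp
qed

section \<open>Coefficient determinants of the polynomial with roots in A and 1/B\<close>

lemma coeff_det_smult: "coeff_det m (Polynomial.smult c q) s = c ^ m * coeff_det m q s"
proof -
  have "coeff_det m (Polynomial.smult c q) s = Determinant.det (c \<cdot>\<^sub>m Matrix.mat m m (\<lambda>(a, k). coeff (monom 1 k * q) (s a)))"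
    unfolding coeff_det_def by (intro arg_cong[of _ _ Determinant.det] eq_matI) auto
  then show ?thesis by (simp add: coeff_det_def)
qed

text \<open>Up to transposition the entries agree: a negative index on the left corresponds to a
  coefficient below the power that multiplies the polynomial on the right.\<close>

lemma moment_det_eq_coeff_det:
  assumes "\<And>k. k < length lam \<Longrightarrow> int (size A) + int k - lam ! k = int (s k)"
  shows "moment_det lam A B = coeff_det (length lam) (moment_poly A B) s"
proof -
  let ?N = "length lam"
  have "moment_det lam A B = Determinant.det (transpose_mat (Matrix.mat ?N ?N (\<lambda>(a, k). coeff (monom 1 k * moment_poly A B) (s a))))"
    unfolding moment_det_def
  proof (intro arg_cong[of _ _ Determinant.det] eq_matI)
    fix j k assume "j < dim_row (transpose_mat (Matrix.mat ?N ?N (\<lambda>(a, k). coeff (monom 1 k * moment_poly A B) (s a))))"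
      "k < dim_col (transpose_mat (Matrix.mat ?N ?N (\<lambda>(a, k). coeff (monom 1 k * moment_poly A B) (s a))))"
    then have jk: "j < ?N" "k < ?N" by auto
    have e: "int k - int j - lam ! k + int (size A) = int (s k) - int j"
      using assms[OF jk(2)] by simp
    have "moment_coeff A B (int k - int j - lam ! k) = coeff (monom 1 j * moment_poly A B) (s k)"
      unfolding moment_coeff_def e by (simp add: coeff_monom_mult nat_diff_distrib')
    then show "Matrix.mat ?N ?N (\<lambda>(j, k). moment_coeff A B (int k - int j - lam ! k)) $$ (j, k)
        = transpose_mat (Matrix.mat ?N ?N (\<lambda>(a, k). coeff (monom 1 k * moment_poly A B) (s a))) $$ (j, k)"
      using jk by simp
  qed auto
  also have "\<dots> = coeff_det ?N (moment_poly A B) s"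
    unfolding coeff_det_def by (rule Determinant.det_transpose) auto
  finally show ?thesis .
qed

lemma moment_poly_eq_root_poly:
  assumes A: "finite A" and B: "finite B" "0 \<notin> B" and disj: "A \<inter> inverse ` B = {}"
    and ts: "set ts = A \<union> inverse ` B" "distinct ts"
  shows "moment_poly (mset_set A) (mset_set B) = Polynomial.smult (\<Prod>b\<in>B. - b) (root_poly (length ts) (nth ts))"
proof -
  have "root_poly (length ts) (nth ts) = (\<Prod>x\<in>A \<union> inverse ` B. [:- x, 1:])"
  proof -
    have "(\<Prod>x\<leftarrow>ts. [:- x, 1:]) = (\<Prod>x\<in>set ts. [:- x, 1:])"
      using ts(2) by (induction ts) auto
    then show ?thesis by (simp add: root_poly_nth ts(1))
  qed
  also have "\<dots> = (\<Prod>x\<in>A. [:- x, 1:]) * (\<Prod>x\<in>inverse ` B. [:- x, 1:])"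
    using A B disj by (intro prod.union_disjoint) auto
  also have "(\<Prod>x\<in>inverse ` B. [:- x, 1:]) = (\<Prod>b\<in>B. [:- inverse b, 1:])"
    by (subst prod.reindex) (auto simp: inj_on_def)
  finally have "Polynomial.smult (\<Prod>b\<in>B. - b) (root_poly (length ts) (nth ts))
      = (\<Prod>x\<in>A. [:- x, 1:]) * Polynomial.smult (\<Prod>b\<in>B. - b) (\<Prod>b\<in>B. [:- inverse b, 1:])"
    by simp
  also have "Polynomial.smult (\<Prod>b\<in>B. - b) (\<Prod>b\<in>B. [:- inverse b, 1:]) = (\<Prod>b\<in>B. [:1, - b:])"
  proof -
    have "Polynomial.smult (\<Prod>b\<in>B. - b) (\<Prod>b\<in>B. [:- inverse b, 1:]) = (\<Prod>b\<in>B. Polynomial.smult (- b) [:- inverse b, 1:])"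
      by (simp only: prod_smult)
    also have "\<dots> = (\<Prod>b\<in>B. [:1, - b:])"
    proof (rule prod.cong)
      fix b assume "b \<in> B"
      then have "b \<noteq> 0" using B(2) by blast
      then show "Polynomial.smult (- b) [:- inverse b, 1:] = [:1, - b:]" by simp
    qed simp
    finally show ?thesis .
  qed
  finally show ?thesis
    by (simp add: moment_poly_def prod_unfold_prod_mset)
qed

text \<open>
  The exponents complementary to \<open>a + k - \<lambda>\<^sub>k\<close> in \<open>{0..<a + b + N}\<close> are read off the conjugates of the
  positive and the negative part of \<open>\<lambda>\<close>.
\<close>

lemma complement_permutation:
  fixes lam :: "int list" and a b :: nat
  defines "N \<equiv> length lam"
  defines "\<mu> j \<equiv> card {i. i < N \<and> int j < lam ! i}"
  defines "\<nu> j \<equiv> card {i. i < N \<and> int j < - (lam ! i)}"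
  assumes dom: "dominant_weight lam" and bounds: "\<And>k. k < N \<Longrightarrow> lam ! k \<le> int a" "\<And>k. k < N \<Longrightarrow> - int b \<le> lam ! k"
  obtains p where "p permutes {0..<a + b + N}"
    "\<And>j. j < a \<Longrightarrow> int (p j) = int a - 1 - int j + int (\<mu> j)"
    "\<And>j. j < b \<Longrightarrow> int (p (a + j)) = int (a + N) + int j - int (\<nu> j)"
    "\<And>k. k < N \<Longrightarrow> int (p (a + b + k)) = int a + int k - lam ! k"
    "signof p = reversal_sign a * (\<Prod>j<a. (- 1) ^ \<mu> j) * (\<Prod>j<b. (- 1) ^ (N - \<nu> j))"
    "\<And>j. \<mu> j \<le> N" "\<And>j. \<nu> j \<le> N"
proof -
  have lam_mono: "lam ! k \<le> lam ! i" if "i \<le> k" "k < N" for i k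
    using dom that unfolding dominant_weight_def sorted_wrt_iff_nth_less N_def by (cases "i = k") auto
  have \<mu>_set: "{i. i < N \<and> int j < lam ! i} = {..<\<mu> j}" for j
    unfolding \<mu>_def
  proof (rule initial_segment)
    fix i k assume "i < k" "k < N" "int j < lam ! k"
    then show "int j < lam ! i" using lam_mono[of i k] by simp
  qed
  have \<mu>_iff: "int j < lam ! k \<longleftrightarrow> k < \<mu> j" if "k < N" for j k
    using \<mu>_set[of j] that by auto
  have \<mu>_le: "\<mu> j \<le> N" for j
    unfolding \<mu>_def using card_mono[of "{..<N}" "{i. i < N \<and> int j < lam ! i}"] by auto
  have \<nu>_le: "\<nu> j \<le> N" for j
    unfolding \<nu>_def using card_mono[of "{..<N}" "{i. i < N \<and> int j < - (lam ! i)}"] by auto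
  have \<nu>_iff: "int j < - (lam ! k) \<longleftrightarrow> N - \<nu> j \<le> k" if "k < N" for j k
  proof -
    have "{i. i < N \<and> \<not> int j < - (lam ! i)} = {..<card {i. i < N \<and> \<not> int j < - (lam ! i)}}"
    proof (rule initial_segment)
      fix i k assume "i < k" "k < N" "\<not> int j < - (lam ! k)"
      then show "\<not> int j < - (lam ! i)" using lam_mono[of i k] by simp
    qed
    moreover have "card {i. i < N \<and> \<not> int j < - (lam ! i)} = N - \<nu> j"
    proof -
      have "{i. i < N \<and> \<not> int j < - (lam ! i)} = {..<N} - {i. i < N \<and> int j < - (lam ! i)}" by auto
      then show ?thesis unfolding \<nu>_def by (simp only:) (subst card_Diff_subset, auto)
    qed
    ultimately have "k \<in> {i. i < N \<and> \<not> int j < - (lam ! i)} \<longleftrightarrow> k \<in> {..<N - \<nu> j}" by (simp only:)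
    then show ?thesis using that unfolding mem_Collect_eq lessThan_iff by linarith
  qed
  have \<mu>_mono: "\<mu> j \<le> \<mu> i" if "i \<le> j" for i j
    unfolding \<mu>_def using that by (intro card_mono) auto
  have \<nu>_mono: "\<nu> j \<le> \<nu> i" if "i \<le> j" for i j
    unfolding \<nu>_def using that by (intro card_mono) auto
  \<comment> \<open>No part of the weight is both positive and negative.\<close>
  have \<mu>\<nu>: "\<mu> i + \<nu> j \<le> N" for i j
  proof -
    have "\<mu> i + \<nu> j = card ({k. k < N \<and> int i < lam ! k} \<union> {k. k < N \<and> int j < - (lam ! k)})"
      unfolding \<mu>_def \<nu>_def by (subst card_Un_disjoint) auto
    also have "\<dots> \<le> card {..<N}" by (intro card_mono) auto
    finally show ?thesis by simp
  qed
  \<comment> \<open>Three blocks: the exponents of the Schur factor for the positive part, those for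
    the negative part after inversion of its variables, and the \<open>N\<close> exponents that
    occur in the coefficient determinant.\<close>
  define L where "L j = (if j < a then int a - 1 - int j + int (\<mu> j)
    else if j < a + b then int N + int j - int (\<nu> (j - a)) else int a + int (j - (a + b)) - lam ! (j - (a + b)))" for j
  have range: "0 \<le> L j \<and> L j < int (a + b + N)" if "j < a + b + N" for j
  proof -
    consider "j < a" | "a \<le> j" "j < a + b" | "a + b \<le> j" by linarith
    then show ?thesis
    proof cases
      case 1
      then show ?thesis using \<mu>_le[of j] by (simp add: L_def)
    next
      case 2
      then show ?thesis using \<nu>_le[of "j - a"] by (simp add: L_def)
    next
      case 3
      then have "j - (a + b) < N" using that by simp
      then show ?thesis using 3 bounds(1,2)[of "j - (a + b)"] by (simp add: L_def)
    qed
  qed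
  \<comment> \<open>The first block decreases, the other two increase, and the first lies below the
    second. So the inversions of \<open>p\<close> are all pairs within the first block and, against
    entry \<open>k\<close> of the last block, the pairs with \<open>k < \<mu> i\<close> or
    \<open>k < N - \<nu> i\<close>. The same comparisons show that no value repeats.\<close>
  have LL: "L i > L j" if "i < j" "j < a" for i j
    using that \<mu>_mono[of i j] by (simp add: L_def)
  have LU: "L i < L j" if "i < a" "a \<le> j" "j < a + b" for i j
    using that \<mu>\<nu>[of i "j - a"] by (simp add: L_def)
  have UU: "L i < L j" if "a \<le> i" "i < j" "j < a + b" for i j
  proof -
    have "\<nu> (j - a) \<le> \<nu> (i - a)" using that by (intro \<nu>_mono diff_le_mono) simp
    then show ?thesis using that by (simp add: L_def)
  qed
  have SS: "L i < L j" if "a + b \<le> i" "i < j" "j < a + b + N" for i j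
  proof -
    have "lam ! (j - (a + b)) \<le> lam ! (i - (a + b))" using that by (intro lam_mono diff_le_mono) auto
    then show ?thesis using that by (simp add: L_def)
  qed
  have LS: "L i < L (a + b + k) \<longleftrightarrow> \<mu> i \<le> k" "L i \<noteq> L (a + b + k)" if "i < a" "k < N" for i k
    using that \<mu>_iff[of k i] by (auto simp: L_def)
  have US: "L (a + i) < L (a + b + k) \<longleftrightarrow> N - \<nu> i \<le> k" "L (a + i) \<noteq> L (a + b + k)" if "i < b" "k < N" for i k
    using that \<nu>_iff[of k i] \<nu>_le[of i] by (auto simp: L_def)
  have neq: "L i \<noteq> L j" if "i < j" "j < a + b + N" for i j
  proof -
    consider "j < a" | "i < a" "a \<le> j" "j < a + b" | "a \<le> i" "j < a + b" | "i < a" "a + b \<le> j"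
      | "a \<le> i" "i < a + b" "a + b \<le> j" | "a + b \<le> i" by linarith
    then show ?thesis
    proof cases
      case 1
      then show ?thesis using LL[of i j] that by simp
    next
      case 2
      then show ?thesis using LU[of i j] by simp
    next
      case 3
      then show ?thesis using UU[of i j] that by simp
    next
      case 4
      then show ?thesis using LS(2)[of i "j - (a + b)"] that by simp
    next
      case 5
      then show ?thesis using US(2)[of "i - a" "j - (a + b)"] that by simp
    next
      case 6
      then show ?thesis using SS[of i j] that by simp
    qed
  qed
  define p where "p j = (if j < a + b + N then nat (L j) else j)" for j
  have pL: "int (p j) = L j" if "j < a + b + N" for j
    using range[OF that] that by (simp add: p_def)
  have "inj_on p {0..<a + b + N}"
  proof (rule linorder_inj_onI)
    fix i j assume "i < j" "i \<in> {0..<a + b + N}" "j \<in> {0..<a + b + N}"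
    then show "p i \<noteq> p j" using neq[of i j] pL[of i] pL[of j] by auto
  qed auto
  moreover have "p ` {0..<a + b + N} \<subseteq> {0..<a + b + N}"
  proof
    fix x assume "x \<in> p ` {0..<a + b + N}"
    then obtain j where "j < a + b + N" "x = p j" by auto
    then show "x \<in> {0..<a + b + N}" using range[of j] pL[of j] by simp
  qed
  ultimately have "bij_betw p {0..<a + b + N} {0..<a + b + N}"
    by (simp add: bij_betw_def endo_inj_surj)
  then have p: "p permutes {0..<a + b + N}"
    by (rule bij_imp_permutes) (auto simp: p_def)
  have less: "p i < p j \<longleftrightarrow> L i < L j" if "i < a + b + N" "j < a + b + N" for i j
    using pL[OF that(1)] pL[OF that(2)] by linarith
  let ?\<sigma> = "\<lambda>i j. if p i < p j then 1 else - 1 :: complex"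
  have sign_count: "(\<Prod>k<N. if c \<le> k then 1 else - 1 :: complex) = (- 1) ^ c" if "c \<le> N" for c
  proof -
    have "(\<Prod>k<N. if c \<le> k then 1 else - 1 :: complex) = (\<Prod>k<c. - 1)"
      using that by (intro prod.mono_neutral_cong_right) auto
    then show ?thesis by simp
  qed
  have "signof p = (\<Prod>j<a. \<Prod>i<j. ?\<sigma> i j) * (\<Prod>j<b. \<Prod>i<a + j. ?\<sigma> i (a + j)) * (\<Prod>k<N. \<Prod>i<a + b + k. ?\<sigma> i (a + b + k))"
    unfolding sign_eq_prod[OF p] prod_add_split[of _ "a + b"] prod_add_split[of _ a] ..
  also have "(\<Prod>j<a. \<Prod>i<j. ?\<sigma> i j) = reversal_sign a"
    unfolding reversal_sign_def
  proof (intro prod.cong refl)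
    fix j i assume "j \<in> {..<a}" "i \<in> {..<j}"
    then show "?\<sigma> i j = - 1" using LL[of i j] less[of i j] by simp
  qed
  also have "(\<Prod>j<b. \<Prod>i<a + j. ?\<sigma> i (a + j)) = 1"
  proof (intro prod.neutral ballI)
    fix j i assume ij: "j \<in> {..<b}" "i \<in> {..<a + j}"
    show "?\<sigma> i (a + j) = 1"
    proof (cases "i < a")
      case True
      then show ?thesis using ij LU[of i "a + j"] less[of i "a + j"] by simp
    next
      case False
      then show ?thesis using ij UU[of i "a + j"] less[of i "a + j"] by simp
    qed
  qed
  also have "(\<Prod>k<N. \<Prod>i<a + b + k. ?\<sigma> i (a + b + k)) =
      (\<Prod>k<N. (\<Prod>i<a. if \<mu> i \<le> k then 1 else - 1) * (\<Prod>i<b. if N - \<nu> i \<le> k then 1 else - 1))"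
  proof (intro prod.cong refl)
    fix k assume "k \<in> {..<N}"
    then have k: "k < N" by simp
    have "(\<Prod>i<a + b + k. ?\<sigma> i (a + b + k)) = (\<Prod>i<a. ?\<sigma> i (a + b + k)) * (\<Prod>i<b. ?\<sigma> (a + i) (a + b + k)) * (\<Prod>i<k. ?\<sigma> (a + b + i) (a + b + k))"
      unfolding prod_add_split[of _ "a + b"] prod_add_split[of _ a] ..
    also have "(\<Prod>i<k. ?\<sigma> (a + b + i) (a + b + k)) = 1"
    proof (intro prod.neutral ballI)
      fix i assume "i \<in> {..<k}"
      then show "?\<sigma> (a + b + i) (a + b + k) = 1"
        using SS[of "a + b + i" "a + b + k"] less[of "a + b + i" "a + b + k"] k by simp
    qed
    also have "(\<Prod>i<a. ?\<sigma> i (a + b + k)) = (\<Prod>i<a. if \<mu> i \<le> k then 1 else - 1)"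
    proof (intro prod.cong refl)
      fix i assume "i \<in> {..<a}"
      then show "?\<sigma> i (a + b + k) = (if \<mu> i \<le> k then 1 else - 1)"
        using LS(1)[of i k] less[of i "a + b + k"] k by simp
    qed
    also have "(\<Prod>i<b. ?\<sigma> (a + i) (a + b + k)) = (\<Prod>i<b. if N - \<nu> i \<le> k then 1 else - 1)"
    proof (intro prod.cong refl)
      fix i assume "i \<in> {..<b}"
      then show "?\<sigma> (a + i) (a + b + k) = (if N - \<nu> i \<le> k then 1 else - 1)"
        using US(1)[of i k] less[of "a + i" "a + b + k"] k by simp
    qed
    finally show "(\<Prod>i<a + b + k. ?\<sigma> i (a + b + k)) =
        (\<Prod>i<a. if \<mu> i \<le> k then 1 else - 1) * (\<Prod>i<b. if N - \<nu> i \<le> k then 1 else - 1)"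
      by (simp only: mult_1_right)
  qed
  also have "\<dots> = (\<Prod>i<a. \<Prod>k<N. if \<mu> i \<le> k then 1 else - 1) * (\<Prod>i<b. \<Prod>k<N. if N - \<nu> i \<le> k then 1 else - 1)"
    unfolding prod.distrib by (intro arg_cong2[of _ _ _ _ "(*)"] prod.swap)
  also have "\<dots> = (\<Prod>j<a. (- 1) ^ \<mu> j) * (\<Prod>j<b. (- 1) ^ (N - \<nu> j))"
    using \<mu>_le by (simp add: sign_count)
  finally have sgn: "signof p = reversal_sign a * (\<Prod>j<a. (- 1) ^ \<mu> j) * (\<Prod>j<b. (- 1 :: complex) ^ (N - \<nu> j))"
    by (simp only: mult_1_right mult.assoc)
  show ?thesis
  proof (rule that[OF p _ _ _ sgn \<mu>_le \<nu>_le])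
    show "int (p j) = int a - 1 - int j + int (\<mu> j)" if "j < a" for j
      using pL[of j] that by (simp add: L_def)
    show "int (p (a + j)) = int (a + N) + int j - int (\<nu> j)" if "j < b" for j
      using pL[of "a + j"] that by (simp add: L_def)
    show "int (p (a + b + k)) = int a + int k - lam ! k" if "k < N" for k
      using pL[of "a + b + k"] that by (simp add: L_def)
  qed
qed

lemma alternant_ratio_cong:
  assumes "\<And>k. k < card X \<Longrightarrow> e k = e' k"
  shows "alternant_ratio e X = alternant_ratio e' X"
  unfolding alternant_ratio_def
proof (intro sum.cong refl)
  fix ys assume "ys \<in> permutations_of_set X"
  then have "length ys = card X" by (auto simp: permutations_of_set_def distinct_card)
  then show "ordered_term e ys = ordered_term e' ys"
    using assms by (auto simp: ordered_term_def intro!: arg_cong2[of _ _ _ _ "(/)"] prod.cong)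
qed

text \<open>By monotonicity the violation already occurs at the first or at the last part, and then
  the corresponding column lies entirely outside the range of the coefficients.\<close>

lemma moment_det_zero:
  assumes dom: "dominant_weight lam" and k: "k < length lam"
    and out: "lam ! k > int (size A) \<or> lam ! k < - int (size B)"
  shows "moment_det lam A B = 0"
proof -
  define N where "N = length lam"
  have N: "N > 0" using k unfolding N_def by linarith
  have mono: "lam ! k \<le> lam ! i" if "i \<le> k" "k < N" for i k
    using dom that unfolding dominant_weight_def sorted_wrt_iff_nth_less N_def by (cases "i = k") auto
  obtain c where c: "c < N" "\<And>j. j < N \<Longrightarrow> moment_coeff A B (int c - int j - lam ! c) = 0"
  proof (cases "lam ! k > int (size A)")
    case True
    then have "lam ! 0 > int (size A)" using mono[of 0 k] k by (simp add: N_def)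
    then have "moment_coeff A B (int 0 - int j - lam ! 0) = 0" for j by (simp add: moment_coeff_def)
    then show ?thesis by (rule that[OF N])
  next
    case False
    have "k \<le> N - 1" "N - 1 < N" using k by (auto simp: N_def)
    then have "lam ! (N - 1) \<le> lam ! k" by (rule mono)
    then have low: "lam ! (N - 1) < - int (size B)" using out False by linarith
    then have "moment_coeff A B (int (N - 1) - int j - lam ! (N - 1)) = 0" if "j < N" for j
    proof -
      have "nat (int (N - 1) - int j - lam ! (N - 1) + int (size A)) > size A + size B"
        using that low by linarith
      then show ?thesis using degree_moment_poly[of A B] by (auto simp: moment_coeff_def intro!: coeff_eq_0)
    qed
    then show ?thesis using N by (intro that[of "N - 1"]) auto
  qed
  have "(\<Prod>k=0..<N. moment_coeff A B (int k - int (p k) - lam ! k)) = 0" if p: "p permutes {0..<N}" for p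
  proof (rule prod_zero)
    have "p c < N" using permutes_in_image[OF p, of c] c(1) by simp
    then show "\<exists>k\<in>{0..<N}. moment_coeff A B (int k - int (p k) - lam ! k) = 0"
      using c by (intro bexI[of _ c]) auto
  qed simp
  then show ?thesis unfolding moment_det_leibniz N_def[symmetric] by (intro sum.neutral) simp
qed

section \<open>The sum over swaps\<close>

lemma neg_part_count:
  "card {i. i < length (neg_part lam) \<and> k < neg_part lam ! i} = card {i. i < length lam \<and> int k < - (lam ! i)}"
proof (rule bij_betw_same_card)
  let ?N = "length lam"
  show "bij_betw (\<lambda>i. ?N - 1 - i) {i. i < length (neg_part lam) \<and> k < neg_part lam ! i} {i. i < ?N \<and> int k < - (lam ! i)}"
    by (rule bij_betw_byWitness[where f' = "\<lambda>i. ?N - 1 - i"]) (auto simp: neg_part_def rev_nth)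
qed

lemma pos_part_count:
  "card {i. i < length (pos_part lam) \<and> k < pos_part lam ! i} = card {i. i < length lam \<and> int k < lam ! i}"
  by (rule arg_cong[of _ _ card]) (auto simp: pos_part_def)

text \<open>A subset of the variables is determined by the elements of \<open>A\<close> it omits and
  the inverses of elements of \<open>B\<close> it contains; it has as many elements as
  \<open>A\<close> exactly when these two are equinumerous.\<close>

lemma swap_bij:
  assumes A: "finite A" and B: "finite B" "0 \<notin> B" and disj: "A \<inter> inverse ` B = ({} :: complex set)"
  shows "bij_betw (\<lambda>(U, V). (A - U) \<union> inverse ` V) {(U, V). U \<subseteq> A \<and> V \<subseteq> B \<and> card U = card V}
    {S. S \<subseteq> A \<union> inverse ` B \<and> card S = card A}"
proof (rule bij_betw_byWitness[where f' = "\<lambda>S. (A - S, {b \<in> B. inverse b \<in> S})"])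
  have notin: "inverse b \<notin> A" if "b \<in> B" for b using disj that by auto
  show "\<forall>x\<in>{(U, V). U \<subseteq> A \<and> V \<subseteq> B \<and> card U = card V}.
      (\<lambda>S. (A - S, {b \<in> B. inverse b \<in> S})) ((\<lambda>(U, V). (A - U) \<union> inverse ` V) x) = x"
    using notin by (auto simp: image_iff)
  show "\<forall>S\<in>{S. S \<subseteq> A \<union> inverse ` B \<and> card S = card A}.
      (\<lambda>(U, V). (A - U) \<union> inverse ` V) ((\<lambda>S. (A - S, {b \<in> B. inverse b \<in> S})) S) = S"
    by auto
  have inj: "inj_on inverse V" for V :: "complex set" by (auto simp: inj_on_def)
  show "(\<lambda>(U, V). (A - U) \<union> inverse ` V) ` {(U, V). U \<subseteq> A \<and> V \<subseteq> B \<and> card U = card V}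
      \<subseteq> {S. S \<subseteq> A \<union> inverse ` B \<and> card S = card A}"
  proof clarify
    fix U V assume UV: "U \<subseteq> A" "V \<subseteq> B" "card U = card V"
    have fin: "finite U" "finite V" using UV A B finite_subset by auto
    have "card ((A - U) \<union> inverse ` V) = card (A - U) + card (inverse ` V)"
      using A fin UV notin by (intro card_Un_disjoint) auto
    also have "card (inverse ` V) = card V" by (rule card_image[OF inj])
    also have "card (A - U) = card A - card U" using UV fin by (simp add: card_Diff_subset)
    finally have "card ((A - U) \<union> inverse ` V) = card A" using UV card_mono[OF A UV(1)] by simp
    then show "(A - U) \<union> inverse ` V \<subseteq> A \<union> inverse ` B \<and> card ((A - U) \<union> inverse ` V) = card A"
      using UV by auto
  qed
  show "(\<lambda>S. (A - S, {b \<in> B. inverse b \<in> S})) ` {S. S \<subseteq> A \<union> inverse ` B \<and> card S = card A}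
      \<subseteq> {(U, V). U \<subseteq> A \<and> V \<subseteq> B \<and> card U = card V}"
  proof clarify
    fix S assume S: "S \<subseteq> A \<union> inverse ` B" "card S = card A"
    have finS: "finite S" using S(1) A B finite_subset by blast
    have "S = (S \<inter> A) \<union> inverse ` {b \<in> B. inverse b \<in> S}" using S(1) by auto
    then have "card S = card ((S \<inter> A) \<union> inverse ` {b \<in> B. inverse b \<in> S})" by simp
    also have "\<dots> = card (S \<inter> A) + card (inverse ` {b \<in> B. inverse b \<in> S})"
      using finS B notin by (intro card_Un_disjoint) auto
    also have "card (inverse ` {b \<in> B. inverse b \<in> S}) = card {b \<in> B. inverse b \<in> S}" by (rule card_image[OF inj])
    finally have "card A = card (S \<inter> A) + card {b \<in> B. inverse b \<in> S}" using S(2) by simp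
    moreover have "card A = card (S \<inter> A) + card (A - S)"
      using A card_Int_Diff[of A S] by (simp add: Int_commute)
    ultimately show "A - S \<subseteq> A \<and> {b \<in> B. inverse b \<in> S} \<subseteq> B \<and> card (A - S) = card {b \<in> B. inverse b \<in> S}"
      by auto
  qed
qed

theorem moment_det_generic:
  assumes gen: "generic A B" and dom: "dominant_weight lam"
  shows "moment_det lam (mset_set A) (mset_set B) = swap_sum lam A B"
proof -
  define N where "N = length lam"
  define a where "a = card A"
  define b where "b = card B"
  define I where "I = {(U, V). U \<subseteq> A \<and> V \<subseteq> B \<and> card U = card V}"
  define T where "T = A \<union> inverse ` B"
  define \<mu> where "\<mu> j = card {i. i < N \<and> int j < lam ! i}" for j
  define \<nu> where "\<nu> j = card {i. i < N \<and> int j < - (lam ! i)}" for j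
  have A: "finite A" "0 \<notin> A" and B: "finite B" "0 \<notin> B" using gen by (auto simp: generic_def)
  have AB: "A \<inter> inverse ` B = {}" and BA: "B \<inter> inverse ` A = {}" using gen by (auto simp: generic_def)
  have inj: "inj_on inverse V" for V :: "complex set" by (auto simp: inj_on_def)
  have fin: "finite U" "finite V" if "(U, V) \<in> I" for U V
    using that A B finite_subset by (auto simp: I_def)
  define C where "C U V = (A - U) \<union> inverse ` V" for U V
  define D where "D U V = (B - V) \<union> inverse ` U" for U V
  have C_mset: "mset_set (A - U) + image_mset inverse (mset_set V) = mset_set (C U V)"
    and D_mset: "mset_set (B - V) + image_mset inverse (mset_set U) = mset_set (D U V)"
    if "(U, V) \<in> I" for U V
  proof -
    have "V \<subseteq> B" "U \<subseteq> A" using that by (auto simp: I_def)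
    then have "inverse ` V \<subseteq> inverse ` B" "inverse ` U \<subseteq> inverse ` A" by (simp_all only: image_mono)
    then have "(A - U) \<inter> inverse ` V = {}" "(B - V) \<inter> inverse ` U = {}"
      using AB BA by blast+
    then show "mset_set (A - U) + image_mset inverse (mset_set V) = mset_set (C U V)"
      "mset_set (B - V) + image_mset inverse (mset_set U) = mset_set (D U V)"
      using fin[OF that] A B by (simp_all add: C_def D_def mset_set_Union image_mset_mset_set inj)
  qed
  have C_card: "card (C U V) = a" "finite (C U V)" if "(U, V) \<in> I" for U V
  proof -
    have "C U V \<in> {S. S \<subseteq> A \<union> inverse ` B \<and> card S = card A}"
      using bspec[OF bij_betwE[OF swap_bij[OF A(1) B AB]] that[unfolded I_def]] by (simp add: C_def)
    then have C: "C U V \<subseteq> A \<union> inverse ` B" "card (C U V) = card A" by blast+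
    show "card (C U V) = a" using C(2) by (simp add: a_def)
    show "finite (C U V)" using A(1) B(1) by (intro finite_subset[OF C(1)]) simp
  qed
  have D_card: "card (D U V) = b" "finite (D U V)" if "(U, V) \<in> I" for U V
  proof -
    have "D U V \<in> {S. S \<subseteq> B \<union> inverse ` A \<and> card S = card B}"
      using bspec[OF bij_betwE[OF swap_bij[OF B(1) A BA]], of "(V, U)"] that by (simp add: I_def D_def)
    then have D: "D U V \<subseteq> B \<union> inverse ` A" "card (D U V) = card B" by blast+
    show "card (D U V) = b" using D(2) by (simp add: b_def)
    show "finite (D U V)" using A(1) B(1) by (intro finite_subset[OF D(1)]) simp
  qed
  have D_nz: "0 \<notin> D U V" if "(U, V) \<in> I" for U V
    using that A(2) B(2) by (auto simp: D_def I_def)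
  have swap: "swap_sum lam A B = (\<Sum>(U, V)\<in>I. ((\<Prod>u\<in>U. u ^ N) * (\<Prod>v\<in>V. v ^ N)) *
      (schur_partition (conj_partition (pos_part lam)) (image_mset uminus (mset_set (C U V))) *
       schur_partition (conj_partition (neg_part lam)) (image_mset uminus (mset_set (D U V))) *
       (\<Prod>c\<in>C U V. \<Prod>d\<in>D U V. inverse (1 - c * d))))"
    unfolding swap_sum_def I_def[symmetric] N_def Z_weight_def Z_def
    by (intro sum.cong refl) (clarsimp simp only: C_mset D_mset prod_unfold_prod_mset split: prod.splits)
  have s1: "schur_partition (conj_partition (pos_part lam)) (image_mset uminus (mset_set (C U V))) =
      (if \<exists>r\<in>set (pos_part lam). a < r then 0
       else (\<Prod>k<a. (- 1) ^ \<mu> k) * (alternant_ratio (\<lambda>k. int a - 1 - int k + int (\<mu> k)) (C U V) / reversal_sign a))"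
    if "(U, V) \<in> I" for U V
    unfolding schur_partition_conj[OF C_card(2)[OF that] C_card(1)[OF that]] pos_part_count \<mu>_def N_def ..
  have s2: "schur_partition (conj_partition (neg_part lam)) (image_mset uminus (mset_set (D U V))) =
      (if \<exists>r\<in>set (neg_part lam). b < r then 0
       else (\<Prod>k<b. (- 1) ^ \<nu> k) * (alternant_ratio (\<lambda>k. int b - 1 - int k + int (\<nu> k)) (D U V) / reversal_sign b))"
    if "(U, V) \<in> I" for U V
    unfolding schur_partition_conj[OF D_card(2)[OF that] D_card(1)[OF that]] neg_part_count \<nu>_def N_def ..
  show ?thesis
  \<comment> \<open>In the first case both sides vanish, the swap sum because in every term one of
    the two conjugate partitions is too long. In the second case all exponents fit into
    \<open>{0..<a + b + N}\<close>.\<close>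
  proof (cases "\<exists>k<N. lam ! k > int a \<or> lam ! k < - int b")
    case True
    then obtain k where k: "k < N" "lam ! k > int a \<or> lam ! k < - int b" by blast
    have mem: "lam ! k \<in> set lam" using k(1) by (simp add: N_def)
    have large: "(\<exists>r\<in>set (pos_part lam). a < r) \<or> (\<exists>r\<in>set (neg_part lam). b < r)"
    proof (cases "lam ! k > int a")
      case True
      then have "a < nat (max (lam ! k) 0)" by linarith
      then show ?thesis using mem by (auto simp: pos_part_def)
    next
      case False
      then have "b < nat (max (- (lam ! k)) 0)" using k(2) by linarith
      then show ?thesis using mem by (auto simp: neg_part_def)
    qed
    have "swap_sum lam A B = 0"
      unfolding swap
    proof (intro sum.neutral ballI)
      fix UV assume UV: "UV \<in> I"
      obtain U V where [simp]: "UV = (U, V)" by (cases UV)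
      have "schur_partition (conj_partition (pos_part lam)) (image_mset uminus (mset_set (C U V))) = 0 \<or>
          schur_partition (conj_partition (neg_part lam)) (image_mset uminus (mset_set (D U V))) = 0"
        using large s1[of U V] s2[of U V] UV by auto
      then show "(case UV of (U, V) \<Rightarrow> ((\<Prod>u\<in>U. u ^ N) * (\<Prod>v\<in>V. v ^ N)) *
          (schur_partition (conj_partition (pos_part lam)) (image_mset uminus (mset_set (C U V))) *
           schur_partition (conj_partition (neg_part lam)) (image_mset uminus (mset_set (D U V))) *
           (\<Prod>c\<in>C U V. \<Prod>d\<in>D U V. inverse (1 - c * d)))) = 0" by auto
    qed
    moreover have "moment_det lam (mset_set A) (mset_set B) = 0"
      using k by (intro moment_det_zero[OF dom, of k]) (auto simp: N_def a_def b_def)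
    ultimately show ?thesis by simp
  next
    case False
    then have bounds: "\<And>k. k < N \<Longrightarrow> lam ! k \<le> int a" "\<And>k. k < N \<Longrightarrow> - int b \<le> lam ! k"
      by (meson not_less)+
    have small: "\<not> (\<exists>r\<in>set (pos_part lam). a < r)" "\<not> (\<exists>r\<in>set (neg_part lam). b < r)"
      using bounds by (auto simp: pos_part_def neg_part_def in_set_conv_nth N_def not_less nat_le_iff minus_le_iff)
    obtain p where p: "p permutes {0..<a + b + N}"
      and p1: "\<And>j. j < a \<Longrightarrow> int (p j) = int a - 1 - int j + int (\<mu> j)"
      and p2: "\<And>j. j < b \<Longrightarrow> int (p (a + j)) = int (a + N) + int j - int (\<nu> j)"
      and p3: "\<And>k. k < N \<Longrightarrow> int (p (a + b + k)) = int a + int k - lam ! k"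
      and sgn: "signof p = reversal_sign a * (\<Prod>j<a. (- 1) ^ \<mu> j) * (\<Prod>j<b. (- 1 :: complex) ^ (N - \<nu> j))"
      and \<nu>_le: "\<And>j. \<nu> j \<le> N"
    proof (rule complement_permutation[OF dom, of a b, folded N_def, folded \<mu>_def \<nu>_def])
      fix k assume "k < N"
      then show "lam ! k \<le> int a" "- int b \<le> lam ! k" by (rule bounds)+
    qed (rule that)
    have finT: "finite T" and cardT: "card T = a + b"
    proof -
      show "finite T" using A B by (simp add: T_def)
      show "card T = a + b"
        unfolding T_def a_def b_def using A B AB by (subst card_Un_disjoint) (auto simp: card_image inj)
    qed
    obtain ts where ts: "set ts = T" "distinct ts" using finite_distinct_list[OF finT] by blast
    have len: "length ts = a + b" using ts cardT by (metis distinct_card)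
    have pnz: "power_alternant (a + b) (\<lambda>k. k) (nth ts) \<noteq> 0"
      using list_vandermonde_nz[OF ts(2)] by (simp add: list_vandermonde_eq len)
    have sign_sq: "signof p * signof p = (1 :: complex)"
      by (metis of_int_1 of_int_mult sign_idempotent)
    have "moment_det lam (mset_set A) (mset_set B) = coeff_det N (moment_poly (mset_set A) (mset_set B)) (\<lambda>k. p (a + b + k))"
      unfolding N_def by (rule moment_det_eq_coeff_det) (simp add: p3 N_def a_def[symmetric])
    also have "\<dots> = (\<Prod>b\<in>B. - b) ^ N * coeff_det N (root_poly (a + b) (nth ts)) (\<lambda>k. p (a + b + k))"
      using moment_poly_eq_root_poly[OF A(1) B AB, of ts] ts by (simp add: T_def coeff_det_smult len)
    also have "coeff_det N (root_poly (a + b) (nth ts)) (\<lambda>k. p (a + b + k)) = signof p * alternant_ratio (\<lambda>k. int (p k)) T"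
    proof -
      have "signof p * power_alternant (a + b) p (nth ts) = coeff_det N (root_poly (a + b) (nth ts)) (\<lambda>k. p (a + b + k)) * power_alternant (a + b) (\<lambda>k. k) (nth ts)"
        unfolding power_alternant_complement[OF p] mult.assoc[symmetric] sign_sq by simp
      moreover have "alternant_ratio (\<lambda>k. int (p k)) T = power_alternant (a + b) p (nth ts) / power_alternant (a + b) (\<lambda>k. k) (nth ts)"
        using alternant_ratio_eq[OF ts(2) len, of "\<lambda>k. int (p k)"] by (simp add: ts(1) power_alternant_eq_int)
      ultimately have "signof p * alternant_ratio (\<lambda>k. int (p k)) T * power_alternant (a + b) (\<lambda>k. k) (nth ts) =
          coeff_det N (root_poly (a + b) (nth ts)) (\<lambda>k. p (a + b + k)) * power_alternant (a + b) (\<lambda>k. k) (nth ts)"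
        using pnz by simp
      then show ?thesis using pnz unfolding mult_cancel_right by simp
    qed
    also have "alternant_ratio (\<lambda>k. int (p k)) T = (\<Sum>S | S \<subseteq> T \<and> card S = a. alternant_ratio (\<lambda>k. int (p k)) S *
        alternant_ratio (\<lambda>k. int (p (a + k))) (T - S) / (\<Prod>x\<in>S. \<Prod>y\<in>T - S. y - x))"
      by (rule alternant_ratio_split[OF finT cardT])
    also have "\<dots> = (\<Sum>(U, V)\<in>I. alternant_ratio (\<lambda>k. int (p k)) (C U V) *
        alternant_ratio (\<lambda>k. int (p (a + k))) (T - C U V) / (\<Prod>x\<in>C U V. \<Prod>y\<in>T - C U V. y - x))"
      using sum.reindex_bij_betw[OF swap_bij[OF A(1) B AB], of "\<lambda>S. alternant_ratio (\<lambda>k. int (p k)) S *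
        alternant_ratio (\<lambda>k. int (p (a + k))) (T - S) / (\<Prod>x\<in>S. \<Prod>y\<in>T - S. y - x)"]
      by (simp add: I_def C_def T_def a_def case_prod_unfold)
    also have "(\<Prod>b\<in>B. - b) ^ N * (signof p * \<dots>) = swap_sum lam A B"
      unfolding swap sum_distrib_left
    proof (intro sum.cong refl, clarify)
      fix U V assume UV: "(U, V) \<in> I"
      let ?C = "C U V" and ?D = "D U V"
      define AL where "AL = alternant_ratio (\<lambda>k. int a - 1 - int k + int (\<mu> k)) ?C"
      define AU where "AU = alternant_ratio (\<lambda>k. int b - 1 - int k + int (\<nu> k)) ?D"
      define ZZ where "ZZ = (\<Prod>c\<in>?C. \<Prod>d\<in>?D. inverse (1 - c * d))"
      define M1 where "M1 = (\<Prod>k<a. (- 1 :: complex) ^ \<mu> k)"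
      define M2 where "M2 = (\<Prod>k<b. (- 1 :: complex) ^ \<nu> k)"
      \<comment> \<open>This sign occurs twice, in the leading coefficient of the moment polynomial
        and in the sign of \<open>p\<close>, and cancels.\<close>
      define e where "e = ((- 1 :: complex) ^ N) ^ b"
      define PB where "PB = (\<Prod>b\<in>B. b ^ N)"
      define PD where "PD = (\<Prod>d\<in>?D. inverse d ^ N)"
      have TC: "T - ?C = inverse ` ?D"
      proof -
        have "U \<subseteq> A" "V \<subseteq> B" using UV by (auto simp: I_def)
        moreover from this have "inverse ` V \<subseteq> inverse ` B" by (simp only: image_mono)
        moreover have "inverse ` ?D = (inverse ` B - inverse ` V) \<union> U"
          unfolding D_def image_Un by (simp add: image_image image_set_diff[OF inj[of UNIV]])
        ultimately show ?thesis using AB unfolding T_def C_def by blast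
      qed
      have low: "alternant_ratio (\<lambda>k. int (p k)) ?C = AL"
        unfolding AL_def by (rule alternant_ratio_cong) (simp add: C_card(1)[OF UV] p1)
      have up: "alternant_ratio (\<lambda>k. int (p (a + k))) (T - ?C) = (\<Prod>d\<in>?D. inverse d ^ (a + N)) * (AU / reversal_sign b)"
      proof -
        have "alternant_ratio (\<lambda>k. int (p (a + k))) (T - ?C) = alternant_ratio (\<lambda>k. int (a + N) + int k - int (\<nu> k)) (inverse ` ?D)"
          unfolding TC by (rule alternant_ratio_cong) (simp add: card_image[OF inj] D_card(1)[OF UV] p2)
        then show ?thesis
          unfolding AU_def using alternant_ratio_inverse[OF D_card(2)[OF UV] D_card(1)[OF UV] D_nz[OF UV], of "a + N" \<nu>] by simp
      qed
      \<comment> \<open>The differences across the cut are \<open>1/d - c = (1 - c d) / d\<close>,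
        so their inverses give the factor \<open>Z\<close> together with the power \<open>a\<close>
        of every \<open>d\<close>.\<close>
      have cross: "inverse (\<Prod>x\<in>?C. \<Prod>y\<in>T - ?C. y - x) = (\<Prod>d\<in>?D. d ^ a) * ZZ"
      proof -
        have "inverse (\<Prod>x\<in>?C. \<Prod>y\<in>T - ?C. y - x) = (\<Prod>x\<in>?C. \<Prod>d\<in>?D. inverse (inverse d - x))"
          unfolding TC prod_inversef[symmetric] by (subst prod.reindex[OF inj]) (simp add: prod_inversef[symmetric] o_def)
        also have "\<dots> = (\<Prod>x\<in>?C. \<Prod>d\<in>?D. d * inverse (1 - x * d))"
        proof (intro prod.cong refl)
          fix x d assume "d \<in> ?D"
          then have "d \<noteq> 0" using D_nz[OF UV] by auto
          then have "inverse d - x = inverse d * (1 - x * d)" by (simp add: field_simps)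
          then show "inverse (inverse d - x) = d * inverse (1 - x * d)" by simp
        qed
        also have "\<dots> = (\<Prod>d\<in>?D. d) ^ a * ZZ"
          by (simp add: prod.distrib ZZ_def C_card(1)[OF UV])
        finally show ?thesis by (simp add: prod_power_distrib)
      qed
      \<comment> \<open>The exponents of the second block start at \<open>a + N\<close>; the part
        \<open>a\<close> is cancelled by the powers from the cross differences.\<close>
      have PD: "(\<Prod>d\<in>?D. inverse d ^ (a + N)) * (\<Prod>d\<in>?D. d ^ a) = PD"
        unfolding PD_def prod.distrib[symmetric]
      proof (intro prod.cong refl)
        fix d assume "d \<in> ?D"
        then have "d \<noteq> 0" using D_nz[OF UV] by auto
        then show "inverse d ^ (a + N) * d ^ a = inverse d ^ N" by (simp add: power_add field_simps)
      qed
      \<comment> \<open>Origin of the factor \<open>(UV)^N\<close>: elements of \<open>B - V\<close>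
        cancel between the leading coefficient and \<open>PD\<close>, the elements of
        \<open>V\<close> remain from the first, and the inverses of \<open>U\<close> in
        \<open>?D\<close> give the powers of the elements of \<open>U\<close>.\<close>
      have PBD: "PB * PD = (\<Prod>u\<in>U. u ^ N) * (\<Prod>v\<in>V. v ^ N)"
      proof -
        let ?x = "\<Prod>b\<in>B - V. b ^ N" and ?y = "\<Prod>b\<in>B - V. inverse b ^ N"
        have PD': "PD = ?y * (\<Prod>u\<in>U. u ^ N)"
        proof -
          have "PD = (\<Prod>b\<in>B - V. inverse b ^ N) * (\<Prod>d\<in>inverse ` U. inverse d ^ N)"
            unfolding PD_def D_def using B fin[OF UV] UV BA by (intro prod.union_disjoint) (auto simp: I_def)
          also have "(\<Prod>d\<in>inverse ` U. inverse d ^ N) = (\<Prod>u\<in>U. u ^ N)"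
            by (subst prod.reindex[OF inj]) simp
          finally show ?thesis .
        qed
        have PB': "PB = ?x * (\<Prod>v\<in>V. v ^ N)"
          unfolding PB_def using B UV by (intro prod.subset_diff) (auto simp: I_def)
        have xy: "?x * ?y = 1"
          unfolding prod.distrib[symmetric]
        proof (intro prod.neutral ballI)
          fix b assume "b \<in> B - V"
          then have "b \<noteq> 0" using B(2) by auto
          then show "b ^ N * inverse b ^ N = 1" by (simp add: power_mult_distrib[symmetric])
        qed
        have "PB * PD = (?x * ?y) * ((\<Prod>u\<in>U. u ^ N) * (\<Prod>v\<in>V. v ^ N))"
          unfolding PB' PD' by (simp only: mult_ac)
        then show ?thesis unfolding xy by (simp only: mult_1_left)
      qed
      have PBneg: "(\<Prod>b\<in>B. - b) ^ N = e * PB"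
      proof -
        have "(\<Prod>b\<in>B. - b) ^ N = (\<Prod>b\<in>B. (- 1) ^ N * b ^ N)"
          by (simp add: prod_power_distrib power_mult_distrib[symmetric])
        then show ?thesis by (simp add: prod.distrib e_def PB_def b_def)
      qed
      have M2: "(\<Prod>j<b. (- 1 :: complex) ^ (N - \<nu> j)) = e * M2"
      proof -
        have "(\<Prod>j<b. (- 1 :: complex) ^ (N - \<nu> j)) = (\<Prod>j<b. (- 1) ^ N * (- 1) ^ \<nu> j)"
        proof (intro prod.cong refl)
          fix j
          have "N + \<nu> j = N - \<nu> j + (\<nu> j + \<nu> j)" using \<nu>_le[of j] by simp
          then have "(- 1 :: complex) ^ N * (- 1) ^ \<nu> j = (- 1) ^ (N - \<nu> j) * ((- 1) ^ \<nu> j * (- 1) ^ \<nu> j)"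
            by (metis power_add)
          then show "(- 1 :: complex) ^ (N - \<nu> j) = (- 1) ^ N * (- 1) ^ \<nu> j"
            by (simp add: power_mult_distrib[symmetric])
        qed
        then show ?thesis by (simp add: prod.distrib e_def M2_def)
      qed
      have ee: "e * e = 1" unfolding e_def by (simp add: power_mult_distrib[symmetric])
      \<comment> \<open>Turns the sign from the first block of \<open>p\<close> into the denominator
        of the first Schur function.\<close>
      have rr: "reversal_sign a = inverse (reversal_sign a)"
        by (metis inverse_unique reversal_sign_square)
      have "(\<Prod>b\<in>B. - b) ^ N * (signof p * (alternant_ratio (\<lambda>k. int (p k)) ?C *
          alternant_ratio (\<lambda>k. int (p (a + k))) (T - ?C) / (\<Prod>x\<in>?C. \<Prod>y\<in>T - ?C. y - x)))
        = (e * PB) * ((inverse (reversal_sign a) * M1 * (e * M2)) * (AL * ((\<Prod>d\<in>?D. inverse d ^ (a + N)) * (AU / reversal_sign b)) * ((\<Prod>d\<in>?D. d ^ a) * ZZ)))"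
        unfolding divide_inverse[of _ "\<Prod>x\<in>?C. \<Prod>y\<in>T - ?C. y - x"] cross low up PBneg sgn M2 M1_def[symmetric] rr[symmetric] ..
      also have "\<dots> = (e * e) * (PB * ((\<Prod>d\<in>?D. inverse d ^ (a + N)) * (\<Prod>d\<in>?D. d ^ a))) *
          ((M1 * (AL / reversal_sign a)) * (M2 * (AU / reversal_sign b)) * ZZ)"
        by (simp add: divide_inverse mult_ac)
      also have "\<dots> = ((\<Prod>u\<in>U. u ^ N) * (\<Prod>v\<in>V. v ^ N)) *
          ((M1 * (AL / reversal_sign a)) * (M2 * (AU / reversal_sign b)) * ZZ)"
        unfolding PD PBD ee by simp
      also have "M1 * (AL / reversal_sign a) = schur_partition (conj_partition (pos_part lam)) (image_mset uminus (mset_set ?C))"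
        unfolding s1[OF UV] using small(1) by (simp only: if_False M1_def AL_def)
      also have "M2 * (AU / reversal_sign b) = schur_partition (conj_partition (neg_part lam)) (image_mset uminus (mset_set ?D))"
        unfolding s2[OF UV] using small(2) by (simp only: if_False M2_def AU_def)
      finally show "(\<Prod>b\<in>B. - b) ^ N * (signof p * (alternant_ratio (\<lambda>k. int (p k)) ?C *
          alternant_ratio (\<lambda>k. int (p (a + k))) (T - ?C) / (\<Prod>x\<in>?C. \<Prod>y\<in>T - ?C. y - x)))
        = ((\<Prod>u\<in>U. u ^ N) * (\<Prod>v\<in>V. v ^ N)) *
          (schur_partition (conj_partition (pos_part lam)) (image_mset uminus (mset_set ?C)) *
           schur_partition (conj_partition (neg_part lam)) (image_mset uminus (mset_set ?D)) *
           (\<Prod>c\<in>?C. \<Prod>d\<in>?D. inverse (1 - c * d)))"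
        unfolding ZZ_def .
    qed
    finally show ?thesis .
  qed
qed

section \<open>Analytic continuation\<close>

text \<open>Centred at \<open>z\<close> to match the required power series. Exponents may repeat in
  the list, so addition is concatenation; their coefficients are merged only in
  \<open>analytic_everywhere_polynomial\<close>.\<close>

definition polynomial_at :: "nat \<Rightarrow> complex list \<Rightarrow> (complex list \<Rightarrow> complex) \<Rightarrow> bool" where
  "polynomial_at m z F \<longleftrightarrow> (\<exists>L. (\<forall>(c, a)\<in>set L. length a = m) \<and>
     (\<forall>w. length w = m \<longrightarrow> F w = (\<Sum>(c, a)\<leftarrow>L. c * (\<Prod>i<m. (w ! i - z ! i) ^ (a ! i)))))"

lemma polynomial_at_cong:
  "(\<And>w. length w = m \<Longrightarrow> F w = G w) \<Longrightarrow> polynomial_at m z F \<longleftrightarrow> polynomial_at m z G"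
  by (simp add: polynomial_at_def)

lemma polynomial_at_const: "polynomial_at m z (\<lambda>_. c)"
  unfolding polynomial_at_def by (rule exI[of _ "[(c, replicate m 0)]"]) simp

lemma polynomial_at_coord:
  assumes "i < m"
  shows "polynomial_at m z (\<lambda>w. w ! i)"
proof -
  have "(\<Prod>j<m. (w ! j - z ! j) ^ ((replicate m 0)[i := Suc 0] ! j)) = w ! i - z ! i" for w :: "complex list"
  proof -
    have "(\<Prod>j<m. (w ! j - z ! j) ^ ((replicate m 0)[i := Suc 0] ! j)) = (\<Prod>j<m. if j = i then w ! j - z ! j else 1)"
      by (intro prod.cong) (auto simp: nth_list_update)
    then show ?thesis using assms by (simp add: prod.delta)
  qed
  then show ?thesis
    unfolding polynomial_at_def
    by (intro exI[of _ "[(z ! i, replicate m 0), (1, (replicate m 0)[i := Suc 0])]"]) simp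
qed

lemma polynomial_at_add:
  assumes "polynomial_at m z F" "polynomial_at m z G"
  shows "polynomial_at m z (\<lambda>w. F w + G w)"
proof -
  obtain L where L: "\<forall>(c, a)\<in>set L. length a = m"
    "\<And>w. length w = m \<Longrightarrow> F w = (\<Sum>(c, a)\<leftarrow>L. c * (\<Prod>i<m. (w ! i - z ! i) ^ (a ! i)))"
    using assms(1) by (auto simp: polynomial_at_def)
  obtain K where K: "\<forall>(c, a)\<in>set K. length a = m"
    "\<And>w. length w = m \<Longrightarrow> G w = (\<Sum>(c, a)\<leftarrow>K. c * (\<Prod>i<m. (w ! i - z ! i) ^ (a ! i)))"
    using assms(2) by (auto simp: polynomial_at_def)
  show ?thesis
    unfolding polynomial_at_def using L K by (intro exI[of _ "L @ K"]) auto
qed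

lemma polynomial_at_mult:
  assumes "polynomial_at m z F" "polynomial_at m z G"
  shows "polynomial_at m z (\<lambda>w. F w * G w)"
proof -
  define T where "T = (\<lambda>w (c, a). c * (\<Prod>i<m. (w ! i - z ! i) ^ (a ! i)))"
  obtain L where L: "\<forall>(c, a)\<in>set L. length a = m" "\<And>w. length w = m \<Longrightarrow> F w = sum_list (map (T w) L)"
    using assms(1) by (auto simp: polynomial_at_def T_def)
  obtain K where K: "\<forall>(c, a)\<in>set K. length a = m" "\<And>w. length w = m \<Longrightarrow> G w = sum_list (map (T w) K)"
    using assms(2) by (auto simp: polynomial_at_def T_def)
  define mon where "mon x y = (fst x * fst y, map2 (+) (snd x) (snd y))" for x y :: "complex \<times> nat list"
  have T_mon: "T w (mon x y) = T w x * T w y" if "length (snd x) = m" "length (snd y) = m" for w x y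
  proof -
    have "(\<Prod>i<m. (w ! i - z ! i) ^ (map2 (+) (snd x) (snd y) ! i)) =
        (\<Prod>i<m. (w ! i - z ! i) ^ (snd x ! i) * (w ! i - z ! i) ^ (snd y ! i))"
      using that by (intro prod.cong) (auto simp: power_add)
    then show ?thesis by (simp add: T_def mon_def prod.distrib case_prod_unfold)
  qed
  have row: "sum_list (map (T w) (map (mon x) K)) = T w x * sum_list (map (T w) K)"
    if "length (snd x) = m" for w x
    using K(1) by (induction K) (auto simp: T_mon[OF that] distrib_left)
  have "sum_list (map (T w) (concat (map (\<lambda>x. map (mon x) K) L))) = sum_list (map (T w) L) * sum_list (map (T w) K)" for w
    using L(1) by (induction L) (auto simp: row distrib_right simp del: map_map)
  then have "F w * G w = sum_list (map (T w) (concat (map (\<lambda>x. map (mon x) K) L)))" if "length w = m" for w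
    using that by (simp add: L(2) K(2))
  moreover have "\<forall>(c, a)\<in>set (concat (map (\<lambda>x. map (mon x) K) L)). length a = m"
    using L(1) K(1) by (auto simp: mon_def case_prod_unfold)
  ultimately show ?thesis unfolding polynomial_at_def T_def by blast
qed

lemma polynomial_at_sum:
  "finite I \<Longrightarrow> (\<And>i. i \<in> I \<Longrightarrow> polynomial_at m z (F i)) \<Longrightarrow> polynomial_at m z (\<lambda>w. \<Sum>i\<in>I. F i w)"
  by (induction I rule: finite_induct) (simp_all add: polynomial_at_const polynomial_at_add)

lemma polynomial_at_prod:
  "finite I \<Longrightarrow> (\<And>i. i \<in> I \<Longrightarrow> polynomial_at m z (F i)) \<Longrightarrow> polynomial_at m z (\<lambda>w. \<Prod>i\<in>I. F i w)"
  by (induction I rule: finite_induct) (simp_all add: polynomial_at_const polynomial_at_mult)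

lemma analytic_everywhere_polynomial:
  assumes "\<And>z. length z = m \<Longrightarrow> polynomial_at m z F"
  shows "analytic_everywhere m F"
  unfolding analytic_everywhere_def
proof (intro allI impI)
  fix z :: "complex list" assume z: "length z = m"
  obtain L where L: "\<forall>(c, a)\<in>set L. length a = m"
    "\<And>w. length w = m \<Longrightarrow> F w = (\<Sum>(c, a)\<leftarrow>L. c * (\<Prod>i<m. (w ! i - z ! i) ^ (a ! i)))"
    using assms[OF z] unfolding polynomial_at_def by blast
  have "\<exists>c. \<forall>w. ((\<lambda>a. c a * (\<Prod>i<m. (w ! i - z ! i) ^ (a ! i))) has_sum
      (\<Sum>(c, a)\<leftarrow>L. c * (\<Prod>i<m. (w ! i - z ! i) ^ (a ! i)))) {a. length a = m}"
    using L(1)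
  proof (induction L)
    case Nil
    show ?case by (rule exI[of _ "\<lambda>_. 0"]) simp
  next
    case (Cons x L)
    obtain c0 a0 where x: "x = (c0, a0)" by (cases x)
    have a0: "length a0 = m" using Cons.prems x by simp
    from Cons obtain c where c: "\<And>w. ((\<lambda>a. c a * (\<Prod>i<m. (w ! i - z ! i) ^ (a ! i))) has_sum
      (\<Sum>(c, a)\<leftarrow>L. c * (\<Prod>i<m. (w ! i - z ! i) ^ (a ! i)))) {a. length a = m}" by auto
    have single: "((\<lambda>a. if a = a0 then f a0 else 0) has_sum f a0) {a :: nat list. length a = m}" for f :: "nat list \<Rightarrow> complex"
    proof -
      have "((\<lambda>a. if a = a0 then f a0 else 0) has_sum f a0) {a0}" by (rule has_sum_finiteI) simp_all
      then show ?thesis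
        by (rule has_sum_cong_neutral[THEN iffD1, rotated 3]) (use a0 in auto)
    qed
    have "((\<lambda>a. (c a + (if a = a0 then c0 else 0)) * (\<Prod>i<m. (w ! i - z ! i) ^ (a ! i))) has_sum
      (\<Sum>(c, a)\<leftarrow>x # L. c * (\<Prod>i<m. (w ! i - z ! i) ^ (a ! i)))) {a. length a = m}" for w :: "complex list"
    proof -
      have eq: "(c a + (if a = a0 then c0 else 0)) * (\<Prod>i<m. (w ! i - z ! i) ^ (a ! i)) =
          (if a = a0 then c0 * (\<Prod>i<m. (w ! i - z ! i) ^ (a0 ! i)) else 0) + c a * (\<Prod>i<m. (w ! i - z ! i) ^ (a ! i))" for a
        by (simp add: distrib_right)
      show ?thesis
        unfolding eq using has_sum_add[OF single[of "\<lambda>a. c0 * (\<Prod>i<m. (w ! i - z ! i) ^ (a ! i))"] c[of w]] by (simp add: x)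
    qed
    then show ?case by (intro exI allI)
  qed
  then obtain c where "\<And>w. ((\<lambda>a. c a * (\<Prod>i<m. (w ! i - z ! i) ^ (a ! i))) has_sum
      (\<Sum>(c, a)\<leftarrow>L. c * (\<Prod>i<m. (w ! i - z ! i) ^ (a ! i)))) {a. length a = m}" by blast
  then show "\<exists>r>0. \<exists>c. \<forall>w. length w = m \<and> (\<forall>i<m. cmod (w ! i - z ! i) < r) \<longrightarrow>
      ((\<lambda>a. c a * (\<Prod>i<m. (w ! i - z ! i) ^ (a ! i))) has_sum F w) {a. length a = m}"
    using L(2) by (intro exI[of _ 1] conjI exI[of _ c] allI impI) auto
qed

section \<open>Uniqueness of the continuation\<close>

definition line_point :: "complex list \<Rightarrow> (nat \<Rightarrow> complex) \<Rightarrow> real \<Rightarrow> complex list" where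
  "line_point z d \<epsilon> = map (\<lambda>i. z ! i + of_real \<epsilon> * d i) [0..<length z]"

lemma line_point_simps [simp]:
  "length (line_point z d \<epsilon>) = length z"
  "i < length z \<Longrightarrow> line_point z d \<epsilon> ! i = z ! i + of_real \<epsilon> * d i"
  by (simp_all add: line_point_def)

text \<open>Every nonconstant monomial has degree at least one, so its increment at \<epsilon> is at
  most \<epsilon>/\<delta> times its modulus at \<delta>. The series converges absolutely at
  \<delta>, hence the values of \<open>F\<close> differ by a multiple of \<epsilon>.\<close>

lemma analytic_everywhere_line:
  assumes F: "analytic_everywhere m F" and z: "length z = m"
  shows "((\<lambda>\<epsilon>. F (line_point z d \<epsilon>)) \<longlongrightarrow> F z) (at_right 0)"
proof -
  let ?X = "{a :: nat list. length a = m}"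
  obtain r c where r: "r > 0" and c: "\<And>w. length w = m \<Longrightarrow> (\<And>i. i < m \<Longrightarrow> norm (w ! i - z ! i) < r) \<Longrightarrow>
      ((\<lambda>a. c a * (\<Prod>i<m. (w ! i - z ! i) ^ (a ! i))) has_sum F w) ?X"
    using F z unfolding analytic_everywhere_def by blast
  define t where "t \<epsilon> a = c a * (\<Prod>i<m. (of_real \<epsilon> * d i) ^ (a ! i))" for \<epsilon> :: real and a :: "nat list"
  \<comment> \<open>Keeps the segment inside the polydisc of convergence; the summand 1 guards
    against a zero direction and makes the inequality strict.\<close>
  define \<delta> where "\<delta> = r / (1 + (\<Sum>i<m. norm (d i)))"
  have sum_nn: "(\<Sum>i<m. norm (d i)) \<ge> 0" by (intro sum_nonneg) simp
  have \<delta>: "\<delta> > 0" using r sum_nn by (simp add: \<delta>_def)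
  have t: "(t \<epsilon> has_sum F (line_point z d \<epsilon>)) ?X" if \<epsilon>: "0 \<le> \<epsilon>" "\<epsilon> \<le> \<delta>" for \<epsilon>
  proof -
    have "norm (line_point z d \<epsilon> ! i - z ! i) < r" if "i < m" for i
    proof -
      have "norm (d i) \<le> (\<Sum>i<m. norm (d i))" using that by (intro member_le_sum) auto
      then have "norm (d i) < 1 + (\<Sum>i<m. norm (d i))" by linarith
      then have "r * norm (d i) < r * (1 + (\<Sum>i<m. norm (d i)))" using r by simp
      then have "\<delta> * norm (d i) < r" using sum_nn by (simp add: \<delta>_def divide_less_eq)
      moreover have "\<epsilon> * norm (d i) \<le> \<delta> * norm (d i)" using \<epsilon> by (intro mult_right_mono) auto
      ultimately show ?thesis using that z \<epsilon> by (simp add: norm_mult)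
    qed
    then have "((\<lambda>a. c a * (\<Prod>i<m. (line_point z d \<epsilon> ! i - z ! i) ^ (a ! i))) has_sum F (line_point z d \<epsilon>)) ?X"
      by (intro c) (simp_all add: z)
    moreover have "(\<Prod>i<m. (line_point z d \<epsilon> ! i - z ! i) ^ (a ! i)) = (\<Prod>i<m. (of_real \<epsilon> * d i) ^ (a ! i))" for a
      by (intro prod.cong) (auto simp: z)
    ultimately show ?thesis by (simp add: t_def[abs_def])
  qed
  have "t \<delta> summable_on ?X" using t[of \<delta>] \<delta> by (intro has_sum_imp_summable) auto
  then have abs: "(\<lambda>a. norm (t \<delta> a)) summable_on ?X"
    by (rule summable_on_iff_abs_summable_on_complex[THEN iffD1])
  define S where "S = infsum (\<lambda>a. norm (t \<delta> a)) ?X"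
  have S: "((\<lambda>a. norm (t \<delta> a)) has_sum S) ?X" unfolding S_def by (rule has_sum_infsum[OF abs])
  have line_0: "line_point z d 0 = z" by (intro nth_equalityI) auto
  have bound: "norm (t \<epsilon> a - t 0 a) \<le> \<epsilon> / \<delta> * norm (t \<delta> a)" if \<epsilon>: "0 < \<epsilon>" "\<epsilon> \<le> \<delta>" for \<epsilon> a
  proof -
    define e where "e = (\<Sum>i<m. a ! i)"
    have t_e: "t x a = c a * (of_real x ^ e * (\<Prod>i<m. d i ^ (a ! i)))" for x
      by (simp add: t_def power_mult_distrib prod.distrib e_def power_sum)
    show ?thesis
    proof (cases "e = 0")
      case True
      then show ?thesis using \<epsilon> \<delta> by (simp add: t_e)
    next
      case False
      then obtain k where k: "e = Suc k" using not0_implies_Suc by blast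
      have "\<epsilon> ^ e = \<epsilon> * \<epsilon> ^ k" by (simp add: k)
      also have "\<dots> \<le> \<epsilon> * \<delta> ^ k" using \<epsilon> by (intro mult_left_mono power_mono) auto
      also have "\<dots> = \<epsilon> / \<delta> * \<delta> ^ e" using \<delta> by (simp add: k)
      finally have pow: "\<epsilon> ^ e \<le> \<epsilon> / \<delta> * \<delta> ^ e" .
      have "norm (t \<epsilon> a - t 0 a) = norm (c a) * norm (\<Prod>i<m. d i ^ (a ! i)) * \<epsilon> ^ e"
        using \<epsilon> by (simp add: t_e k norm_mult norm_power)
      also have "\<dots> \<le> norm (c a) * norm (\<Prod>i<m. d i ^ (a ! i)) * (\<epsilon> / \<delta> * \<delta> ^ e)"
        using pow by (intro mult_left_mono) auto
      also have "\<dots> = \<epsilon> / \<delta> * norm (t \<delta> a)"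
        using \<delta> by (simp add: t_e norm_mult norm_power)
      finally show ?thesis .
    qed
  qed
  have est: "norm (F (line_point z d \<epsilon>) - F z) \<le> \<epsilon> / \<delta> * S" if \<epsilon>: "0 < \<epsilon>" "\<epsilon> \<le> \<delta>" for \<epsilon>
  proof -
    have "((\<lambda>a. t \<epsilon> a + - t 0 a) has_sum F (line_point z d \<epsilon>) + - F (line_point z d 0)) ?X"
      using \<epsilon> \<delta> by (intro has_sum_add[OF t has_sum_uminusI[OF t]]) auto
    then have diff: "((\<lambda>a. t \<epsilon> a - t 0 a) has_sum F (line_point z d \<epsilon>) - F z) ?X" by (simp add: line_0)
    have abs_diff: "(\<lambda>a. norm (t \<epsilon> a - t 0 a)) summable_on ?X"
      by (rule summable_on_iff_abs_summable_on_complex[THEN iffD1, OF has_sum_imp_summable[OF diff]])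
    have "norm (F (line_point z d \<epsilon>) - F z) \<le> infsum (\<lambda>a. norm (t \<epsilon> a - t 0 a)) ?X"
      by (rule norm_has_sum_bound[OF has_sum_infsum[OF abs_diff] diff])
    also have "\<dots> \<le> \<epsilon> / \<delta> * S"
      by (rule has_sum_mono[OF has_sum_infsum[OF abs_diff] has_sum_cmult_right[OF S] bound[OF \<epsilon>]])
    finally show ?thesis .
  qed
  have "((\<lambda>\<epsilon>. F (line_point z d \<epsilon>) - F z) \<longlongrightarrow> 0) (at_right 0)"
  proof (rule Lim_null_comparison)
    show "\<forall>\<^sub>F \<epsilon> in at_right 0. norm (F (line_point z d \<epsilon>) - F z) \<le> \<epsilon> / \<delta> * S"
      unfolding eventually_at_right_field using est \<delta> by (intro exI[of _ \<delta>]) auto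
    have "((\<lambda>\<epsilon>. \<epsilon> / \<delta> * S) \<longlongrightarrow> 0 / \<delta> * S) (at_right 0)" using \<delta> by (intro tendsto_intros) auto
    then show "((\<lambda>\<epsilon>. \<epsilon> / \<delta> * S) \<longlongrightarrow> 0) (at_right 0)" by simp
  qed
  then show ?thesis by (simp add: LIM_zero_iff)
qed

lemma eventually_at_right_poly_nz:
  fixes P :: "complex poly"
  assumes "P \<noteq> 0"
  shows "\<forall>\<^sub>F \<epsilon> in at_right (0 :: real). poly P (of_real \<epsilon>) \<noteq> 0"
proof -
  let ?R = "{\<epsilon> :: real. poly P (of_real \<epsilon>) = 0}"
  have "of_real ` ?R \<subseteq> {x. poly P x = 0}" by auto
  then have "finite (of_real ` ?R :: complex set)" using poly_roots_finite[OF assms] finite_subset by blast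
  then have "finite ?R" by (rule finite_imageD) (auto simp: inj_on_def)
  then have "\<forall>\<^sub>F \<epsilon> in at_right 0. \<forall>x\<in>?R. \<epsilon> \<noteq> x"
    by (rule eventually_ball_finite) (simp add: eventually_neq_at_within)
  then show ?thesis by (rule eventually_mono) auto
qed

text \<open>
  A direction with distinct nonzero entries leads from every point into general position: along
  the line the conditions fail only at the zeros of finitely many nonzero polynomials.
\<close>

lemma eventually_generic:
  assumes z: "length z = p + q"
  shows "\<forall>\<^sub>F \<epsilon> in at_right 0. let w = line_point z (\<lambda>i. of_nat (Suc i)) \<epsilon>; as = take p w; bs = drop p w in
    distinct as \<and> distinct bs \<and> generic (set as) (set bs)"
proof -
  define w where "w = line_point z (\<lambda>i. of_nat (Suc i))"
  let ?d = "\<lambda>i. of_nat (Suc i) :: complex"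
  have len: "length (w \<epsilon>) = p + q" for \<epsilon> by (simp add: w_def z)
  have w: "w \<epsilon> ! i = z ! i + of_real \<epsilon> * ?d i" if "i < p + q" for \<epsilon> i
    unfolding w_def by (rule line_point_simps) (simp only: z that)
  \<comment> \<open>For all pairs of indices, \<open>i = j\<close> included in the last condition,
    these imply general position. The leading coefficients \<open>?d i\<close>,
    \<open>?d i - ?d j\<close> and \<open>?d i * ?d j\<close> do not depend on \<open>z\<close> and
    are nonzero in the relevant cases.\<close>
  have "\<forall>\<^sub>F \<epsilon> in at_right 0. w \<epsilon> ! i \<noteq> 0 \<and> (i \<noteq> j \<longrightarrow> w \<epsilon> ! i \<noteq> w \<epsilon> ! j) \<and> w \<epsilon> ! i * w \<epsilon> ! j \<noteq> 1"
    if ij: "i < p + q" "j < p + q" for i j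
  proof (intro eventually_conj)
    have "\<forall>\<^sub>F \<epsilon> in at_right 0. poly [:z ! i, ?d i:] (of_real \<epsilon>) \<noteq> 0"
      by (rule eventually_at_right_poly_nz) (simp del: of_nat_Suc)
    then show "\<forall>\<^sub>F \<epsilon> in at_right 0. w \<epsilon> ! i \<noteq> 0"
      by (rule eventually_mono) (simp add: w ij del: of_nat_Suc)
    have "\<forall>\<^sub>F \<epsilon> in at_right 0. i \<noteq> j \<longrightarrow> poly [:z ! i - z ! j, ?d i - ?d j:] (of_real \<epsilon>) \<noteq> 0"
    proof (cases "i = j")
      case False
      then have "?d i \<noteq> ?d j" by simp
      then show ?thesis using eventually_at_right_poly_nz[of "[:z ! i - z ! j, ?d i - ?d j:]"] by simp
    qed simp
    then show "\<forall>\<^sub>F \<epsilon> in at_right 0. i \<noteq> j \<longrightarrow> w \<epsilon> ! i \<noteq> w \<epsilon> ! j"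
      by (rule eventually_mono) (auto simp: w ij algebra_simps)
    have "\<forall>\<^sub>F \<epsilon> in at_right 0. poly [:z ! i * z ! j - 1, z ! i * ?d j + z ! j * ?d i, ?d i * ?d j:] (of_real \<epsilon>) \<noteq> 0"
      by (rule eventually_at_right_poly_nz) (simp del: of_nat_Suc)
    then show "\<forall>\<^sub>F \<epsilon> in at_right 0. w \<epsilon> ! i * w \<epsilon> ! j \<noteq> 1"
      by (rule eventually_mono) (simp add: w ij algebra_simps del: of_nat_Suc)
  qed
  then have "\<forall>\<^sub>F \<epsilon> in at_right 0. \<forall>i\<in>{..<p + q}. \<forall>j\<in>{..<p + q}.
      w \<epsilon> ! i \<noteq> 0 \<and> (i \<noteq> j \<longrightarrow> w \<epsilon> ! i \<noteq> w \<epsilon> ! j) \<and> w \<epsilon> ! i * w \<epsilon> ! j \<noteq> 1"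
    by (intro eventually_ball_finite ballI) auto
  then show ?thesis
  proof (rule eventually_mono)
    fix \<epsilon> assume ev: "\<forall>i\<in>{..<p + q}. \<forall>j\<in>{..<p + q}.
      w \<epsilon> ! i \<noteq> 0 \<and> (i \<noteq> j \<longrightarrow> w \<epsilon> ! i \<noteq> w \<epsilon> ! j) \<and> w \<epsilon> ! i * w \<epsilon> ! j \<noteq> 1"
    let ?as = "take p (w \<epsilon>)" and ?bs = "drop p (w \<epsilon>)"
    have "distinct (w \<epsilon>)" using ev by (auto simp: distinct_conv_nth len)
    then have dist: "distinct (?as @ ?bs)" by simp
    have nz: "x \<noteq> 0" and prod: "x * y \<noteq> 1" if xy: "x \<in> set (?as @ ?bs)" "y \<in> set (?as @ ?bs)" for x y
    proof -
      obtain i j where "i < p + q" "j < p + q" "x = w \<epsilon> ! i" "y = w \<epsilon> ! j"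
        using xy unfolding append_take_drop_id in_set_conv_nth len by metis
      then show "x \<noteq> 0" "x * y \<noteq> 1" using ev by auto
    qed
    have inv: "X \<inter> inverse ` Y = {}" if "X \<subseteq> set (?as @ ?bs)" "Y \<subseteq> set (?as @ ?bs)" for X Y
    proof (rule ccontr)
      assume "X \<inter> inverse ` Y \<noteq> {}"
      then obtain y where "y \<in> Y" "inverse y \<in> X" by auto
      then show False using nz[of y y] prod[of "inverse y" y] that by auto
    qed
    have AB: "set ?as \<inter> set ?bs = {}" using dist unfolding distinct_append by blast
    have "inj (inverse :: complex \<Rightarrow> complex)" by (auto simp: inj_on_def)
    then have "inverse ` set ?as \<inter> inverse ` set ?bs = {}"
      by (simp only: image_Int[symmetric] AB image_empty)
    moreover have sub: "set ?as \<subseteq> set (?as @ ?bs)" "set ?bs \<subseteq> set (?as @ ?bs)" by (simp_all only: set_append Un_upper1 Un_upper2)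
    moreover from this have "0 \<notin> set ?as" "0 \<notin> set ?bs" using nz[of 0 0] by blast+
    ultimately have "generic (set ?as) (set ?bs)"
      unfolding generic_def
      using AB inv[OF sub(1) sub(1)] inv[OF sub(1) sub(2)] inv[OF sub(2) sub(1)] inv[OF sub(2) sub(2)]
      by (intro conjI finite_set)
    then show "let w = line_point z ?d \<epsilon>; as = take p w; bs = drop p w in
        distinct as \<and> distinct bs \<and> generic (set as) (set bs)"
      using dist unfolding w_def[symmetric] Let_def distinct_append by blast
  qed
qed

text \<open>Every point is the limit along a line of points in general position, where both
  functions are the swap sum, and both are continuous along that line.\<close>

lemma swap_sum_continuation_unique:
  assumes F: "swap_sum_continuation lam p q F" and G: "swap_sum_continuation lam p q G" and z: "length z = p + q"
  shows "F z = G z"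
proof -
  let ?w = "line_point z (\<lambda>i. of_nat (Suc i))"
  have lim: "((\<lambda>\<epsilon>. H (?w \<epsilon>)) \<longlongrightarrow> H z) (at_right 0)" if "swap_sum_continuation lam p q H" for H
    using that z by (intro analytic_everywhere_line) (auto simp: swap_sum_continuation_def)
  have "\<forall>\<^sub>F \<epsilon> in at_right 0. F (?w \<epsilon>) = G (?w \<epsilon>)"
    using eventually_generic[OF z]
  proof (rule eventually_mono)
    fix \<epsilon> assume gen: "let w = ?w \<epsilon>; as = take p w; bs = drop p w in
      distinct as \<and> distinct bs \<and> generic (set as) (set bs)"
    have "H (take p (?w \<epsilon>) @ drop p (?w \<epsilon>)) = swap_sum lam (set (take p (?w \<epsilon>))) (set (drop p (?w \<epsilon>)))"
      if H: "swap_sum_continuation lam p q H" for H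
    proof -
      have "length (take p (?w \<epsilon>)) = p" "length (drop p (?w \<epsilon>)) = q" using z by simp_all
      then show ?thesis using H gen unfolding swap_sum_continuation_def Let_def by blast
    qed
    from this[OF F] this[OF G] show "F (?w \<epsilon>) = G (?w \<epsilon>)" unfolding append_take_drop_id by (rule trans[OF _ sym])
  qed
  then have "((\<lambda>\<epsilon>. F (?w \<epsilon>)) \<longlongrightarrow> G z) (at_right 0)"
    using lim[OF G] by (simp add: tendsto_cong)
  then show ?thesis using lim[OF F] by (intro tendsto_unique[OF trivial_limit_at_right_real])
qed

section \<open>The determinant as the continuation\<close>

lemma prod_mset_mset: "(\<Prod>x\<in>#mset xs. f x) = (\<Prod>i<length xs. f (xs ! i) :: 'b :: comm_monoid_mult)"
proof -
  have "(\<Prod>x\<in>#mset xs. f x) = prod_list (map f xs)" by (induction xs) simp_all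
  then show ?thesis by (simp add: prod.list_conv_set_nth atLeast0LessThan)
qed

lemma polynomial_at_coeff_prod:
  assumes "finite I" "\<And>i k. i \<in> I \<Longrightarrow> polynomial_at m z (\<lambda>w. coeff (G i w) k)"
  shows "polynomial_at m z (\<lambda>w. coeff (\<Prod>i\<in>I. G i w) k)"
  using assms
proof (induction I arbitrary: k rule: finite_induct)
  case (insert i I)
  then show ?case
    by (simp add: coeff_mult polynomial_at_sum polynomial_at_mult)
qed (simp add: polynomial_at_const)

lemma polynomial_at_moment_poly:
  assumes m: "m = p + q"
  shows "polynomial_at m z (\<lambda>w. coeff (moment_poly (mset (take p w)) (mset (drop p w))) k)"
proof -
  have eq: "moment_poly (mset (take p w)) (mset (drop p w)) = (\<Prod>i<p. [:- (w ! i), 1:]) * (\<Prod>i<q. [:1, - (w ! (p + i)):])"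
    if "length w = m" for w
    using that m by (simp add: moment_poly_def prod_mset_mset)
  have neg: "polynomial_at m z (\<lambda>w. - (w ! i))" if "i < m" for i
    using polynomial_at_mult[OF polynomial_at_const[of m z "- 1"] polynomial_at_coord[OF that, of z]] by simp
  have 1: "polynomial_at m z (\<lambda>w. coeff [:- (w ! i), 1:] k)" if "i < p" for i k
    using neg[of i] that m by (cases k) (auto simp: coeff_pCons intro!: polynomial_at_const split: nat.split)
  have 2: "polynomial_at m z (\<lambda>w. coeff [:1, - (w ! (p + i)):] k)" if "i < q" for i k
    using neg[of "p + i"] that m by (cases k; cases "k - 1") (auto simp: coeff_pCons intro!: polynomial_at_const split: nat.split)
  have "polynomial_at m z (\<lambda>w. coeff ((\<Prod>i<p. [:- (w ! i), 1:]) * (\<Prod>i<q. [:1, - (w ! (p + i)):])) k)"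
    unfolding coeff_mult
    by (intro polynomial_at_sum polynomial_at_mult polynomial_at_coeff_prod 1 2) auto
  then show ?thesis by (rule polynomial_at_cong[THEN iffD1, rotated]) (simp add: eq)
qed

lemma polynomial_at_moment_det:
  assumes m: "m = p + q"
  shows "polynomial_at m z (\<lambda>w. moment_det lam (mset (take p w)) (mset (drop p w)))"
proof -
  let ?N = "length lam"
  have coeff: "polynomial_at m z (\<lambda>w. moment_coeff (mset (take p w)) (mset (drop p w)) i)" for i
  proof -
    have "moment_coeff (mset (take p w)) (mset (drop p w)) i =
        (if i + int p < 0 then 0 else coeff (moment_poly (mset (take p w)) (mset (drop p w))) (nat (i + int p)))"
      if "length w = m" for w
      using that m by (simp add: moment_coeff_def)
    moreover have "polynomial_at m z (\<lambda>w. if i + int p < 0 then 0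
        else coeff (moment_poly (mset (take p w)) (mset (drop p w))) (nat (i + int p)))"
      using polynomial_at_const[of m z 0] polynomial_at_moment_poly[OF m, of z "nat (i + int p)"]
      by (cases "i + int p < 0") (simp_all only: if_True if_False)
    ultimately show ?thesis by (rule polynomial_at_cong[THEN iffD2])
  qed
  show ?thesis
    unfolding moment_det_leibniz
    by (intro polynomial_at_sum polynomial_at_mult polynomial_at_prod coeff polynomial_at_const finite_permutations; simp)
qed

lemma swap_sum_continuation_moment_det:
  assumes "dominant_weight lam"
  shows "swap_sum_continuation lam p q (\<lambda>w. moment_det lam (mset (take p w)) (mset (drop p w)))"
  unfolding swap_sum_continuation_def
proof (intro conjI allI impI)
  show "analytic_everywhere (p + q) (\<lambda>w. moment_det lam (mset (take p w)) (mset (drop p w)))"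
    by (rule analytic_everywhere_polynomial) (rule polynomial_at_moment_det[OF refl])
  fix as bs :: "complex list"
  assume *: "length as = p \<and> length bs = q \<and> distinct as \<and> distinct bs \<and> generic (set as) (set bs)"
  then show "moment_det lam (mset (take p (as @ bs))) (mset (drop p (as @ bs))) = swap_sum lam (set as) (set bs)"
    using moment_det_generic[OF _ assms, of "set as" "set bs"] by (simp add: mset_set_set)
qed

theorem theorem1p2:
  fixes M :: "(complex^'n^'n) measure" and lam :: "int list"
  assumes haar: "haar_prob M"
    and len: "length lam = CARD('n)"
    and dom: "dominant_weight lam"
  shows "(\<forall>A B. generic A B \<longrightarrow>
            twisted_moment M (mset_set A) (mset_set B) lam = swap_sum lam A B) \<and>
         (\<forall>A B. (\<exists>F. swap_sum_continuation lam (size A) (size B) F) \<and>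
            (\<forall>F as bs. swap_sum_continuation lam (size A) (size B) F \<and>
                       mset as = A \<and> mset bs = B \<longrightarrow>
               twisted_moment M A B lam = F (as @ bs)))"
proof -
  interpret haar M by unfold_locales (rule haar)
  have moment: "twisted_moment M A B lam = moment_det lam A B" for A B
    by (rule twisted_moment_eq_moment_det[OF len])
  show ?thesis
  proof (intro conjI allI impI)
    show "twisted_moment M (mset_set A) (mset_set B) lam = swap_sum lam A B" if "generic A B" for A B
      unfolding moment by (rule moment_det_generic[OF that dom])
    show "\<exists>F. swap_sum_continuation lam (size A) (size B) F" for A B
      using swap_sum_continuation_moment_det[OF dom] by blast
    fix A B F and as bs :: "complex list"
    assume "swap_sum_continuation lam (size A) (size B) F \<and> mset as = A \<and> mset bs = B"
    then have F: "swap_sum_continuation lam (length as) (length bs) F" and AB: "A = mset as" "B = mset bs"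
      by auto
    \<comment> \<open>The determinant is itself a continuation, so any other one agrees with it at
      every point, including those with repeated or vanishing entries.\<close>
    have "F (as @ bs) = moment_det lam (mset (take (length as) (as @ bs))) (mset (drop (length as) (as @ bs)))"
      by (rule swap_sum_continuation_unique[OF F swap_sum_continuation_moment_det[OF dom]]) simp
    then show "twisted_moment M A B lam = F (as @ bs)" by (simp add: moment AB)
  qed
qed

end
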